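(* Let $n\ge 3$, $1\le k\le n-1$, and let $F$ be a Minkowski norm on $\mathbb{R}^n$ which is invariant under the standard block diagonal action of $SO(k)\times SO(n-k)$. Let $G_0$ be the identity component of the group of all isometries of the Riemannian manifold $(\mathbb{R}^n\setminus\{0\},g)$, where $g=\tfrac12 \mathrm{d}^2(F^2)$ is the Hessian metric of $F$. Then every element $\Phi\in G_0$ is the restriction to $\mathbb{R}^n\setminus\{0\}$ of a linear map. Moreover, if $F$ is not Euclidean, then $G_0$ (together with its action on $\mathbb{R}^n\setminus\{0\}$) coincides with the group $\{\mathrm{diag}(A',A'')\mid A'\in SO(k),\ A''\in SO(n-k)\}$ acting by matrix multiplication on column vectors.
   Context: A Minkowski norm on $\mathbb{R}^n$ is a continuous function $F:\mathbb{R}^n\to\mathbb{R}_{\ge 0}$, smooth and positive on $\mathbb{R}^n\setminus\{0\}$, positively $1$-homogeneous ($F(\lambda y)=\lambda F(y)$ for $\lambda\ge 0$), such that the Hessian $\mathrm{d}^2E=\big(\partial^2E/\partial x_i\partial x_j\big)$ of $E=\tfrac12F^2$ is positive definite at every point of $\mathbb{R}^n\setminus\{0\}$. The Hessian metric of $F$ is the Riemannian metric $g=\mathrm{d}^2E$ on $\mathbb{R}^n\setminus\{0\}$. $F$ is called Euclidean if $F(x)=\sqrt{\sum_{i,j}\alpha_{ij}x_ix_j}$ for some positive definite symmetric matrix $(\alpha_{ij})$. The standard block diagonal action of $SO(k)\times SO(n-k)$ on $\mathbb{R}^n$ (column vectors) is left multiplication by the matrices $\mathrm{diag}(A',A'')$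 with $A'\in SO(k)$, $A''\in SO(n-k)$. *)

theory Defs
  imports "HOL-Analysis.Analysis"
begin

definition partial :: "'n::finite \<Rightarrow> (real^'n \<Rightarrow> real) \<Rightarrow> real^'n \<Rightarrow> real" where
  "partial i f x = deriv (\<lambda>t. f (x + t *\<^sub>R axis i 1)) 0"

fun iter_partial :: "'n::finite list \<Rightarrow> (real^'n \<Rightarrow> real) \<Rightarrow> real^'n \<Rightarrow> real" where
  "iter_partial [] f = f"
| "iter_partial (i # is) f = partial i (iter_partial is f)"

definition smooth_on :: "(real^'n::finite) set \<Rightarrow> (real^'n \<Rightarrow> real) \<Rightarrow> bool" where
  "smooth_on U f \<longleftrightarrow>
     (\<forall>is. continuous_on U (iter_partial is f) \<and>
        (\<forall>i. \<forall>x\<in>U. (\<lambda>t. iter_partial is f (x + t *\<^sub>R axis i 1)) differentiable (at 0)))"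

definition smooth_map_on :: "(real^'n::finite) set \<Rightarrow> (real^'n \<Rightarrow> real^'m::finite) \<Rightarrow> bool" where
  "smooth_map_on U \<Phi> \<longleftrightarrow> (\<forall>j. smooth_on U (\<lambda>x. \<Phi> x $ j))"

definition jacobian :: "(real^'n::finite \<Rightarrow> real^'m::finite) \<Rightarrow> real^'n \<Rightarrow> real^'n^'m" where
  "jacobian \<Phi> x = (\<chi> i j. partial j (\<lambda>y. \<Phi> y $ i) x)"

definition hessian :: "(real^'n::finite \<Rightarrow> real) \<Rightarrow> real^'n \<Rightarrow> real^'n^'n" where
  "hessian E x = (\<chi> i j. partial i (partial j E) x)"

definition pos_def_matrix :: "real^'n::finite^'n \<Rightarrow> bool" where
  "pos_def_matrix A \<longleftrightarrow> (\<forall>v. v \<noteq> 0 \<longrightarrow> v \<bullet> (A *v v) > 0)"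

abbreviation punct :: "(real^'n::finite) set" where
  "punct \<equiv> UNIV - {0}"

definition minkowski_norm :: "(real^'n::finite \<Rightarrow> real) \<Rightarrow> bool" where
  "minkowski_norm F \<longleftrightarrow>
     continuous_on UNIV F \<and> (\<forall>y. F y \<ge> 0) \<and>
     smooth_on punct F \<and> (\<forall>y\<in>punct. F y > 0) \<and>
     (\<forall>c y. c \<ge> 0 \<longrightarrow> F (c *\<^sub>R y) = c * F y) \<and>
     (\<forall>y\<in>punct. pos_def_matrix (hessian (\<lambda>x. (F x)\<^sup>2 / 2) y))"

definition hess_metric :: "(real^'n::finite \<Rightarrow> real) \<Rightarrow> real^'n \<Rightarrow> real^'n \<Rightarrow> real^'n \<Rightarrow> real" where
  "hess_metric F x u v = u \<bullet> (hessian (\<lambda>y. (F y)\<^sup>2 / 2) x *v v)"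

definition euclidean_norm :: "(real^'n::finite \<Rightarrow> real) \<Rightarrow> bool" where
  "euclidean_norm F \<longleftrightarrow>
     (\<exists>\<alpha>::real^'n^'n. transpose \<alpha> = \<alpha> \<and> pos_def_matrix \<alpha> \<and>
        (\<forall>x. F x = sqrt (x \<bullet> (\<alpha> *v x))))"

text \<open>Isometries of (R^n - 0, g): smooth diffeomorphisms of the punctured space preserving g.
  Maps are represented as total functions with the convention that the origin is sent to itself.\<close>
definition isometries :: "(real^'n::finite \<Rightarrow> real) \<Rightarrow> (real^'n \<Rightarrow> real^'n) set" where
  "isometries F = {\<Phi>. \<Phi> 0 = 0 \<and> bij_betw \<Phi> punct punct \<and>
      smooth_map_on punct \<Phi> \<and> smooth_map_on punct (inv_into punct \<Phi>) \<and>
      (\<forall>x\<in>punct. \<forall>u v. hess_metric F (\<Phi> x) (jacobian \<Phi> x *v u) (jacobian \<Phi> x *v v)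
                        = hess_metric F x u v)}"

definition compact_open :: "(real^'n::finite \<Rightarrow> real^'n) topology" where
  "compact_open = topology_generated_by
     {{f. f ` K \<subseteq> V} | K V. compact K \<and> K \<subseteq> punct \<and> open V}"

definition isom_identity_component :: "(real^'n::finite \<Rightarrow> real) \<Rightarrow> (real^'n \<Rightarrow> real^'n) set" where
  "isom_identity_component F =
     {\<Phi>. connected_component_of (subtopology compact_open (isometries F)) id \<Phi>}"

definition SO_matrix :: "real^'n::finite^'n \<Rightarrow> bool" where
  "SO_matrix A \<longleftrightarrow> orthogonal_matrix A \<and> det A = 1"

text \<open>Block diagonal matrix diag(A', A'') on R^(k + (n-k)); the index type 'k + 'm lists the
  first k coordinates (Inl) before the last n-k coordinates (Inr).\<close>
definition block_diag :: "real^'k::finite^'k \<Rightarrow> real^'m::finite^'m \<Rightarrow> real^('k + 'm)^('k + 'm)" where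
  "block_diag A B = (\<chi> i j. case (i, j) of
      (Inl a, Inl b) \<Rightarrow> A $ a $ b
    | (Inr a, Inr b) \<Rightarrow> B $ a $ b
    | _ \<Rightarrow> 0)"

end

(* The metric g of a Minkowski norm F is a cone: F is the distance to the origin, which is the only
   point missing from the metric completion, so every isometry preserves F. The curvature of a
   Hessian metric involves only third derivatives of the potential E = F^2/2, and the set of points
   where it vanishes is preserved by isometries.

   Up to the symmetry group, a point is described by the norms (a, b) of its two components, hence by
   F and a polar angle. The curvature vanishes on the orbit where the angle is 0, because there the
   third derivatives are odd under a half turn. If it vanishes everywhere, then the mixed derivative
   of E with respect to a and b satisfies an ODE along the profile which forces it to be 0, and
   F is Euclidean. Otherwise some level of the angle bounds a set of curved levels; orbits of the
   identity component are connected, so this level is preserved, and since the angle measured by arc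
   length is the distance to that level, all levels are preserved. An isometry that preserves a and b
   splits into isometries of the two blocks, on which g is a constant multiple of the Euclidean
   metric, so it is linear and orthogonal. *)
theory Submission
  imports Defs
begin

subsection \<open>Directional derivatives of smooth functions\<close>

text \<open>Distances, geodesics and the completion never appear as such. Each metric argument
  compares a curve of known metric speed with a function whose derivative is bounded by that speed:
  a ray shows that an isometry cannot increase \<open>F\<close>, a meridian that it cannot increase
  the distance to a preserved level of the angle, a segment that it cannot increase distances within
  a block. The inverse isometry turns each inequality into an equality. Curvature is likewise just
  the formula \<open>kap\<close>, whose invariance follows by differentiating the isometry condition
  twice.

  The preserved level is the largest flat angle below some curved angle. It is an edge: a connected
  orbit cannot leave it upwards without meeting curved points, and the curved points just above it
  cannot drop below it. Connectedness also excludes the swap of the two sides.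

  The flat case rotates inside one block, so \<open>\<pi>\<close> projects onto the other one, which
  may be a line; for \<open>n >= 3\<close> at least one block has room to rotate.

  Smoothness is given by iterated partial derivatives, so total derivatives and the symmetry of
  second derivatives are derived first.\<close>

definition dd :: "real^'n::finite \<Rightarrow> (real^'n \<Rightarrow> real) \<Rightarrow> real^'n \<Rightarrow> real" where
  "dd v f x = (\<Sum>i\<in>UNIV. v $ i * partial i f x)"

lemma dd_axis [simp]: "dd (axis i 1) f x = partial i f x"
  by (simp add: dd_def axis_def if_distrib [of "\<lambda>c. c * _"] cong: if_cong)

lemma dd_add: "dd (u + v) f x = dd u f x + dd v f x"
  and dd_scaleR: "dd (c *\<^sub>R v) f x = c * dd v f x"
  by (simp_all add: dd_def algebra_simps sum.distrib sum_distrib_left)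

lemma linear_dd: "linear (\<lambda>v. dd v f x)"
  by (rule linearI) (simp_all add: dd_add dd_scaleR)

text \<open>Since \<open>dd\<close> is built from partial derivatives, it makes sense for every
  function. Where a total derivative exists it agrees with \<open>dd\<close>, and the calculus rules
  for \<open>dd\<close> are obtained through this.\<close>

lemma dd_unique:
  assumes "(f has_derivative D) (at x)"
  shows "dd v f x = D v"
proof -
  interpret D: bounded_linear D using assms by (rule has_derivative_bounded_linear)
  have *: "partial i f x = D (axis i 1)" for i
  proof -
    have "((\<lambda>t. f (x + t *\<^sub>R axis i 1)) has_derivative (\<lambda>t. D (t *\<^sub>R axis i 1))) (at 0)"
      by (rule has_derivative_compose[where g=f and f="\<lambda>t. x + t *\<^sub>R axis i 1"])
         (use assms in \<open>auto intro!: derivative_eq_intros\<close>)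
    hence "((\<lambda>t. f (x + t *\<^sub>R axis i 1)) has_field_derivative D (axis i 1)) (at 0)"
      by (simp add: has_field_derivative_def D.scaleR mult.commute[of "D _"] mult_commute_abs)
    thus ?thesis unfolding partial_def by (rule DERIV_imp_deriv)
  qed
  have "D v = D (\<Sum>i\<in>UNIV. v $ i *\<^sub>R axis i 1)"
    by (simp add: basis_expansion scalar_mult_eq_scaleR[symmetric])
  also have "\<dots> = dd v f x" by (simp add: D.sum D.scaleR dd_def *)
  finally show ?thesis ..
qed

text \<open>The increment is built up one coordinate at a time. The induction runs over the set
  \<open>A\<close> of coordinates in which \<open>h\<close> may be nonzero, and each new coordinate
  costs one mean value estimate.\<close>

lemma has_derivative_continuous_partials:
  fixes f :: "real^'n::finite \<Rightarrow> real"
  assumes U: "open U" "x \<in> U"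
    and p: "\<And>y i. y \<in> U \<Longrightarrow> ((\<lambda>t. f (y + t *\<^sub>R axis i 1)) has_real_derivative p i y) (at 0)"
    and c: "\<And>i. continuous_on U (p i)"
  shows "(f has_derivative (\<lambda>v. \<Sum>i\<in>UNIV. v $ i * p i x)) (at x)"
proof -
  have claim: "\<forall>e>0. \<exists>d>0. \<forall>h. norm h < d \<and> (\<forall>i. i \<notin> A \<longrightarrow> h $ i = 0) \<longrightarrow>
          \<bar>f (x + h) - f x - (\<Sum>i\<in>A. h $ i * p i x)\<bar> \<le> e * norm h" for A
  proof (induction A rule: finite_induct[OF finite])
    case 1
    have "\<bar>f (x + h) - f x - (\<Sum>i\<in>{}. h $ i * p i x)\<bar> \<le> e * norm h" if "\<forall>i. i \<notin> {} \<longrightarrow> h $ i = 0" for e :: real and h :: "real^'n"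
    proof -
      have "h = 0" using that by (simp add: vec_eq_iff)
      thus ?thesis by simp
    qed
    then show ?case by (intro allI impI exI[of _ 1]) simp
  next
    case (2 i A)
    show ?case
    proof (intro allI impI)
      fix e :: real assume e: "e > 0"
      \<comment> \<open>Half of the error goes to the coordinates in \<open>A\<close>, half to the
        new coordinate \<open>i\<close>.\<close>
      hence "e/2 > 0" by simp
      with 2(3) obtain d1 where d1: "d1 > 0" and
        D1: "\<And>h. norm h < d1 \<Longrightarrow> (\<forall>i. i \<notin> A \<longrightarrow> h $ i = 0) \<Longrightarrow>
          \<bar>f (x + h) - f x - (\<Sum>i\<in>A. h $ i * p i x)\<bar> \<le> e/2 * norm h" by meson
      obtain d2 where d2: "d2 > 0" "ball x d2 \<subseteq> U" using U open_contains_ball by blast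
      have "\<exists>d>0. \<forall>y\<in>U. dist y x < d \<longrightarrow> dist (p i y) (p i x) < e/2"
        using c[of i] U(2) \<open>e/2 > 0\<close> unfolding continuous_on_iff by blast
      then obtain d3 where d3: "d3 > 0" "\<And>y. y \<in> U \<Longrightarrow> dist y x < d3 \<Longrightarrow> dist (p i y) (p i x) < e/2"
        by blast
      show "\<exists>d>0. \<forall>h. norm h < d \<and> (\<forall>j. j \<notin> insert i A \<longrightarrow> h $ j = 0) \<longrightarrow>
          \<bar>f (x + h) - f x - (\<Sum>i\<in>insert i A. h $ i * p i x)\<bar> \<le> e * norm h"
      proof (intro exI[of _ "min d1 (min d2 d3)"] conjI allI impI)
        show "min d1 (min d2 d3) > 0" using d1 d2 d3 by simp
        fix h :: "real^'n"
        assume h: "norm h < min d1 (min d2 d3) \<and> (\<forall>j. j \<notin> insert i A \<longrightarrow> h $ j = 0)"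
        define h' where "h' = h - h $ i *\<^sub>R axis i 1"
        have h'c: "h' $ j = (if j = i then 0 else h $ j)" for j
          by (simp add: h'_def axis_def)
        have nle: "norm (h' + t *\<^sub>R axis i 1) \<le> norm h" if "t \<in> closed_segment 0 (h $ i)" for t
        proof (rule norm_le_componentwise_cart)
          fix j
          have "\<bar>t\<bar> \<le> \<bar>h $ i\<bar>" using that by (auto simp: closed_segment_eq_real_ivl split: if_splits)
          thus "norm ((h' + t *\<^sub>R axis i 1) $ j) \<le> norm (h $ j)"
            by (auto simp: h'c axis_def)
        qed
        have hh': "norm h' \<le> norm h" using nle[of 0] by simp
        have inU: "x + h' + t *\<^sub>R axis i 1 \<in> U" and near: "dist (x + h' + t *\<^sub>R axis i 1) x < d3"
          if "t \<in> closed_segment 0 (h $ i)" for t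
        proof -
          have *: "dist (x + h' + t *\<^sub>R axis i 1) x < min d2 d3"
            using nle[OF that] h by (simp add: dist_norm algebra_simps)
          show "dist (x + h' + t *\<^sub>R axis i 1) x < d3" using * by simp
          show "x + h' + t *\<^sub>R axis i 1 \<in> U" using * d2 by (auto simp: dist_commute)
        qed
        \<comment> \<open>With the linear term subtracted, the derivative of \<open>g\<close> is the
          oscillation of \<open>p i\<close> near \<open>x\<close>, which continuity makes smaller
          than \<open>e/2\<close>.\<close>
        define g where "g = (\<lambda>t. f (x + h' + t *\<^sub>R axis i 1) - t * p i x)"
        have "norm (g (h $ i) - g 0) \<le> e/2 * norm (h $ i - 0)"
        proof (rule field_differentiable_bound[of "closed_segment 0 (h $ i)"])
          show "(g has_field_derivative (p i (x + h' + t *\<^sub>R axis i 1) - p i x)) (at t within closed_segment 0 (h $ i))"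
            if "t \<in> closed_segment 0 (h $ i)" for t
          proof -
            have "((\<lambda>s. f (x + h' + t *\<^sub>R axis i 1 + s *\<^sub>R axis i 1)) has_real_derivative p i (x + h' + t *\<^sub>R axis i 1)) (at (t - t))"
              using p[OF inU[OF that]] by simp
            hence "((\<lambda>s. f (x + h' + t *\<^sub>R axis i 1 + (s - t) *\<^sub>R axis i 1)) has_real_derivative p i (x + h' + t *\<^sub>R axis i 1) * 1) (at t)"
              by (rule DERIV_chain2[where g="\<lambda>s. s - t" and f="\<lambda>s. f (x + h' + t *\<^sub>R axis i 1 + s *\<^sub>R axis i 1)"])
                 (auto intro!: derivative_eq_intros)
            moreover have "x + h' + t *\<^sub>R axis i 1 + (s - t) *\<^sub>R axis i 1 = x + h' + s *\<^sub>R axis i 1" for s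
              by (simp add: scaleR_left_diff_distrib)
            ultimately have "((\<lambda>s. f (x + h' + s *\<^sub>R axis i 1)) has_real_derivative p i (x + h' + t *\<^sub>R axis i 1)) (at t)"
              by simp
            moreover have "((\<lambda>t. t * p i x) has_real_derivative p i x) (at t)"
              using DERIV_cmult_right[OF DERIV_ident, of "p i x"] by simp
            ultimately show ?thesis unfolding g_def
              by (rule has_field_derivative_at_within[OF DERIV_diff])
          qed
          show "norm (p i (x + h' + t *\<^sub>R axis i 1) - p i x) \<le> e/2" if "t \<in> closed_segment 0 (h $ i)" for t
            using d3(2)[OF inU[OF that] near[OF that]] by (simp add: dist_norm)
        qed auto
        moreover have "g (h $ i) = f (x + h) - h $ i * p i x" "g 0 = f (x + h')"
          by (auto simp: g_def h'_def algebra_simps)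
        ultimately have 1: "\<bar>f (x + h) - h $ i * p i x - f (x + h')\<bar> \<le> e/2 * norm h"
          using component_le_norm_cart[of h i] e
          by (smt (verit) mult_left_mono real_norm_def divide_pos_pos zero_less_numeral)
        have "\<bar>f (x + h') - f x - (\<Sum>j\<in>A. h' $ j * p j x)\<bar> \<le> e/2 * norm h'"
          by (rule D1) (use h hh' in \<open>auto simp: h'c\<close>)
        moreover have "(\<Sum>j\<in>A. h' $ j * p j x) = (\<Sum>j\<in>A. h $ j * p j x)"
          by (rule sum.cong) (use 2 in \<open>auto simp: h'c\<close>)
        ultimately have 2: "\<bar>f (x + h') - f x - (\<Sum>j\<in>A. h $ j * p j x)\<bar> \<le> e/2 * norm h"
          using hh' e by (smt (verit) mult_left_mono divide_pos_pos zero_less_numeral)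
        have "(\<Sum>j\<in>insert i A. h $ j * p j x) = h $ i * p i x + (\<Sum>j\<in>A. h $ j * p j x)"
          using 2 \<open>finite A\<close> \<open>i \<notin> A\<close> by simp
        moreover have "e * norm h = e/2 * norm h + e/2 * norm h" by simp
        ultimately show "\<bar>f (x + h) - f x - (\<Sum>j\<in>insert i A. h $ j * p j x)\<bar> \<le> e * norm h"
          using 1 2 by linarith
      qed
    qed
  qed
  have lin: "bounded_linear (\<lambda>v. \<Sum>i\<in>UNIV. v $ i * p i x)"
    by (intro bounded_linear_sum bounded_linear_mult_const bounded_linear_vec_nth bounded_linear_ident)
  show ?thesis unfolding has_derivative_at_alt
  proof (intro conjI lin allI impI)
    fix e :: real assume "e > 0"
    with claim[of UNIV] obtain d where "d > 0" and
      d: "\<And>h. norm h < d \<Longrightarrow> \<bar>f (x + h) - f x - (\<Sum>i\<in>UNIV. h $ i * p i x)\<bar> \<le> e * norm h" by auto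
    show "\<exists>d>0. \<forall>y. norm (y - x) < d \<longrightarrow> norm (f y - f x - (\<Sum>i\<in>UNIV. (y - x) $ i * p i x)) \<le> e * norm (y - x)"
      using \<open>d > 0\<close> d[of "y - x" for y] by (auto intro!: exI[of _ d])
  qed
qed

section \<open>Smooth functions and their closure properties\<close>

lemma smooth_on_continuous: "smooth_on U f \<Longrightarrow> continuous_on U f"
  unfolding smooth_on_def by (metis iter_partial.simps(1))

lemma iter_partial_append: "iter_partial (is @ js) f = iter_partial is (iter_partial js f)"
  by (induction "is") auto

lemma smooth_on_partial: "smooth_on U f \<Longrightarrow> smooth_on U (partial i f)"
  unfolding smooth_on_def iter_partial_append[of _ "[i]" f, unfolded iter_partial.simps, symmetric]
  by blast

lemma smooth_on_has_partial:
  assumes "smooth_on U f" "x \<in> U"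
  shows "((\<lambda>t. f (x + t *\<^sub>R axis i 1)) has_real_derivative partial i f x) (at 0)"
proof -
  have "(\<lambda>t. f (x + t *\<^sub>R axis i 1)) differentiable (at 0)"
    using assms unfolding smooth_on_def by (metis iter_partial.simps(1))
  thus ?thesis unfolding partial_def
    using DERIV_deriv_iff_real_differentiable by blast
qed

lemma smooth_on_has_derivative:
  assumes "smooth_on U f" "open U" "x \<in> U"
  shows "(f has_derivative (\<lambda>v. dd v f x)) (at x)"
  unfolding dd_def
  by (rule has_derivative_continuous_partials[OF assms(2,3)])
     (use assms smooth_on_has_partial smooth_on_partial smooth_on_continuous in blast)+

lemma dd_cong:
  assumes "open U" "x \<in> U" "\<And>y. y \<in> U \<Longrightarrow> f y = g y"
  shows "dd v f x = dd v g x"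
proof -
  have "partial i f x = partial i g x" for i unfolding partial_def
  proof (rule deriv_cong_ev)
    have "isCont (\<lambda>t. x + t *\<^sub>R axis i 1) 0" by (intro continuous_intros)
    hence "\<forall>\<^sub>F t in at 0. x + t *\<^sub>R axis i 1 \<in> U"
      using assms(1,2) by (metis (no_types, lifting) add.right_neutral continuous_at_open eventually_at_topological scaleR_zero_left)
    hence "\<forall>\<^sub>F t in nhds 0. x + t *\<^sub>R axis i 1 \<in> U" using assms(2)
      by (simp add: eventually_nhds_conv_at)
    thus "\<forall>\<^sub>F t in nhds 0. f (x + t *\<^sub>R axis i 1) = g (x + t *\<^sub>R axis i 1)"
      by eventually_elim (use assms in auto)
  qed simp
  thus ?thesis by (simp add: dd_def)
qed

text \<open>Smoothness quantifies over all finite lists of partial derivatives. Any class of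
  differentiable functions that is closed under partial derivatives, up to equality on
  \<open>U\<close>, therefore consists of smooth functions; only the class has to be found.\<close>

lemma smooth_on_coinduct:
  assumes U: "open U" and P: "P f"
    and "\<And>f. P f \<Longrightarrow> continuous_on U f"
    and "\<And>f x. P f \<Longrightarrow> x \<in> U \<Longrightarrow> f differentiable (at x)"
    and "\<And>f i. P f \<Longrightarrow> \<exists>g. P g \<and> (\<forall>x\<in>U. partial i f x = g x)"
  shows "smooth_on U f"
proof -
  have *: "\<exists>g. P g \<and> (\<forall>x\<in>U. iter_partial is f x = g x)" for "is"
  proof (induction "is")
    case Nil then show ?case using P by auto
  next
    case (Cons i "is")
    then obtain g where g: "P g" "\<forall>x\<in>U. iter_partial is f x = g x" by blast
    obtain h where h: "P h" "\<forall>x\<in>U. partial i g x = h x" using assms(5) g by blast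
    have "iter_partial (i # is) f x = h x" if "x \<in> U" for x
      using dd_cong[OF U that, of "iter_partial is f" g "axis i 1"] g(2) h(2) that by simp
    with h show ?case by blast
  qed
  show ?thesis unfolding smooth_on_def
  proof (intro allI conjI ballI)
    fix "is"
    obtain g where g: "P g" "\<forall>x\<in>U. iter_partial is f x = g x" using * by blast
    show "continuous_on U (iter_partial is f)"
      using assms(3)[OF g(1)] g(2) by (metis continuous_on_cong)
    fix i x assume x: "x \<in> U"
    obtain D where "(g has_derivative D) (at x)"
      using assms(4)[OF g(1) x] unfolding differentiable_def by blast
    hence "(iter_partial is f has_derivative D) (at x)"
      by (rule has_derivative_transform_within_open[OF _ U x]) (use g in auto)
    hence "((\<lambda>t. iter_partial is f (x + t *\<^sub>R axis i 1)) has_derivative (\<lambda>t. D (t *\<^sub>R axis i 1))) (at 0)"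
      by (intro has_derivative_compose[where g="iter_partial is f" and f="\<lambda>t. x + t *\<^sub>R axis i 1"])
         (auto intro!: derivative_eq_intros)
    thus "(\<lambda>t. iter_partial is f (x + t *\<^sub>R axis i 1)) differentiable (at 0)"
      unfolding differentiable_def by blast
  qed
qed

lemma smooth_on_cong:
  assumes "smooth_on U f" "open U" "\<And>x. x \<in> U \<Longrightarrow> f x = g x"
  shows "smooth_on U g"
proof (rule smooth_on_coinduct[where P="\<lambda>h. \<exists>f. smooth_on U f \<and> (\<forall>x\<in>U. f x = h x)"])
  show "\<exists>f. smooth_on U f \<and> (\<forall>x\<in>U. f x = g x)" using assms by blast
  fix h assume "\<exists>f. smooth_on U f \<and> (\<forall>x\<in>U. f x = h x)"
  then obtain f where f: "smooth_on U f" "\<forall>x\<in>U. f x = h x" by blast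
  show "continuous_on U h" using smooth_on_continuous[OF f(1)] f(2) by (metis continuous_on_cong)
  show "h differentiable at x" if "x \<in> U" for x
    using has_derivative_transform_within_open[OF smooth_on_has_derivative[OF f(1) assms(2) that] assms(2) that, of h] f(2)
    unfolding differentiable_def by blast
  show "\<exists>g. (\<exists>f. smooth_on U f \<and> (\<forall>x\<in>U. f x = g x)) \<and> (\<forall>x\<in>U. partial i h x = g x)" for i
  proof -
    have "partial i f x = partial i h x" if "x \<in> U" for x
      using dd_cong[OF assms(2) that, of f h "axis i 1"] f by simp
    thus ?thesis using smooth_on_partial[OF f(1), of i] by metis
  qed
qed fact

lemma smooth_on_affine:
  fixes U :: "(real^'n::finite) set"
  assumes "open U"
  shows "smooth_on U (\<lambda>x. c + v \<bullet> x)"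
proof (rule smooth_on_coinduct[where P="\<lambda>f. \<exists>c v. f = (\<lambda>x. c + v \<bullet> x)"])
  fix f :: "real^'n \<Rightarrow> real" and i assume "\<exists>c v. f = (\<lambda>x. c + v \<bullet> x)"
  then obtain c v where f: "f = (\<lambda>x. c + v \<bullet> x)" by blast
  have D: "(f has_derivative (\<lambda>w. v \<bullet> w)) (at x)" for x
    unfolding f by (auto intro!: derivative_eq_intros)
  show "continuous_on U f" unfolding f by (intro continuous_intros)
  show "f differentiable at x" for x using D unfolding differentiable_def by blast
  have "partial i f x = v \<bullet> axis i 1" for x using dd_unique[OF D, of "axis i 1"] by simp
  thus "\<exists>g. (\<exists>c v. g = (\<lambda>x. c + v \<bullet> x)) \<and> (\<forall>x\<in>U. partial i f x = g x)"
    by (intro exI[of _ "\<lambda>x. v \<bullet> axis i 1 + 0 \<bullet> x"] conjI exI[of _ "v \<bullet> axis i 1"] exI[of _ 0]) auto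
qed (use assms in auto)

lemma smooth_on_const: "open U \<Longrightarrow> smooth_on U (\<lambda>x. c)"
  using smooth_on_affine[of U c 0] by simp

lemma smooth_on_inner: "open U \<Longrightarrow> smooth_on U (\<lambda>x. v \<bullet> x)"
  using smooth_on_affine[of U 0 v] by simp

lemma smooth_on_nth: "open U \<Longrightarrow> smooth_on U (\<lambda>x. x $ j)"
  using smooth_on_inner[of U "axis j 1"] by (simp add: inner_axis inner_commute)

section \<open>Smooth maps between vector spaces and the chain rule\<close>

lemma has_derivative_vec:
  fixes \<Phi> :: "real^'n::finite \<Rightarrow> real^'m::finite"
  assumes "\<And>j. ((\<lambda>x. \<Phi> x $ j) has_derivative (\<lambda>v. D v $ j)) (at x)"
  shows "(\<Phi> has_derivative D) (at x)"
proof -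
  have "((\<lambda>x. \<Phi> x \<bullet> b) has_derivative (\<lambda>v. D v \<bullet> b)) (at x)" if b: "b \<in> Basis" for b
  proof -
    obtain j :: 'm where "b = axis j 1" using b by (auto simp: Basis_vec_def)
    thus ?thesis using assms[of j] by (simp add: inner_axis)
  qed
  thus ?thesis using has_derivative_componentwise_within by blast
qed

definition ddv :: "real^'n::finite \<Rightarrow> (real^'n \<Rightarrow> real^'m::finite) \<Rightarrow> real^'n \<Rightarrow> real^'m" where
  "ddv v \<Phi> x = (\<chi> j. dd v (\<lambda>y. \<Phi> y $ j) x)"

lemma ddv_nth [simp]: "ddv v \<Phi> x $ j = dd v (\<lambda>y. \<Phi> y $ j) x"
  by (simp add: ddv_def)

lemma ddv_add: "ddv (u + v) \<Phi> x = ddv u \<Phi> x + ddv v \<Phi> x"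
  and ddv_scaleR: "ddv (c *\<^sub>R v) \<Phi> x = c *\<^sub>R ddv v \<Phi> x"
  by (simp_all add: vec_eq_iff dd_add dd_scaleR)

lemma linear_ddv: "linear (\<lambda>v. ddv v \<Phi> x)"
  by (rule linearI) (simp_all add: ddv_add ddv_scaleR)

lemma jacobian_mult: "jacobian \<Phi> x *v v = ddv v \<Phi> x"
  by (simp add: vec_eq_iff jacobian_def matrix_vector_mult_def dd_def mult.commute)

lemma ddv_unique:
  assumes "(\<Phi> has_derivative D) (at x)"
  shows "ddv v \<Phi> x = D v"
proof -
  have "((\<lambda>x. \<Phi> x $ j) has_derivative (\<lambda>v. D v $ j)) (at x)" for j
    by (rule bounded_linear.has_derivative[OF bounded_linear_vec_nth assms])
  from dd_unique[OF this] show ?thesis by (simp add: vec_eq_iff)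
qed

lemma smooth_map_has_derivative:
  assumes "smooth_map_on U \<Phi>" "open U" "x \<in> U"
  shows "(\<Phi> has_derivative (\<lambda>v. ddv v \<Phi> x)) (at x)"
  by (rule has_derivative_vec) (use assms smooth_on_has_derivative in \<open>auto simp: smooth_map_on_def\<close>)

lemma smooth_map_continuous:
  assumes "smooth_map_on U \<Phi>" "open U"
  shows "continuous_on U \<Phi>"
  using smooth_map_has_derivative[OF assms]
  by (meson continuous_at_imp_continuous_on has_derivative_continuous)

text \<open>The smooth functions on \<open>U\<close> and the pullbacks of smooth functions generate an algebra
  that is closed under partial derivatives by the chain rule.\<close>

inductive pullback_alg for U :: "(real^'n::finite) set" and \<Phi> :: "real^'n \<Rightarrow> real^'m::finite" and V where
  base: "smooth_on U f \<Longrightarrow> pullback_alg U \<Phi> V f"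
| comp: "smooth_on V f \<Longrightarrow> pullback_alg U \<Phi> V (\<lambda>x. f (\<Phi> x))"
| plus: "pullback_alg U \<Phi> V f \<Longrightarrow> pullback_alg U \<Phi> V g \<Longrightarrow> pullback_alg U \<Phi> V (\<lambda>x. f x + g x)"
| mult: "pullback_alg U \<Phi> V f \<Longrightarrow> pullback_alg U \<Phi> V g \<Longrightarrow> pullback_alg U \<Phi> V (\<lambda>x. f x * g x)"

lemma has_derivative_comp_dd:
  assumes f: "smooth_on V f" "open V" "\<Phi> x \<in> V" and \<Phi>: "(\<Phi> has_derivative D) (at x within S)"
  shows "((\<lambda>x. f (\<Phi> x)) has_derivative (\<lambda>v. dd (D v) f (\<Phi> x))) (at x within S)"
  by (rule has_derivative_compose[OF \<Phi>]) (rule smooth_on_has_derivative[OF f])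

lemma pullback_alg_smooth:
  assumes UV: "open U" "open V" "\<Phi> ` U \<subseteq> V" and \<Phi>: "smooth_map_on U \<Phi>"
    and h: "pullback_alg U \<Phi> V h"
  shows "smooth_on U h"
proof (rule smooth_on_coinduct[where P="pullback_alg U \<Phi> V"])
  have D: "(f has_derivative (\<lambda>v. dd v f x)) (at x)" if "pullback_alg U \<Phi> V f" "x \<in> U" for f x
  proof -
    have "\<exists>D. (f has_derivative D) (at x)" using that
    proof (induction rule: pullback_alg.induct)
      case (base f)
      then show ?case using smooth_on_has_derivative UV by blast
    next
      case (comp f)
      have "\<Phi> x \<in> V" using comp UV by blast
      show ?case
        using has_derivative_comp_dd[OF comp(1) UV(2) \<open>\<Phi> x \<in> V\<close> smooth_map_has_derivative[OF \<Phi> UV(1) comp(2)]]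
        by blast
    next
      case (plus f g)
      then show ?case using has_derivative_add by blast
    next
      case (mult f g)
      then show ?case using has_derivative_mult by blast
    qed
    thus ?thesis using dd_unique by (metis (no_types, lifting) ext)
  qed
  show "f differentiable at x" if "pullback_alg U \<Phi> V f" "x \<in> U" for f x
    using D[OF that] unfolding differentiable_def by blast
  show "continuous_on U f" if "pullback_alg U \<Phi> V f" for f
    using D[OF that] by (meson continuous_at_imp_continuous_on has_derivative_continuous)
  have sum_alg: "pullback_alg U \<Phi> V (\<lambda>x. \<Sum>j\<in>A. F j x)"
    if "finite A" "\<And>j. j \<in> A \<Longrightarrow> pullback_alg U \<Phi> V (F j)" for A :: "'m set" and F
    using that
  proof (induction A rule: finite_induct)
    case empty
    then show ?case using pullback_alg.base[OF smooth_on_const[OF UV(1)]] by simp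
  next
    case (insert i A)
    then show ?case using pullback_alg.plus[of U \<Phi> V "F i" "\<lambda>x. \<Sum>j\<in>A. F j x"] by simp
  qed
  show "\<exists>g. pullback_alg U \<Phi> V g \<and> (\<forall>x\<in>U. partial i f x = g x)" if "pullback_alg U \<Phi> V f" for f i
    using that
  proof (induction rule: pullback_alg.induct)
    case (base f)
    then show ?case using smooth_on_partial pullback_alg.base by blast
  next
    case (comp f)
    have "partial i (\<lambda>x. f (\<Phi> x)) x = (\<Sum>j\<in>UNIV. partial i (\<lambda>x. \<Phi> x $ j) x * partial j f (\<Phi> x))" if "x \<in> U" for x
    proof -
      have "\<Phi> x \<in> V" using that UV by blast
      from dd_unique[OF has_derivative_comp_dd[OF comp(1) UV(2) this smooth_map_has_derivative[OF \<Phi> UV(1) that]],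
          of "axis i 1"]
      show ?thesis by (simp add: dd_def[of "ddv _ _ _"])
    qed
    moreover have "pullback_alg U \<Phi> V (\<lambda>x. \<Sum>j\<in>UNIV. partial i (\<lambda>x. \<Phi> x $ j) x * partial j f (\<Phi> x))"
      by (intro sum_alg pullback_alg.mult[of U \<Phi> V "partial i (\<lambda>x. \<Phi> x $ j)" "\<lambda>x. partial j f (\<Phi> x)" for j]
            pullback_alg.base pullback_alg.comp smooth_on_partial)
         (use \<Phi> comp in \<open>auto simp: smooth_map_on_def\<close>)
    ultimately show ?case by blast
  next
    case (plus f g)
    then obtain f' g' where f': "pullback_alg U \<Phi> V f'" "\<forall>x\<in>U. partial i f x = f' x"
      and g': "pullback_alg U \<Phi> V g'" "\<forall>x\<in>U. partial i g x = g' x" by blast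
    have "partial i (\<lambda>x. f x + g x) x = f' x + g' x" if "x \<in> U" for x
      using dd_unique[OF has_derivative_add[OF D[OF plus(1) that] D[OF plus(2) that]], of "axis i 1"] f' g' that
      by simp
    thus ?case using pullback_alg.plus[OF f'(1) g'(1)] by blast
  next
    case (mult f g)
    then obtain f' g' where f': "pullback_alg U \<Phi> V f'" "\<forall>x\<in>U. partial i f x = f' x"
      and g': "pullback_alg U \<Phi> V g'" "\<forall>x\<in>U. partial i g x = g' x" by blast
    have "partial i (\<lambda>x. f x * g x) x = f x * g' x + f' x * g x" if "x \<in> U" for x
      using dd_unique[OF has_derivative_mult[OF D[OF mult(1) that] D[OF mult(2) that]], of "axis i 1"] f' g' that
      by simp
    moreover have "pullback_alg U \<Phi> V (\<lambda>x. f x * g' x + f' x * g x)"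
      by (intro pullback_alg.plus[of U \<Phi> V "\<lambda>x. f x * g' x" "\<lambda>x. f' x * g x"]
            pullback_alg.mult[of U \<Phi> V f g'] pullback_alg.mult[of U \<Phi> V f' g] mult f' g')
    ultimately show ?case by blast
  qed
qed (use assms in auto)

lemma smooth_on_compose:
  assumes "open U" "open V" "\<Phi> ` U \<subseteq> V" "smooth_map_on U \<Phi>" "smooth_on V f"
  shows "smooth_on U (\<lambda>x. f (\<Phi> x))"
  by (rule pullback_alg_smooth[OF assms(1-4)]) (rule pullback_alg.comp, fact)

lemma smooth_map_on_ident: "open U \<Longrightarrow> smooth_map_on U (\<lambda>x. x)"
  by (simp add: smooth_map_on_def smooth_on_nth)

text \<open>With the identity as the map, the pullback algebra already contains sums and products of
  smooth functions.\<close>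

lemma smooth_on_add:
  assumes "open U" "smooth_on U f" "smooth_on U g"
  shows "smooth_on U (\<lambda>x. f x + g x)"
  by (rule pullback_alg_smooth[where \<Phi>="\<lambda>x. x" and V=U])
     (use assms smooth_map_on_ident in \<open>auto intro: pullback_alg.intros\<close>)

lemma smooth_on_mult:
  assumes "open U" "smooth_on U f" "smooth_on U g"
  shows "smooth_on U (\<lambda>x. f x * g x)"
  by (rule pullback_alg_smooth[where \<Phi>="\<lambda>x. x" and V=U])
     (use assms smooth_map_on_ident in \<open>auto intro: pullback_alg.intros\<close>)

lemma smooth_on_sum:
  assumes "open U" "finite A" "\<And>i. i \<in> A \<Longrightarrow> smooth_on U (f i)"
  shows "smooth_on U (\<lambda>x. \<Sum>i\<in>A. f i x)"
  using assms(2,3) by (induction A rule: finite_induct) (auto intro!: smooth_on_const smooth_on_add assms(1))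

lemma smooth_on_dd: "open U \<Longrightarrow> smooth_on U f \<Longrightarrow> smooth_on U (dd v f)"
  unfolding dd_def[abs_def]
  by (intro smooth_on_sum smooth_on_mult smooth_on_const smooth_on_partial) auto

text \<open>The mean value theorem in direction \<open>u\<close> turns the second difference into
  \<open>t\<close> times an increment of \<open>dd u f\<close>, and differentiability of
  \<open>dd u f\<close> at \<open>x\<close> evaluates that increment up to an error that is small
  compared with \<open>t\<close>.\<close>

lemma second_difference_limit:
  assumes U: "open U" "x \<in> U" and f: "smooth_on U f"
  shows "((\<lambda>t. (f (x + t *\<^sub>R u + t *\<^sub>R v) - f (x + t *\<^sub>R u) - f (x + t *\<^sub>R v) + f x) / t\<^sup>2)
           \<longlongrightarrow> dd v (dd u f) x) (at_right 0)"
proof (rule tendstoI)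
  fix e :: real assume e: "e > 0"
  \<comment> \<open>The linear approximation of \<open>dd u f\<close> is used at two points, with
    errors proportional to \<open>s * norm u + t * norm v\<close> and \<open>s * norm u\<close>.
    Their sum is at most \<open>t * (2 * norm u + norm v)\<close>; the extra 1 keeps
    \<open>K\<close> positive and the estimate strict.\<close>
  define K where "K = 2 * norm u + norm v + 1"
  have K: "K > 0" by (simp add: K_def add_nonneg_pos)
  have "(dd u f has_derivative (\<lambda>w. dd w (dd u f) x)) (at x)"
    by (rule smooth_on_has_derivative[OF smooth_on_dd[OF U(1) f] U])
  moreover have "e / (2*K) > 0" using e K by simp
  ultimately obtain d1 where d1: "d1 > 0"
    "\<And>y. norm (y - x) < d1 \<Longrightarrow> norm (dd u f y - dd u f x - dd (y - x) (dd u f) x) \<le> e / (2*K) * norm (y - x)"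
    unfolding has_derivative_at_alt by meson
  obtain d2 where d2: "d2 > 0" "ball x d2 \<subseteq> U" using U open_contains_ball by blast
  define d where "d = min d1 d2 / K"
  have d: "d > 0" using d1 d2 K by (simp add: d_def)
  show "\<forall>\<^sub>F t in at_right 0. dist ((f (x + t *\<^sub>R u + t *\<^sub>R v) - f (x + t *\<^sub>R u) - f (x + t *\<^sub>R v) + f x) / t\<^sup>2) (dd v (dd u f) x) < e"
    unfolding eventually_at_right_field
  proof (intro exI[of _ d] conjI allI impI)
    show "0 < d" by (rule d)
  next
    fix t :: real assume t: "0 < t" "t < d"
    have small: "norm (s *\<^sub>R u + r *\<^sub>R v) < min d1 d2" if "0 \<le> s" "s \<le> t" "0 \<le> r" "r \<le> t" for s r
    proof -
      have "norm (s *\<^sub>R u + r *\<^sub>R v) \<le> norm (s *\<^sub>R u) + norm (r *\<^sub>R v)" by (rule norm_triangle_ineq)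
      also have "\<dots> = s * norm u + r * norm v" using that by simp
      also have "\<dots> \<le> t * norm u + t * norm v"
        using that by (intro add_mono mult_right_mono) auto
      also have "\<dots> \<le> t * K" using t by (simp add: K_def algebra_simps)
      also have "\<dots> < d * K" using t K by simp
      also have "\<dots> = min d1 d2" using K by (simp add: d_def)
      finally show ?thesis .
    qed
    have inU: "x + s *\<^sub>R u + r *\<^sub>R v \<in> U" if "0 \<le> s" "s \<le> t" "0 \<le> r" "r \<le> t" for s r
    proof -
      have "dist x (x + (s *\<^sub>R u + r *\<^sub>R v)) < d2"
        using small[OF that] by (subst dist_commute) (simp add: dist_norm)
      hence "x + (s *\<^sub>R u + r *\<^sub>R v) \<in> U" using d2 by (intro subsetD[OF d2(2)]) simp
      thus ?thesis by (simp add: algebra_simps)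
    qed
    define \<phi> where "\<phi> = (\<lambda>s. f (x + s *\<^sub>R u + t *\<^sub>R v) - f (x + s *\<^sub>R u + 0 *\<^sub>R v))"
    have D: "(\<phi> has_real_derivative dd u f (x + s *\<^sub>R u + t *\<^sub>R v) - dd u f (x + s *\<^sub>R u + 0 *\<^sub>R v)) (at s)"
      if "0 \<le> s" "s \<le> t" for s
    proof -
      have "((\<lambda>s. f (x + s *\<^sub>R u + r *\<^sub>R v)) has_derivative (\<lambda>h. dd (h *\<^sub>R u) f (x + s *\<^sub>R u + r *\<^sub>R v))) (at s)"
        if "0 \<le> r" "r \<le> t" for r
        by (rule has_derivative_comp_dd[OF f U(1), where \<Phi>="\<lambda>s. x + s *\<^sub>R u + r *\<^sub>R v"])
           (use \<open>0 \<le> s\<close> \<open>s \<le> t\<close> that inU in \<open>auto intro!: derivative_eq_intros\<close>)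
      hence "((\<lambda>s. f (x + s *\<^sub>R u + r *\<^sub>R v)) has_real_derivative dd u f (x + s *\<^sub>R u + r *\<^sub>R v)) (at s)"
        if "0 \<le> r" "r \<le> t" for r
        using that by (simp add: has_field_derivative_def dd_scaleR mult_commute_abs)
      from DERIV_diff[OF this[of t] this[of 0]] show ?thesis unfolding \<phi>_def using t by simp
    qed
    obtain s where s: "0 < s" "s < t" and
      eq: "\<phi> t - \<phi> 0 = (t - 0) * (dd u f (x + s *\<^sub>R u + t *\<^sub>R v) - dd u f (x + s *\<^sub>R u + 0 *\<^sub>R v))"
      using MVT2[OF t(1), of \<phi> "\<lambda>s. dd u f (x + s *\<^sub>R u + t *\<^sub>R v) - dd u f (x + s *\<^sub>R u + 0 *\<^sub>R v)"] D
      by auto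
    have bnd: "\<bar>dd u f (x + s *\<^sub>R u + r *\<^sub>R v) - dd u f x - (s * dd u (dd u f) x + r * dd v (dd u f) x)\<bar>
          \<le> e / (2*K) * (s * norm u + r * norm v)" if "0 \<le> r" "r \<le> t" for r
    proof -
      have "norm ((x + s *\<^sub>R u + r *\<^sub>R v) - x) < d1" using small[of s r] that s by simp
      from d1(2)[OF this] have "\<bar>dd u f (x + s *\<^sub>R u + r *\<^sub>R v) - dd u f x - (s * dd u (dd u f) x + r * dd v (dd u f) x)\<bar>
          \<le> e / (2*K) * norm (s *\<^sub>R u + r *\<^sub>R v)"
        by (simp add: dd_add dd_scaleR)
      also have "\<dots> \<le> e / (2*K) * (s * norm u + r * norm v)"
        using norm_triangle_ineq[of "s *\<^sub>R u" "r *\<^sub>R v"] s that e K by (intro mult_left_mono) auto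
      finally show ?thesis .
    qed
    have "\<bar>(dd u f (x + s *\<^sub>R u + t *\<^sub>R v) - dd u f (x + s *\<^sub>R u + 0 *\<^sub>R v)) - t * dd v (dd u f) x\<bar>
        \<le> e / (2*K) * (s * norm u + t * norm v) + e / (2*K) * (s * norm u + 0 * norm v)"
      using bnd[of t] bnd[of 0] t by (simp only: abs_le_iff) linarith
    also have "\<dots> = e / (2*K) * (2 * s * norm u + t * norm v)" by (simp add: algebra_simps)
    also have "\<dots> \<le> e / (2*K) * (2 * t * norm u + t * norm v)"
      using e K s by (intro mult_left_mono add_mono mult_right_mono) auto
    also have "\<dots> < e / (2*K) * (t * K)"
      using e K t by (intro mult_strict_left_mono) (auto simp: K_def algebra_simps)
    also have "\<dots> = e * t / 2" using K by simp
    finally have fin: "\<bar>(dd u f (x + s *\<^sub>R u + t *\<^sub>R v) - dd u f (x + s *\<^sub>R u + 0 *\<^sub>R v)) - t * dd v (dd u f) x\<bar> < e * t / 2" .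
    define W where "W = dd u f (x + s *\<^sub>R u + t *\<^sub>R v) - dd u f (x + s *\<^sub>R u + 0 *\<^sub>R v)"
    have "(f (x + t *\<^sub>R u + t *\<^sub>R v) - f (x + t *\<^sub>R u) - f (x + t *\<^sub>R v) + f x) / t\<^sup>2 = (\<phi> t - \<phi> 0) / t\<^sup>2"
      by (simp add: \<phi>_def)
    also have "\<dots> = W / t" using eq t by (simp add: W_def power2_eq_square)
    finally have q: "(f (x + t *\<^sub>R u + t *\<^sub>R v) - f (x + t *\<^sub>R u) - f (x + t *\<^sub>R v) + f x) / t\<^sup>2 = W / t" .
    have "\<bar>W / t - dd v (dd u f) x\<bar> = \<bar>(W - t * dd v (dd u f) x) / t\<bar>"
      using t by (simp add: diff_divide_distrib)
    also have "\<dots> = \<bar>W - t * dd v (dd u f) x\<bar> / t" using t by (simp add: abs_divide)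
    also have "\<dots> < (e * t / 2) / t" using fin t unfolding W_def by (intro divide_strict_right_mono)
    also have "\<dots> < e" using t e by simp
    finally show "dist ((f (x + t *\<^sub>R u + t *\<^sub>R v) - f (x + t *\<^sub>R u) - f (x + t *\<^sub>R v) + f x) / t\<^sup>2) (dd v (dd u f) x) < e"
      using q by (simp add: dist_real_def)
  qed
qed

text \<open>The second difference is symmetric in \<open>u\<close> and \<open>v\<close>, so both
  mixed derivatives are its limit.\<close>

lemma dd_commute:
  assumes U: "open U" "x \<in> U" and f: "smooth_on U f"
  shows "dd u (dd v f) x = dd v (dd u f) x"
proof (rule tendsto_unique[OF _ second_difference_limit[OF assms]])
  have "(f (x + t *\<^sub>R u + t *\<^sub>R v) - f (x + t *\<^sub>R u) - f (x + t *\<^sub>R v) + f x) / t\<^sup>2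
      = (f (x + t *\<^sub>R v + t *\<^sub>R u) - f (x + t *\<^sub>R v) - f (x + t *\<^sub>R u) + f x) / t\<^sup>2" for t
    by (simp add: algebra_simps)
  with second_difference_limit[OF assms, of u v]
  show "((\<lambda>t. (f (x + t *\<^sub>R v + t *\<^sub>R u) - f (x + t *\<^sub>R v) - f (x + t *\<^sub>R u) + f x) / t\<^sup>2)
           \<longlongrightarrow> dd v (dd u f) x) (at_right 0)" by simp
qed simp

subsection \<open>Hessians and third derivatives along curves\<close>

definition hs :: "(real^'n::finite \<Rightarrow> real) \<Rightarrow> real^'n \<Rightarrow> real^'n \<Rightarrow> real^'n \<Rightarrow> real" where
  "hs f x u v = dd u (dd v f) x"

definition td :: "(real^'n::finite \<Rightarrow> real) \<Rightarrow> real^'n \<Rightarrow> real^'n \<Rightarrow> real^'n \<Rightarrow> real^'n \<Rightarrow> real" where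
  "td f x u v w = dd u (dd v (dd w f)) x"

text \<open>Fourth derivatives serve only the proof of \<open>kap_isometry\<close>, where they
  cancel.\<close>

definition qd :: "(real^'n::finite \<Rightarrow> real) \<Rightarrow> real^'n \<Rightarrow> real^'n \<Rightarrow> real^'n \<Rightarrow> real^'n \<Rightarrow> real^'n \<Rightarrow> real" where
  "qd f x u v w z = dd u (dd v (dd w (dd z f))) x"

lemma dd_sum_mult:
  assumes "open U" "x \<in> U" "finite A" "\<And>i. i \<in> A \<Longrightarrow> smooth_on U (g i)"
  shows "dd u (\<lambda>x. \<Sum>i\<in>A. c i * g i x) x = (\<Sum>i\<in>A. c i * dd u (g i) x)"
proof (rule dd_unique)
  show "((\<lambda>x. \<Sum>i\<in>A. c i * g i x) has_derivative (\<lambda>u. \<Sum>i\<in>A. c i * dd u (g i) x)) (at x)"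
    by (intro has_derivative_sum has_derivative_mult_right)
       (use assms smooth_on_has_derivative in blast)
qed

lemma DERIV_vec_nth:
  assumes "(a has_vector_derivative a') (at t)"
  shows "((\<lambda>t. a t $ i) has_real_derivative a' $ i) (at t)"
  using bounded_linear.has_vector_derivative[OF bounded_linear_vec_nth assms]
  by (simp add: has_real_derivative_iff_has_vector_derivative)

lemma eventually_curve_in_open:
  assumes "(\<gamma> has_vector_derivative g') (at t)" "open U" "\<gamma> t \<in> U"
  shows "\<forall>\<^sub>F s in nhds t. \<gamma> s \<in> U"
proof -
  have "isCont \<gamma> t" using assms(1) by (rule has_vector_derivative_continuous)
  hence "\<forall>\<^sub>F s in at t. \<gamma> s \<in> U"
    using assms(2,3) by (simp add: continuous_at topological_tendstoD)
  thus ?thesis using assms(3) by (simp add: eventually_nhds_conv_at)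
qed

locale smooth_fun =
  fixes U :: "(real^'n::finite) set" and f :: "real^'n \<Rightarrow> real"
  assumes opn: "open U" and smo: "smooth_on U f"
begin

lemma smooth_fun_partial: "smooth_fun U (partial i f)"
  by unfold_locales (use opn smo smooth_on_partial in auto)

lemma smooth_fun_dd: "smooth_fun U (dd v f)"
  by unfold_locales (use opn smo smooth_on_dd in auto)

lemma hs_commute: "x \<in> U \<Longrightarrow> hs f x u v = hs f x v u"
  unfolding hs_def by (rule dd_commute[OF opn _ smo])

lemma linear_hs: "linear (\<lambda>u. hs f x u v)" "x \<in> U \<Longrightarrow> linear (\<lambda>u. hs f x v u)"
proof -
  show 1: "linear (\<lambda>u. hs f x u v)" for v unfolding hs_def by (rule linear_dd)
  show "linear (\<lambda>u. hs f x v u)" if "x \<in> U"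
    using 1[of v] hs_commute[OF that] by (simp add: linear_iff)
qed

lemma hs_linear [simp]:
  assumes "x \<in> U"
  shows "hs f x (u + u') v = hs f x u v + hs f x u' v"
        "hs f x v (u + u') = hs f x v u + hs f x v u'"
        "hs f x (c *\<^sub>R u) v = c * hs f x u v"
        "hs f x v (c *\<^sub>R u) = c * hs f x v u"
        "hs f x (u - u') v = hs f x u v - hs f x u' v"
        "hs f x v (u - u') = hs f x v u - hs f x v u'"
        "hs f x (- u) v = - hs f x u v"
        "hs f x v (- u) = - hs f x v u"
        "hs f x 0 v = 0"
        "hs f x v 0 = 0"
  using linear_add[OF linear_hs(1)] linear_add[OF linear_hs(2)] linear_cmul[OF linear_hs(1)]
    linear_cmul[OF linear_hs(2)] linear_diff[OF linear_hs(1)] linear_diff[OF linear_hs(2)]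
    linear_neg[OF linear_hs(1)] linear_neg[OF linear_hs(2)] linear_0[OF linear_hs(1)] linear_0[OF linear_hs(2)] assms
  by auto

lemma td_commute:
  assumes "x \<in> U"
  shows "td f x u v w = td f x v u w" "td f x u v w = td f x u w v"
  unfolding td_def
  using dd_commute[OF opn assms smooth_on_dd[OF opn smo]]
    dd_cong[OF opn assms dd_commute[OF opn _ smo]] by auto

lemma linear_td: "linear (\<lambda>u. td f x u v w)"
  unfolding td_def by (rule linear_dd)

lemma td_linear1 [simp]:
  shows "td f x (u + u') v w = td f x u v w + td f x u' v w"
        "td f x (c *\<^sub>R u) v w = c * td f x u v w"
        "td f x (u - u') v w = td f x u v w - td f x u' v w"
        "td f x (- u) v w = - td f x u v w"
        "td f x 0 v w = 0"
  using linear_add[OF linear_td] linear_cmul[OF linear_td] linear_diff[OF linear_td]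
    linear_neg[OF linear_td] linear_0[OF linear_td] by auto

lemma td_linear [simp]:
  assumes "x \<in> U"
  shows "td f x v (u + u') w = td f x v u w + td f x v u' w"
        "td f x v (c *\<^sub>R u) w = c * td f x v u w"
        "td f x v (u - u') w = td f x v u w - td f x v u' w"
        "td f x v (- u) w = - td f x v u w"
        "td f x v 0 w = 0"
        "td f x v w (u + u') = td f x v w u + td f x v w u'"
        "td f x v w (c *\<^sub>R u) = c * td f x v w u"
        "td f x v w (u - u') = td f x v w u - td f x v w u'"
        "td f x v w (- u) = - td f x v w u"
        "td f x v w 0 = 0"
proof -
  have 2: "td f x v u w = td f x u v w" for u v w using td_commute[OF assms] by metis
  have 3: "td f x v w u = td f x u v w" for u v w using td_commute[OF assms] by metis
  show  "td f x v (u + u') w = td f x v u w + td f x v u' w"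
        "td f x v (c *\<^sub>R u) w = c * td f x v u w"
        "td f x v (u - u') w = td f x v u w - td f x v u' w"
        "td f x v (- u) w = - td f x v u w"
        "td f x v 0 w = 0"
    unfolding 2[of v] by simp_all
  show  "td f x v w (u + u') = td f x v w u + td f x v w u'"
        "td f x v w (c *\<^sub>R u) = c * td f x v w u"
        "td f x v w (u - u') = td f x v w u - td f x v w u'"
        "td f x v w (- u) = - td f x v w u"
        "td f x v w 0 = 0"
    unfolding 3[of v w] by simp_all
qed

lemma qd_commute12: "x \<in> U \<Longrightarrow> qd f x u v w z = qd f x v u w z"
  unfolding qd_def by (rule dd_commute[OF opn]) (auto intro!: smooth_on_dd opn smo)

lemma dd_dd_expand: "x \<in> U \<Longrightarrow> dd u (dd v f) x = (\<Sum>i\<in>UNIV. v $ i * dd u (partial i f) x)"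
  unfolding dd_def[of v, abs_def]
  by (rule dd_sum_mult[OF opn]) (auto intro!: smooth_on_partial smo)

lemma DERIV_dd_curve:
  assumes g: "(\<gamma> has_vector_derivative g') (at t)" and x: "\<gamma> t \<in> U"
    and a: "(a has_vector_derivative a') (at t)"
  shows "((\<lambda>t. dd (a t) f (\<gamma> t)) has_real_derivative
            (dd a' f (\<gamma> t) + hs f (\<gamma> t) g' (a t))) (at t)"
proof -
  have p: "((\<lambda>t. partial i f (\<gamma> t)) has_real_derivative dd g' (partial i f) (\<gamma> t)) (at t)" for i
  proof -
    interpret p: smooth_fun U "partial i f" by (rule smooth_fun_partial)
    have "((\<lambda>t. partial i f (\<gamma> t)) has_derivative (\<lambda>s. dd (s *\<^sub>R g') (partial i f) (\<gamma> t))) (at t)"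
      by (rule has_derivative_comp_dd[OF p.smo p.opn, where \<Phi>=\<gamma> and x=t, OF x]) (use g in \<open>simp add: has_vector_derivative_def\<close>)
    thus ?thesis by (simp add: has_field_derivative_def dd_scaleR mult_commute_abs)
  qed
  note ai = DERIV_vec_nth[OF a]
  have "((\<lambda>t. \<Sum>i\<in>UNIV. a t $ i * partial i f (\<gamma> t)) has_real_derivative
          (\<Sum>i\<in>UNIV. a' $ i * partial i f (\<gamma> t) + dd g' (partial i f) (\<gamma> t) * a t $ i)) (at t)"
    by (intro DERIV_sum DERIV_mult ai p)
  thus ?thesis
    unfolding hs_def dd_dd_expand[OF x] by (simp add: dd_def[of _ f] sum.distrib mult.commute)
qed

lemma DERIV_curve:
  assumes g: "(\<gamma> has_vector_derivative g') (at t)" and x: "\<gamma> t \<in> U"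
  shows "((\<lambda>t. f (\<gamma> t)) has_real_derivative dd g' f (\<gamma> t)) (at t)"
proof -
  have "((\<lambda>t. f (\<gamma> t)) has_derivative (\<lambda>s. dd (s *\<^sub>R g') f (\<gamma> t))) (at t)"
    by (rule has_derivative_comp_dd[OF smo opn, where \<Phi>=\<gamma> and x=t, OF x]) (use g in \<open>simp add: has_vector_derivative_def\<close>)
  thus ?thesis by (simp add: has_field_derivative_def dd_scaleR mult_commute_abs)
qed

lemma hs_expand: "x \<in> U \<Longrightarrow> hs f x u v = (\<Sum>i\<in>UNIV. v $ i * dd u (partial i f) x)"
  unfolding hs_def by (rule dd_dd_expand)

lemma hs_matrix: "x \<in> U \<Longrightarrow> hs f x u v = u \<bullet> (hessian f x *v v)"
proof -
  assume x: "x \<in> U"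
  have "hs f x u v = (\<Sum>i\<in>UNIV. v $ i * (\<Sum>j\<in>UNIV. u $ j * partial j (partial i f) x))"
    by (simp add: hs_expand[OF x] dd_def)
  also have "\<dots> = (\<Sum>j\<in>UNIV. \<Sum>i\<in>UNIV. u $ j * (partial j (partial i f) x * v $ i))"
    by (subst sum.swap) (simp add: sum_distrib_left algebra_simps)
  also have "\<dots> = u \<bullet> (hessian f x *v v)"
    by (simp add: inner_vec_def hessian_def matrix_vector_mult_def sum_distrib_left)
  finally show ?thesis .
qed

lemma td_expand: "x \<in> U \<Longrightarrow> td f x u v w = (\<Sum>i\<in>UNIV. w $ i * hs (partial i f) x u v)"
  unfolding td_def hs_def
  by (subst dd_cong[OF opn _ dd_dd_expand], assumption, assumption, rule dd_sum_mult[OF opn])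
     (auto intro!: smooth_on_dd smooth_on_partial opn smo)

lemma qd_expand: "x \<in> U \<Longrightarrow> qd f x u v w z = (\<Sum>i\<in>UNIV. z $ i * td (partial i f) x u v w)"
  unfolding qd_def td_def
  by (subst dd_cong[OF opn _ td_expand[unfolded td_def hs_def]], assumption, assumption, rule dd_sum_mult[OF opn])
     (auto intro!: smooth_on_dd smooth_on_partial opn smo)

text \<open>Expanding the last argument in coordinates writes the form as a combination of forms of
  one order less, taken for the smooth functions \<open>partial i f\<close>. The product rule then
  lifts the previous rule by one order; \<open>DERIV_td_curve\<close> repeats this.\<close>

lemma DERIV_hs_curve:
  assumes g: "(\<gamma> has_vector_derivative g') (at t)" and x: "\<gamma> t \<in> U"
    and a: "(a has_vector_derivative a') (at t)" and b: "(b has_vector_derivative b') (at t)"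
  shows "((\<lambda>t. hs f (\<gamma> t) (a t) (b t)) has_real_derivative
            (td f (\<gamma> t) g' (a t) (b t) + hs f (\<gamma> t) a' (b t) + hs f (\<gamma> t) (a t) b')) (at t)"
proof -
  note ev = eventually_curve_in_open[OF g opn x]
  note bi = DERIV_vec_nth[OF b]
  have "((\<lambda>t. \<Sum>i\<in>UNIV. b t $ i * dd (a t) (partial i f) (\<gamma> t)) has_real_derivative
          (\<Sum>i\<in>UNIV. b' $ i * dd (a t) (partial i f) (\<gamma> t)
             + (dd a' (partial i f) (\<gamma> t) + hs (partial i f) (\<gamma> t) g' (a t)) * b t $ i)) (at t)"
    by (intro DERIV_sum DERIV_mult bi smooth_fun.DERIV_dd_curve[OF smooth_fun_partial g x a])
  also have "(\<Sum>i\<in>UNIV. b' $ i * dd (a t) (partial i f) (\<gamma> t)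
             + (dd a' (partial i f) (\<gamma> t) + hs (partial i f) (\<gamma> t) g' (a t)) * b t $ i)
        = td f (\<gamma> t) g' (a t) (b t) + hs f (\<gamma> t) a' (b t) + hs f (\<gamma> t) (a t) b'"
    by (simp add: hs_expand[OF x] td_expand[OF x] sum.distrib algebra_simps)
  finally show ?thesis
    by (rule DERIV_cong_ev[THEN iffD1, rotated 3])
       (use ev in \<open>auto elim!: eventually_mono simp: hs_expand\<close>)
qed

lemma DERIV_td_curve:
  assumes g: "(\<gamma> has_vector_derivative g') (at t)" and x: "\<gamma> t \<in> U"
    and a: "(a has_vector_derivative a') (at t)" and b: "(b has_vector_derivative b') (at t)"
    and c: "(c has_vector_derivative c') (at t)"
  shows "((\<lambda>t. td f (\<gamma> t) (a t) (b t) (c t)) has_real_derivative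
            (qd f (\<gamma> t) g' (a t) (b t) (c t) + td f (\<gamma> t) a' (b t) (c t)
              + td f (\<gamma> t) (a t) b' (c t) + td f (\<gamma> t) (a t) (b t) c')) (at t)"
proof -
  note ev = eventually_curve_in_open[OF g opn x]
  note ci = DERIV_vec_nth[OF c]
  have "((\<lambda>t. \<Sum>i\<in>UNIV. c t $ i * hs (partial i f) (\<gamma> t) (a t) (b t)) has_real_derivative
          (\<Sum>i\<in>UNIV. c' $ i * hs (partial i f) (\<gamma> t) (a t) (b t)
             + (td (partial i f) (\<gamma> t) g' (a t) (b t) + hs (partial i f) (\<gamma> t) a' (b t)
                 + hs (partial i f) (\<gamma> t) (a t) b') * c t $ i)) (at t)"
    by (intro DERIV_sum DERIV_mult ci smooth_fun.DERIV_hs_curve[OF smooth_fun_partial g x a b])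
  also have "(\<Sum>i\<in>UNIV. c' $ i * hs (partial i f) (\<gamma> t) (a t) (b t)
             + (td (partial i f) (\<gamma> t) g' (a t) (b t) + hs (partial i f) (\<gamma> t) a' (b t)
                 + hs (partial i f) (\<gamma> t) (a t) b') * c t $ i)
        = qd f (\<gamma> t) g' (a t) (b t) (c t) + td f (\<gamma> t) a' (b t) (c t)
              + td f (\<gamma> t) (a t) b' (c t) + td f (\<gamma> t) (a t) (b t) c'"
    by (simp add: td_expand[OF x] qd_expand[OF x] sum.distrib algebra_simps)
  finally show ?thesis
    by (rule DERIV_cong_ev[THEN iffD1, rotated 3])
       (use ev in \<open>auto elim!: eventually_mono simp: td_expand\<close>)
qed

lemma continuous_on_hs: "continuous_on U (\<lambda>x. hs f x u v)"
  unfolding hs_def by (intro smooth_on_continuous smooth_on_dd opn smo)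

lemma continuous_on_td: "continuous_on U (\<lambda>x. td f x u v w)"
  unfolding td_def by (intro smooth_on_continuous smooth_on_dd opn smo)

end

text \<open>Serves to differentiate an identity that holds on an open set, in a direction
  \<open>W\<close>.\<close>

lemma line_DERIV_unique:
  fixes x W :: "real^'n::finite"
  assumes U: "open U" "x \<in> U" and eq: "\<And>y. y \<in> U \<Longrightarrow> \<phi> y = \<psi> y"
    and 1: "((\<lambda>t. \<phi> (x + t *\<^sub>R W)) has_real_derivative a) (at 0)"
    and 2: "((\<lambda>t. \<psi> (x + t *\<^sub>R W)) has_real_derivative b) (at 0)"
  shows "a = b"
proof -
  have "isCont (\<lambda>t. x + t *\<^sub>R W) 0" by (intro continuous_intros)
  hence "\<forall>\<^sub>F t in at 0. x + t *\<^sub>R W \<in> U"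
    using U by (simp add: continuous_at topological_tendstoD)
  hence "\<forall>\<^sub>F t in nhds 0. x + t *\<^sub>R W \<in> U" using U(2) by (simp add: eventually_nhds_conv_at)
  hence "\<forall>\<^sub>F t in nhds 0. \<phi> (x + t *\<^sub>R W) = \<psi> (x + t *\<^sub>R W)"
    by eventually_elim (rule eq)
  from DERIV_cong_ev[OF refl this refl] 1 have "((\<lambda>t. \<psi> (x + t *\<^sub>R W)) has_real_derivative a) (at 0)" by simp
  from DERIV_unique[OF this 2] show ?thesis .
qed

lemma smooth_map_on_ddv:
  assumes "open U" "smooth_map_on U \<Phi>"
  shows "smooth_map_on U (ddv v \<Phi>)"
  using assms smooth_on_dd unfolding smooth_map_on_def by auto

lemma line_has_vector_derivative: "((\<lambda>t. x + t *\<^sub>R W) has_vector_derivative W) (at t)"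
  by (auto intro!: derivative_eq_intros simp: has_vector_derivative_def)

lemma smooth_map_curve:
  assumes "open U" "smooth_map_on U \<Phi>" "(\<gamma> has_vector_derivative g') (at t)" "\<gamma> t \<in> U"
  shows "((\<lambda>t. \<Phi> (\<gamma> t)) has_vector_derivative ddv g' \<Phi> (\<gamma> t)) (at t)"
proof -
  have "((\<lambda>t. \<Phi> (\<gamma> t)) has_derivative (\<lambda>s. ddv (s *\<^sub>R g') \<Phi> (\<gamma> t))) (at t)"
    by (rule has_derivative_compose[where g=\<Phi> and f=\<gamma>])
       (use assms smooth_map_has_derivative in \<open>auto simp: has_vector_derivative_def\<close>)
  thus ?thesis by (simp add: has_vector_derivative_def ddv_scaleR)
qed

subsection \<open>The curvature form of a Hessian metric\<close>

text \<open>The Levi-Civita connection of a Hessian metric has Christoffel symbols \<open>cv/2\<close>, and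
  \<open>kap x X Y / 4\<close> is the curvature form \<open>\<langle>R(X,Y)Y, X\<rangle>\<close>.
  No fourth derivative of the potential enters.\<close>

definition cv :: "(real^'n::finite \<Rightarrow> real) \<Rightarrow> real^'n \<Rightarrow> real^'n \<Rightarrow> real^'n \<Rightarrow> real^'n" where
  "cv f x u v = matrix_inv (hessian f x) *v (\<chi> k. td f x u v (axis k 1))"

definition kap :: "(real^'n::finite \<Rightarrow> real) \<Rightarrow> real^'n \<Rightarrow> real^'n \<Rightarrow> real^'n \<Rightarrow> real" where
  "kap f x u v = hs f x (cv f x u v) (cv f x u v) - hs f x (cv f x u u) (cv f x v v)"

lemma matrix_inv_right:
  fixes A :: "real^'n::finite^'n"
  assumes "invertible A"
  shows "A ** matrix_inv A = mat 1"
  unfolding matrix_inv_def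
  by (rule someI2_ex) (use assms in \<open>auto simp: invertible_def\<close>)

locale hess_fun = smooth_fun +
  assumes pos: "x \<in> U \<Longrightarrow> v \<noteq> 0 \<Longrightarrow> hs f x v v > 0"
begin

lemma hs_eq_0D: "x \<in> U \<Longrightarrow> (\<And>v. hs f x u v = 0) \<Longrightarrow> u = 0"
  using pos by (metis less_irrefl)

lemma invertible_hessian:
  assumes x: "x \<in> U"
  shows "invertible (hessian f x)"
proof -
  have "hessian f x *v v = 0 \<Longrightarrow> v = 0" for v
    using pos[OF x, of v] hs_matrix[OF x, of v v] by fastforce
  thus ?thesis
    by (metis matrix_left_invertible_ker invertible_left_inverse)
qed

text \<open>\<open>cv\<close> is the metric dual of the third derivative. Except for continuity,
  this and \<open>cv_unique\<close> replace the matrix formula from here on.\<close>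

lemma hs_cv:
  assumes x: "x \<in> U"
  shows "hs f x (cv f x u v) w = td f x u v w"
proof -
  have "hessian f x *v cv f x u v = (\<chi> k. td f x u v (axis k 1))"
    unfolding cv_def using invertible_hessian[OF x, THEN matrix_inv_right]
    by (simp add: matrix_vector_mul_assoc)
  hence "hs f x w (cv f x u v) = (\<Sum>k\<in>UNIV. w $ k * td f x u v (axis k 1))"
    by (simp add: hs_matrix[OF x] inner_vec_def)
  also have "\<dots> = (\<Sum>k\<in>UNIV. w $ k * td f x (axis k 1) u v)"
    using td_commute[OF x] by metis
  also have "\<dots> = td f x w u v"
    by (simp add: td_def) (simp add: dd_def)
  also have "\<dots> = td f x u v w" using td_commute[OF x] by metis
  finally show ?thesis by (simp add: hs_commute[OF x])
qed

lemma cv_unique: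
  assumes x: "x \<in> U" and "\<And>w. hs f x c w = td f x u v w"
  shows "cv f x u v = c"
proof -
  have "cv f x u v - c = 0"
    by (rule hs_eq_0D[OF x]) (use assms hs_cv[OF x] in \<open>simp add: x\<close>)
  thus ?thesis by simp
qed

text \<open>The inverse matrix is given by a choice, so continuity is read off from Cramer's rule
  instead: a quotient of determinants with continuous entries.\<close>

lemma continuous_on_cv: "continuous_on U (\<lambda>x. cv f x u v)"
proof -
  define M where "M x = hessian f x" for x
  define b where "b x = (\<chi> k. td f x u v (axis k 1))" for x
  have Mc: "continuous_on U (\<lambda>x. M x $ i $ j)" for i j
    using continuous_on_hs[of "axis i 1" "axis j 1"]
    by (simp add: M_def hessian_def hs_def dd_axis[abs_def])
  have bc: "continuous_on U (\<lambda>x. b x $ i)" for i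
    unfolding b_def by (simp add: continuous_on_td)
  have dc: "continuous_on U (\<lambda>x. det (N x))" if "\<And>i j. continuous_on U (\<lambda>x. N x $ i $ j)" for N :: "_ \<Rightarrow> real^'n^'n"
    unfolding det_def by (intro continuous_intros that)
  have d0: "det (M x) \<noteq> 0" if "x \<in> U" for x
    using invertible_hessian[OF that] by (simp add: M_def invertible_det_nz)
  have "continuous_on U (\<lambda>x. \<chi> k. det (\<chi> i j. if j = k then b x $ i else M x $ i $ j) / det (M x))"
  proof (intro continuous_on_vec_lambda continuous_on_divide dc Mc)
    show "continuous_on U (\<lambda>x. (\<chi> i j. if j = k then b x $ i else M x $ i $ j) $ i $ j)" for i j k
      using bc Mc by (cases "j = k") auto
  qed (use d0 in auto)
  moreover have "cv f x u v = (\<chi> k. det (\<chi> i j. if j = k then b x $ i else M x $ i $ j) / det (M x))" if "x \<in> U" for x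
  proof -
    have "M x *v cv f x u v = b x"
      unfolding cv_def M_def b_def using invertible_hessian[OF that, THEN matrix_inv_right]
      by (simp add: matrix_vector_mul_assoc)
    thus ?thesis using cramer[OF d0[OF that]] by blast
  qed
  ultimately show ?thesis by (metis (no_types, lifting) continuous_on_cong)
qed

lemma continuous_on_hs_vary:
  assumes "continuous_on S g" "continuous_on S a" "continuous_on S b" "g ` S \<subseteq> U"
  shows "continuous_on S (\<lambda>x. hs f (g x) (a x) (b x))"
proof -
  have Mc: "continuous_on S (\<lambda>x. hessian f (g x) $ i $ j)" for i j
  proof -
    have "continuous_on U (\<lambda>x. hessian f x $ i $ j)"
      using continuous_on_hs[of "axis i 1" "axis j 1"]
      by (simp add: hessian_def hs_def dd_axis[abs_def])
    from continuous_on_compose2[OF this assms(1) assms(4)] show ?thesis .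
  qed
  have "continuous_on S (\<lambda>x. a x \<bullet> (hessian f (g x) *v b x))"
    unfolding matrix_vector_mult_def by (intro continuous_intros assms Mc)
  moreover have "hs f (g x) (a x) (b x) = a x \<bullet> (hessian f (g x) *v b x)" if "x \<in> S" for x
    using hs_matrix assms that by blast
  ultimately show ?thesis by (metis (no_types, lifting) continuous_on_cong)
qed

lemma continuous_on_kap: "continuous_on U (\<lambda>x. kap f x u v)"
  unfolding kap_def by (intro continuous_intros continuous_on_hs_vary continuous_on_cv) auto

end

text \<open>One derivative of the isometry condition expresses the second derivatives of
  \<open>\<Phi>\<close> by third derivatives of the potentials. A second derivative brings in third
  derivatives of \<open>\<Phi>\<close> and fourth derivatives of the potentials; both are symmetric,
  so they cancel in the difference of two index orders. What is left is a quadratic identity between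
  the \<open>cv\<close> vectors.\<close>

theorem kap_isometry:
  fixes \<Phi> :: "real^'n::finite \<Rightarrow> real^'n"
  assumes f: "hess_fun U f" and g: "hess_fun V g"
    and \<Phi>: "smooth_map_on U \<Phi>" "\<Phi> ` U \<subseteq> V"
    and iso: "\<And>x X Y. x \<in> U \<Longrightarrow> hs g (\<Phi> x) (ddv X \<Phi> x) (ddv Y \<Phi> x) = hs f x X Y"
    and x: "x \<in> U"
  shows "kap g (\<Phi> x) (ddv X \<Phi> x) (ddv Y \<Phi> x) = kap f x X Y"
proof -
  interpret f: hess_fun U f by fact
  interpret g: hess_fun V g by fact
  have inV: "\<Phi> y \<in> V" if "y \<in> U" for y using that \<Phi> by blast
  have cS: "((\<lambda>t. \<Phi> (y + t *\<^sub>R W)) has_vector_derivative ddv W \<Phi> y) (at 0)" if "y \<in> U" for y W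
    using smooth_map_curve[OF f.opn \<Phi>(1) line_has_vector_derivative[of y W 0]] that by simp
  have cJ: "((\<lambda>t. ddv A \<Phi> (y + t *\<^sub>R W)) has_vector_derivative ddv W (ddv A \<Phi>) y) (at 0)" if "y \<in> U" for y W A
    using smooth_map_curve[OF f.opn smooth_map_on_ddv[OF f.opn \<Phi>(1)] line_has_vector_derivative[of y W 0]] that by simp
  have cD: "((\<lambda>t. ddv B (ddv A \<Phi>) (y + t *\<^sub>R W)) has_vector_derivative ddv W (ddv B (ddv A \<Phi>)) y) (at 0)"
    if "y \<in> U" for y W A B
    using smooth_map_curve[OF f.opn smooth_map_on_ddv[OF f.opn smooth_map_on_ddv[OF f.opn \<Phi>(1)]]
        line_has_vector_derivative[of y W 0]] that by simp
  have Dsym: "ddv A (ddv B \<Phi>) y = ddv B (ddv A \<Phi>) y" if "y \<in> U" for y A B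
    using \<Phi>(1) dd_commute[OF f.opn that] by (simp add: vec_eq_iff smooth_map_on_def)
  have D3sym: "ddv A (ddv B (ddv C \<Phi>)) y = ddv B (ddv A (ddv C \<Phi>)) y" if "y \<in> U" for y A B C
    using smooth_map_on_ddv[OF f.opn \<Phi>(1), of C] dd_commute[OF f.opn that]
    by (simp add: vec_eq_iff smooth_map_on_def)
  have cc: "((\<lambda>t. A) has_vector_derivative 0) (at t)" for A :: "real^'n" and t by (rule has_vector_derivative_const)
  have s1: "td g (\<Phi> y) (ddv W \<Phi> y) (ddv A \<Phi> y) (ddv B \<Phi> y)
      + hs g (\<Phi> y) (ddv W (ddv A \<Phi>) y) (ddv B \<Phi> y) + hs g (\<Phi> y) (ddv A \<Phi> y) (ddv W (ddv B \<Phi>) y) = td f y W A B"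
    if y: "y \<in> U" for y W A B
  proof (rule line_DERIV_unique[OF f.opn y iso])
    show "((\<lambda>t. hs f (y + t *\<^sub>R W) A B) has_real_derivative td f y W A B) (at 0)"
      using f.DERIV_hs_curve[OF line_has_vector_derivative[of y W 0] _ cc cc, of A B] y by simp
    show "((\<lambda>t. hs g (\<Phi> (y + t *\<^sub>R W)) (ddv A \<Phi> (y + t *\<^sub>R W)) (ddv B \<Phi> (y + t *\<^sub>R W)))
      has_real_derivative td g (\<Phi> y) (ddv W \<Phi> y) (ddv A \<Phi> y) (ddv B \<Phi> y)
      + hs g (\<Phi> y) (ddv W (ddv A \<Phi>) y) (ddv B \<Phi> y) + hs g (\<Phi> y) (ddv A \<Phi> y) (ddv W (ddv B \<Phi>) y)) (at 0)"
      using g.DERIV_hs_curve[OF cS[OF y, of W] _ cJ[OF y, of A W] cJ[OF y, of B W]] inV[OF y] by simp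
  qed
  \<comment> \<open>The Koszul trick: the instances of \<open>s1\<close> for \<open>A B C\<close>
    and \<open>B A C\<close> are added and that for \<open>C A B\<close> is subtracted. Third
    derivatives are totally symmetric, so only one second derivative of \<open>\<Phi>\<close>
    survives, twice.\<close>
  have s2: "hs g (\<Phi> y) (ddv A (ddv B \<Phi>) y) (ddv C \<Phi> y)
      = (td f y A B C - td g (\<Phi> y) (ddv A \<Phi> y) (ddv B \<Phi> y) (ddv C \<Phi> y)) / 2"
    if y: "y \<in> U" for y A B C
  proof -
    note yV = inV[OF y]
    have "td f y B A C = td f y A B C" "td f y C A B = td f y A B C"
      "td g (\<Phi> y) (ddv B \<Phi> y) (ddv A \<Phi> y) (ddv C \<Phi> y) = td g (\<Phi> y) (ddv A \<Phi> y) (ddv B \<Phi> y) (ddv C \<Phi> y)"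
      "td g (\<Phi> y) (ddv C \<Phi> y) (ddv A \<Phi> y) (ddv B \<Phi> y) = td g (\<Phi> y) (ddv A \<Phi> y) (ddv B \<Phi> y) (ddv C \<Phi> y)"
      using f.td_commute[OF y] g.td_commute[OF yV] by metis+
    with s1[OF y, of A B C] s1[OF y, of B A C] s1[OF y, of C A B]
    show ?thesis
      by (simp add: g.hs_commute[OF yV, of "ddv B \<Phi> y"] g.hs_commute[OF yV, of "ddv A \<Phi> y"]
          Dsym[OF y, of B A] Dsym[OF y, of C])
  qed
  define J where "J A = ddv A \<Phi> x" for A
  define D where "D A B = ddv A (ddv B \<Phi>) x" for A B
  note xV = inV[OF x]
  have s3: "td g (\<Phi> x) (J W) (D A B) (J C) + hs g (\<Phi> x) (ddv W (ddv A (ddv B \<Phi>)) x) (J C) + hs g (\<Phi> x) (D A B) (D W C)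
      = (qd f x W A B C - (qd g (\<Phi> x) (J W) (J A) (J B) (J C) + td g (\<Phi> x) (D W A) (J B) (J C)
          + td g (\<Phi> x) (J A) (D W B) (J C) + td g (\<Phi> x) (J A) (J B) (D W C))) / 2" for W A B C
    unfolding J_def D_def
  proof (rule line_DERIV_unique[OF f.opn x s2])
    show "((\<lambda>t. hs g (\<Phi> (x + t *\<^sub>R W)) (ddv A (ddv B \<Phi>) (x + t *\<^sub>R W)) (ddv C \<Phi> (x + t *\<^sub>R W))) has_real_derivative
      td g (\<Phi> x) (ddv W \<Phi> x) (ddv A (ddv B \<Phi>) x) (ddv C \<Phi> x) +
     hs g (\<Phi> x) (ddv W (ddv A (ddv B \<Phi>)) x) (ddv C \<Phi> x) + hs g (\<Phi> x) (ddv A (ddv B \<Phi>) x) (ddv W (ddv C \<Phi>) x)) (at 0)"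
      using g.DERIV_hs_curve[OF cS[OF x, of W] _ cD[OF x, of A B W] cJ[OF x, of C W]] inV[OF x] by simp
    have 1: "((\<lambda>t. td f (x + t *\<^sub>R W) A B C) has_real_derivative qd f x W A B C) (at 0)"
      using f.DERIV_td_curve[OF line_has_vector_derivative[of x W 0] _ cc cc cc, of A B C] x by simp
    have 2: "((\<lambda>t. td g (\<Phi> (x + t *\<^sub>R W)) (ddv A \<Phi> (x + t *\<^sub>R W)) (ddv B \<Phi> (x + t *\<^sub>R W)) (ddv C \<Phi> (x + t *\<^sub>R W)))
      has_real_derivative (qd g (\<Phi> x) (ddv W \<Phi> x) (ddv A \<Phi> x) (ddv B \<Phi> x) (ddv C \<Phi> x)
          + td g (\<Phi> x) (ddv W (ddv A \<Phi>) x) (ddv B \<Phi> x) (ddv C \<Phi> x)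
          + td g (\<Phi> x) (ddv A \<Phi> x) (ddv W (ddv B \<Phi>) x) (ddv C \<Phi> x)
          + td g (\<Phi> x) (ddv A \<Phi> x) (ddv B \<Phi> x) (ddv W (ddv C \<Phi>) x))) (at 0)"
      using g.DERIV_td_curve[OF cS[OF x, of W] _ cJ[OF x, of A W] cJ[OF x, of B W] cJ[OF x, of C W]] xV by simp
    show "((\<lambda>t. (td f (x + t *\<^sub>R W) A B C - td g (\<Phi> (x + t *\<^sub>R W)) (ddv A \<Phi> (x + t *\<^sub>R W)) (ddv B \<Phi> (x + t *\<^sub>R W))
            (ddv C \<Phi> (x + t *\<^sub>R W))) / 2) has_real_derivative
     (qd f x W A B C - (qd g (\<Phi> x) (ddv W \<Phi> x) (ddv A \<Phi> x) (ddv B \<Phi> x) (ddv C \<Phi> x)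
          + td g (\<Phi> x) (ddv W (ddv A \<Phi>) x) (ddv B \<Phi> x) (ddv C \<Phi> x)
          + td g (\<Phi> x) (ddv A \<Phi> x) (ddv W (ddv B \<Phi>) x) (ddv C \<Phi> x)
          + td g (\<Phi> x) (ddv A \<Phi> x) (ddv B \<Phi> x) (ddv W (ddv C \<Phi>) x))) / 2) (at 0)"
      by (rule DERIV_cdivide[OF DERIV_diff[OF 1 2]])
  qed
  define h where "h = hs g (\<Phi> x)"
  define T where "T = td g (\<Phi> x)"
  have hc: "h u v = h v u" for u v unfolding h_def by (rule g.hs_commute[OF xV])
  have Tc: "T u v w = T v u w" "T u v w = T u w v" for u v w unfolding T_def using g.td_commute[OF xV] by auto
  \<comment> \<open>The difference of \<open>s3\<close> for the orders \<open>Y X X Y\<close> and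
    \<open>X Y X Y\<close>.\<close>
  have key: "T (J Y) (J Y) (D X X) / 2 + T (J X) (J X) (D Y Y) / 2 - T (J X) (J Y) (D X Y)
       + h (D X X) (D Y Y) - h (D X Y) (D X Y) = 0"
  proof -
    have e1: "T (J Y) (D X X) (J Y) + h (ddv Y (ddv X (ddv X \<Phi>)) x) (J Y) + h (D X X) (D Y Y)
      = (qd f x Y X X Y - (qd g (\<Phi> x) (J Y) (J X) (J X) (J Y) + T (D Y X) (J X) (J Y)
          + T (J X) (D Y X) (J Y) + T (J X) (J X) (D Y Y))) / 2"
      using s3[of Y X X Y] unfolding h_def T_def .
    have e2: "T (J X) (D Y X) (J Y) + h (ddv X (ddv Y (ddv X \<Phi>)) x) (J Y) + h (D Y X) (D X Y)
      = (qd f x X Y X Y - (qd g (\<Phi> x) (J X) (J Y) (J X) (J Y) + T (D X Y) (J X) (J Y)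
          + T (J Y) (D X X) (J Y) + T (J Y) (J X) (D X Y))) / 2"
      using s3[of X Y X Y] unfolding h_def T_def .
    have D: "D Y X = D X Y" unfolding D_def by (rule Dsym[OF x])
    have q: "qd f x Y X X Y = qd f x X Y X Y" by (rule f.qd_commute12[OF x])
    have q': "qd g (\<Phi> x) (J Y) (J X) (J X) (J Y) = qd g (\<Phi> x) (J X) (J Y) (J X) (J Y)" by (rule g.qd_commute12[OF xV])
    have t: "T (J Y) (D X X) (J Y) = T (J Y) (J Y) (D X X)"
      "T (D X Y) (J X) (J Y) = T (J X) (J Y) (D X Y)" "T (J X) (D X Y) (J Y) = T (J X) (J Y) (D X Y)"
      "T (J Y) (J X) (D X Y) = T (J X) (J Y) (D X Y)"
      using Tc by metis+
    show ?thesis using e1 e2 unfolding D q q' t D3sym[OF x, of Y X X] by argo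
  qed
  have linJ: "linear J" unfolding J_def by (rule linear_ddv)
  have "inj J"
  proof (rule linear_injective_0[OF linJ, THEN iffD2], intro allI impI)
    fix v assume "J v = 0"
    hence "hs f x v w = 0" for w using iso[OF x, of v w] xV unfolding J_def by simp
    thus "v = 0" by (rule f.hs_eq_0D[OF x])
  qed
  hence surjJ: "surj J" using linJ linear_injective_imp_surjective by blast
  define a where "a A B = J (cv f x A B)" for A B
  define b where "b A B = cv g (\<Phi> x) (J A) (J B)" for A B
  \<comment> \<open>The transformation law of the connection: the second derivative of
    \<open>\<Phi>\<close> is half the difference between the pushed forward and the target
    \<open>cv\<close>.\<close>
  have Deq: "D A B = (1/2) *\<^sub>R (a A B - b A B)" for A B
  proof -
    have "D A B - (1/2) *\<^sub>R (a A B - b A B) = 0"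
    proof (rule g.hs_eq_0D[OF xV])
      fix v
      obtain C where C: "v = J C" using surjJ by blast
      have "hs g (\<Phi> x) (D A B) (J C) = (td f x A B C - T (J A) (J B) (J C)) / 2"
        unfolding D_def J_def T_def by (rule s2[OF x])
      moreover have "hs g (\<Phi> x) (a A B) (J C) = td f x A B C"
        unfolding a_def J_def iso[OF x] by (rule f.hs_cv[OF x])
      moreover have "hs g (\<Phi> x) (b A B) (J C) = T (J A) (J B) (J C)"
        unfolding b_def T_def by (rule g.hs_cv[OF xV])
      ultimately show "hs g (\<Phi> x) (D A B - (1/2) *\<^sub>R (a A B - b A B)) v = 0"
        unfolding C by (simp add: xV)
    qed
    thus ?thesis by simp
  qed
  have Tb: "T (J A) (J B) w = h (b A B) w" for A B w
    unfolding T_def h_def b_def by (rule g.hs_cv[OF xV, symmetric])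
  have hl: "h u ((1/2) *\<^sub>R (v - w)) = (h u v - h u w) / 2" "h ((1/2) *\<^sub>R (v - w)) u = (h v u - h w u) / 2" for u v w
    unfolding h_def by (simp_all add: xV)
  \<comment> \<open>After substituting \<open>Deq\<close> into \<open>key\<close>, all products of
    an \<open>a\<close> with a \<open>b\<close> cancel.\<close>
  have "h (a X Y) (a X Y) - h (a X X) (a Y Y) = h (b X Y) (b X Y) - h (b X X) (b Y Y)"
    using key unfolding Tb Deq hl
    by (simp add: hc[of "b Y Y" "a X X"] hc[of "b X X" "a Y Y"] hc[of "b Y Y" "b X X"] hc[of "b X Y" "a X Y"] field_simps)
  moreover have "h (a A B) (a A' B') = hs f x (cv f x A B) (cv f x A' B')" for A B A' B'
    unfolding h_def a_def J_def by (rule iso[OF x])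
  ultimately show ?thesis unfolding kap_def h_def b_def J_def by simp
qed

subsection \<open>Minkowski norms and their isometries\<close>

lemma open_punct: "open (punct :: (real^'n::finite) set)"
  by (simp add: open_delete)

text \<open>The conclusion has the shape of the hypothesis \<open>eq\<close>, with
  \<open>dd (L v) f\<close> and \<open>dd v g\<close> for \<open>f\<close> and \<open>g\<close>, so
  the lemma can be iterated; \<open>E_similarity\<close> applies it three times.\<close>

lemma dd_comp_linear:
  fixes L :: "real^'n::finite \<Rightarrow> real^'m::finite"
  assumes "linear L" "open U" "open V" "L ` U \<subseteq> V" "smooth_on V f" "smooth_on U g"
    and eq: "\<And>x. x \<in> U \<Longrightarrow> f (L x) = c * g x" and x: "x \<in> U"
  shows "dd (L v) f (L x) = c * dd v g x"
proof -
  have "(L has_derivative L) (at x)"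
    using assms(1) by (simp add: linear_linear bounded_linear_imp_has_derivative)
  moreover have "L x \<in> V" using assms x by auto
  ultimately have "((\<lambda>x. f (L x)) has_derivative (\<lambda>v. dd (L v) f (L x))) (at x)"
    using assms by (intro has_derivative_comp_dd[where V=V]) auto
  hence "dd v (\<lambda>x. f (L x)) x = dd (L v) f (L x)" by (rule dd_unique)
  moreover have "dd v (\<lambda>x. f (L x)) x = dd v (\<lambda>x. c * g x) x" by (rule dd_cong[OF assms(2) x eq])
  moreover have "dd v (\<lambda>x. c * g x) x = c * dd v g x"
    by (rule dd_unique, rule has_derivative_mult_right, rule smooth_on_has_derivative) fact+
  ultimately show ?thesis by simp
qed

lemma smooth_map_on_compose:
  assumes "open U" "open V" "\<Psi> ` U \<subseteq> V" "smooth_map_on U \<Psi>" "smooth_map_on V \<Phi>"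
  shows "smooth_map_on U (\<lambda>x. \<Phi> (\<Psi> x))"
  unfolding smooth_map_on_def
proof
  fix j
  show "smooth_on U (\<lambda>x. \<Phi> (\<Psi> x) $ j)"
    by (rule smooth_on_compose[OF assms(1-4), where f="\<lambda>y. \<Phi> y $ j"])
       (use assms(5) in \<open>simp add: smooth_map_on_def\<close>)
qed

lemma smooth_map_on_cong:
  assumes "smooth_map_on U \<Phi>" "open U" "\<And>x. x \<in> U \<Longrightarrow> \<Phi> x = \<Psi> x"
  shows "smooth_map_on U \<Psi>"
  unfolding smooth_map_on_def
proof
  fix j
  show "smooth_on U (\<lambda>x. \<Psi> x $ j)"
    by (rule smooth_on_cong[of U "\<lambda>x. \<Phi> x $ j"]) (use assms in \<open>auto simp: smooth_map_on_def\<close>)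
qed

lemma smooth_map_on_linear:
  fixes L :: "real^'n::finite \<Rightarrow> real^'m::finite"
  assumes "linear L" "open U"
  shows "smooth_map_on U L"
  unfolding smooth_map_on_def
proof
  fix j
  have "L x $ j = adjoint L (axis j 1) \<bullet> x" for x
    using adjoint_works[OF assms(1), of x "axis j 1"] by (simp add: inner_axis inner_commute)
  thus "smooth_on U (\<lambda>x. L x $ j)" using smooth_on_inner[OF assms(2)] by simp
qed

lemma ddv_comp:
  assumes "open U" "open V" "\<Psi> x \<in> V" "x \<in> U" "smooth_map_on U \<Psi>" "smooth_map_on V \<Phi>"
  shows "ddv v (\<lambda>x. \<Phi> (\<Psi> x)) x = ddv (ddv v \<Psi> x) \<Phi> (\<Psi> x)"
  by (rule ddv_unique, rule has_derivative_compose[OF smooth_map_has_derivative[OF assms(5,1,4)]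
        smooth_map_has_derivative[OF assms(6,2,3)]])

lemma ddv_linear: "linear L \<Longrightarrow> ddv v L x = L v"
  by (rule ddv_unique) (simp add: linear_linear bounded_linear_imp_has_derivative)

locale minkowski =
  fixes F :: "real^'n::finite \<Rightarrow> real"
  assumes mink: "minkowski_norm F"
begin

definition E :: "real^'n \<Rightarrow> real" where "E x = (F x)\<^sup>2 / 2"

lemma E_eta: "(\<lambda>x. (F x)\<^sup>2 / 2) = E"
  by (simp add: E_def[abs_def])

lemma F_nonneg: "F x \<ge> 0" and F_pos: "x \<noteq> 0 \<Longrightarrow> F x > 0"
  and F_scaleR: "c \<ge> 0 \<Longrightarrow> F (c *\<^sub>R x) = c * F x"
  and smooth_F: "smooth_on punct F" and continuous_F: "continuous_on UNIV F"
  using mink unfolding minkowski_norm_def by auto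

lemma F_0 [simp]: "F 0 = 0"
  using F_scaleR[of 0 0] by simp

lemma F_E: "F x = sqrt (2 * E x)"
  using F_nonneg by (simp add: E_def)

lemma E_pos: "x \<noteq> 0 \<Longrightarrow> E x > 0"
  using F_pos[of x] by (simp add: E_def)

lemma E_scaleR: "c \<ge> 0 \<Longrightarrow> E (c *\<^sub>R x) = c\<^sup>2 * E x"
  by (simp add: E_def F_scaleR power_mult_distrib)

lemma smooth_E: "smooth_on punct E"
proof -
  have "smooth_on punct (\<lambda>x. (1/2) * (F x * F x))"
    by (intro smooth_on_mult smooth_on_const smooth_F open_punct)
  thus ?thesis by (simp add: E_def[abs_def] power2_eq_square)
qed

sublocale hess_fun punct E
proof -
  interpret smooth_fun punct E by unfold_locales (rule open_punct, rule smooth_E)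
  show "hess_fun punct E"
  proof unfold_locales
    fix x v :: "real^'n" assume "x \<in> punct" "v \<noteq> 0"
    thus "hs E x v v > 0" using mink hs_matrix[of x v v]
      unfolding minkowski_norm_def E_eta pos_def_matrix_def by auto
  qed
qed

lemma hess_metric_eq: "x \<noteq> 0 \<Longrightarrow> hess_metric F x u v = hs E x u v"
  unfolding hess_metric_def E_eta by (simp add: hs_matrix)

lemma hs_nonneg: "x \<noteq> 0 \<Longrightarrow> hs E x v v \<ge> 0"
  using pos[of x v] by (cases "v = 0") auto

text \<open>A linear map has no higher derivatives of its own, so it acts on each derivative of
  \<open>E\<close> by substitution. Symmetries of \<open>F\<close> have \<open>c = 1\<close>; for a
  homothety \<open>c\<close> is the square of its factor.\<close>

lemma E_similarity:
  assumes L: "linear L" "inj L" and eq: "\<And>x. E (L x) = c * E x" and x: "x \<noteq> 0"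
  shows "dd (L u) E (L x) = c * dd u E x"
    "hs E (L x) (L u) (L v) = c * hs E x u v"
    "td E (L x) (L u) (L v) (L w) = c * td E x u v w"
proof -
  have im: "L ` punct \<subseteq> punct" using L by (auto simp: linear_injective_0)
  have 1: "dd (L u) E (L x) = c * dd u E x" if "x \<in> punct" for x u
    by (rule dd_comp_linear[OF L(1) open_punct open_punct im smooth_E smooth_E eq that])
  have 2: "dd (L u) (dd (L v) E) (L x) = c * dd u (dd v E) x" if "x \<in> punct" for x u v
    by (rule dd_comp_linear[OF L(1) open_punct open_punct im, where f="dd (L v) E" and g="dd v E"])
       (use 1 that in \<open>auto intro!: smooth_on_dd smooth_E open_punct\<close>)
  have 3: "dd (L u) (dd (L v) (dd (L w) E)) (L x) = c * dd u (dd v (dd w E)) x" if "x \<in> punct" for x u v w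
    by (rule dd_comp_linear[OF L(1) open_punct open_punct im, where f="dd (L v) (dd (L w) E)" and g="dd v (dd w E)"])
       (use 2 that in \<open>auto intro!: smooth_on_dd smooth_E open_punct\<close>)
  show "dd (L u) E (L x) = c * dd u E x"
    "hs E (L x) (L u) (L v) = c * hs E x u v"
    "td E (L x) (L u) (L v) (L w) = c * td E x u v w"
    using x 1 2 3 unfolding hs_def td_def by auto
qed

lemma kap_similarity:
  assumes L: "linear L" "inj L" and eq: "\<And>x. E (L x) = c * E x" and c: "c \<noteq> 0" and x: "x \<noteq> 0"
  shows "kap E (L x) (L u) (L v) = c * kap E x u v"
proof -
  have Lx: "L x \<in> punct" using L x by (auto simp: linear_injective_0)
  have surj: "surj L" using L linear_injective_imp_surjective by blast
  have "cv E (L x) (L u) (L v) = L (cv E x u v)" for u v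
  proof (rule cv_unique[OF Lx])
    fix w
    obtain w' where w: "w = L w'" using surj by blast
    show "hs E (L x) (L (cv E x u v)) w = td E (L x) (L u) (L v) w"
      unfolding w E_similarity[OF L eq x] using hs_cv x by simp
  qed
  thus ?thesis unfolding kap_def by (simp add: E_similarity[OF L eq x] right_diff_distrib)
qed

lemma homogeneous_derivatives:
  assumes c: "c > 0" and x: "x \<noteq> 0"
  shows "dd v E (c *\<^sub>R x) = c * dd v E x" "hs E (c *\<^sub>R x) u v = hs E x u v"
    "td E (c *\<^sub>R x) u v w = td E x u v w / c"
proof -
  have L: "linear (\<lambda>x::real^'n. c *\<^sub>R x)" "inj (\<lambda>x::real^'n. c *\<^sub>R x)"
    using c by (auto simp: linear_scale_self inj_on_def)
  have eq: "E (c *\<^sub>R x) = c\<^sup>2 * E x" for x using c by (simp add: E_scaleR)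
  have cx: "c *\<^sub>R x \<in> punct" using c x by simp
  note S = E_similarity[OF L eq x]
  show "dd v E (c *\<^sub>R x) = c * dd v E x"
    using S(1)[of v] c by (simp add: dd_scaleR power2_eq_square)
  show "hs E (c *\<^sub>R x) u v = hs E x u v"
    using S(2)[of u v] c cx by (simp add: power2_eq_square)
  show "td E (c *\<^sub>R x) u v w = td E x u v w / c"
    using S(3)[of u v w] c cx by (simp add: power2_eq_square field_simps)
qed

lemma ray_deriv: "((\<lambda>c. c *\<^sub>R x) has_vector_derivative x) (at c)" for x :: "real^'n"
  by (auto intro!: derivative_eq_intros simp: has_vector_derivative_def)

text \<open>Euler's relations: the homogeneity laws of degree 2, 1 and 0 for \<open>E\<close> and
  its first two derivatives, differentiated along the ray at parameter 1.\<close>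

lemma euler:
  assumes x: "x \<noteq> 0"
  shows "dd x E x = 2 * E x" "hs E x x v = dd v E x" "hs E x x x = (F x)\<^sup>2" "td E x x u v = 0"
proof -
  have ev: "\<forall>\<^sub>F c in nhds 1. (c::real) > 0"
    using eventually_nhds_in_open[of "{0<..}" "1::real"] by simp
  have D1: "((\<lambda>c. f (c *\<^sub>R x)) has_real_derivative dd x f x) (at 1)" if "smooth_on punct f" for f
    using smooth_fun.DERIV_curve[OF smooth_fun.intro[OF open_punct that] ray_deriv[of x 1]] x by simp
  show "dd x E x = 2 * E x"
  proof (rule DERIV_unique)
    show "((\<lambda>c. E (c *\<^sub>R x)) has_real_derivative dd x E x) (at 1)" by (rule D1[OF smooth_E])
    have "((\<lambda>c. c\<^sup>2 * E x) has_real_derivative 2 * E x) (at 1)" by (auto intro!: derivative_eq_intros)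
    thus "((\<lambda>c. E (c *\<^sub>R x)) has_real_derivative 2 * E x) (at 1)"
      by (rule DERIV_cong_ev[THEN iffD1, rotated 3])
         (use ev in \<open>auto elim!: eventually_mono simp: E_scaleR\<close>)
  qed
  show e2: "hs E x x v = dd v E x" for v
    unfolding hs_def
  proof (rule DERIV_unique)
    show "((\<lambda>c. dd v E (c *\<^sub>R x)) has_real_derivative dd x (dd v E) x) (at 1)"
      by (intro D1 smooth_on_dd smooth_E open_punct)
    have "((\<lambda>c. c * dd v E x) has_real_derivative dd v E x) (at 1)" by (auto intro!: derivative_eq_intros)
    thus "((\<lambda>c. dd v E (c *\<^sub>R x)) has_real_derivative dd v E x) (at 1)"
      by (rule DERIV_cong_ev[THEN iffD1, rotated 3])
         (use ev x in \<open>auto elim!: eventually_mono simp: homogeneous_derivatives\<close>)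
  qed
  show "hs E x x x = (F x)\<^sup>2" using e2[of x] \<open>dd x E x = 2 * E x\<close> by (simp add: E_def)
  show "td E x x u v = 0"
    unfolding td_def
  proof (rule DERIV_unique)
    show "((\<lambda>c. dd u (dd v E) (c *\<^sub>R x)) has_real_derivative dd x (dd u (dd v E)) x) (at 1)"
      by (intro D1 smooth_on_dd smooth_E open_punct)
    have "((\<lambda>c. dd u (dd v E) x) has_real_derivative 0) (at 1)" by (auto intro!: derivative_eq_intros)
    thus "((\<lambda>c. dd u (dd v E) (c *\<^sub>R x)) has_real_derivative 0) (at 1)"
      by (rule DERIV_cong_ev[THEN iffD1, rotated 3])
         (use ev x in \<open>auto elim!: eventually_mono simp: homogeneous_derivatives(2)[unfolded hs_def]\<close>)
  qed
qed

lemma cauchy_schwarz: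
  assumes x: "x \<noteq> 0"
  shows "(hs E x u v)\<^sup>2 \<le> hs E x u u * hs E x v v"
proof (cases "v = 0")
  case False
  hence p: "hs E x v v > 0" using pos x by simp
  define w where "w = hs E x v v *\<^sub>R u - hs E x u v *\<^sub>R v"
  have "0 \<le> hs E x w w" by (rule hs_nonneg[OF x])
  also have "hs E x w w = hs E x v v * (hs E x u u * hs E x v v - (hs E x u v)\<^sup>2)"
    using x hs_commute[of x v u] by (simp add: w_def algebra_simps power2_eq_square)
  finally show ?thesis using p by (simp add: zero_le_mult_iff)
qed (use x in simp)

lemma dd_E_F: "x \<noteq> 0 \<Longrightarrow> dd v E x = F x * dd v F x"
proof -
  assume x: "x \<noteq> 0"
  have "(F has_derivative (\<lambda>v. dd v F x)) (at x)"
    by (rule smooth_on_has_derivative[OF smooth_F open_punct]) (use x in auto)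
  hence "(E has_derivative (\<lambda>v. F x * dd v F x)) (at x)"
    unfolding E_def[abs_def] by (auto intro!: derivative_eq_intros)
  thus ?thesis by (rule dd_unique)
qed

text \<open>\<open>F\<close> is 1-Lipschitz for the metric. By Euler, \<open>F\<close> times its
  differential is the metric product with the position vector, whose metric length is
  \<open>F x\<close>, so Cauchy-Schwarz applies.\<close>

lemma dd_F_le:
  assumes x: "x \<noteq> 0"
  shows "\<bar>dd v F x\<bar> \<le> sqrt (hs E x v v)"
proof -
  have "(F x * dd v F x)\<^sup>2 \<le> (F x)\<^sup>2 * hs E x v v"
    using cauchy_schwarz[OF x, of x v] euler[OF x] dd_E_F[OF x] by metis
  hence "(dd v F x)\<^sup>2 \<le> hs E x v v" using F_pos[OF x] by (simp add: power_mult_distrib)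
  thus ?thesis using real_le_rsqrt by (metis power2_abs)
qed

text \<open>The metric is homogeneous of degree 0 in the base point, so a minimum over pairs of unit
  vectors bounds it everywhere, uniformly up to the origin.\<close>

lemma hs_lower_bound: "\<exists>c>0. \<forall>x v. x \<noteq> 0 \<longrightarrow> c * (norm v)\<^sup>2 \<le> hs E x v v"
proof -
  let ?S = "sphere (0::real^'n) 1 \<times> sphere (0::real^'n) 1"
  have "continuous_on ?S (\<lambda>z. hs E (fst z) (snd z) (snd z))"
    by (intro continuous_on_hs_vary continuous_intros) auto
  moreover have "compact ?S" by (intro compact_Times compact_sphere)
  moreover have "axis undefined 1 \<in> sphere (0::real^'n) 1" by simp
  hence "?S \<noteq> {}" by blast
  ultimately obtain z where z: "z \<in> ?S" "\<And>y. y \<in> ?S \<Longrightarrow> hs E (fst z) (snd z) (snd z) \<le> hs E (fst y) (snd y) (snd y)"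
    using continuous_attains_inf[of ?S "\<lambda>z. hs E (fst z) (snd z) (snd z)"] by blast
  define c where "c = hs E (fst z) (snd z) (snd z)"
  have "c > 0" unfolding c_def by (rule pos) (use z(1) in auto)
  moreover have "c * (norm v)\<^sup>2 \<le> hs E x v v" if x: "x \<noteq> 0" for x v
  proof (cases "v = 0")
    case False
    have "c \<le> hs E ((1 / norm x) *\<^sub>R x) ((1 / norm v) *\<^sub>R v) ((1 / norm v) *\<^sub>R v)"
      unfolding c_def using z(2)[of "((1 / norm x) *\<^sub>R x, (1 / norm v) *\<^sub>R v)"] x False by simp
    also have "\<dots> = hs E x v v / (norm v)\<^sup>2"
      using homogeneous_derivatives(2)[of "1 / norm x" x] x by (simp add: power2_eq_square)
    finally show ?thesis using False by (simp add: field_simps)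
  qed (use x in auto)
  ultimately show ?thesis by blast
qed

section \<open>The group of isometries and its action on \<open>F\<close>\<close>

lemma isometriesD:
  assumes "\<Phi> \<in> isometries F"
  shows "\<Phi> 0 = 0" "bij_betw \<Phi> punct punct" "smooth_map_on punct \<Phi>" "smooth_map_on punct (inv_into punct \<Phi>)"
    "x \<noteq> 0 \<Longrightarrow> hs E (\<Phi> x) (ddv u \<Phi> x) (ddv v \<Phi> x) = hs E x u v" "x \<noteq> 0 \<Longrightarrow> \<Phi> x \<noteq> 0"
proof -
  show b: "\<Phi> 0 = 0" "bij_betw \<Phi> punct punct" "smooth_map_on punct \<Phi>" "smooth_map_on punct (inv_into punct \<Phi>)"
    using assms unfolding isometries_def by auto
  show n: "x \<noteq> 0 \<Longrightarrow> \<Phi> x \<noteq> 0" for x using bij_betwE[OF b(2)] by auto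
  show "x \<noteq> 0 \<Longrightarrow> hs E (\<Phi> x) (ddv u \<Phi> x) (ddv v \<Phi> x) = hs E x u v"
    using assms n hess_metric_eq unfolding isometries_def jacobian_mult by fastforce
qed

lemma isometriesI:
  assumes "\<Phi> 0 = 0" "\<And>x. x \<noteq> 0 \<Longrightarrow> \<Phi> x \<noteq> 0" "\<And>x. x \<noteq> 0 \<Longrightarrow> \<Psi> x \<noteq> 0"
    "\<And>x. x \<noteq> 0 \<Longrightarrow> \<Psi> (\<Phi> x) = x" "\<And>x. x \<noteq> 0 \<Longrightarrow> \<Phi> (\<Psi> x) = x"
    "smooth_map_on punct \<Phi>" "smooth_map_on punct \<Psi>"
    "\<And>x u v. x \<noteq> 0 \<Longrightarrow> hs E (\<Phi> x) (ddv u \<Phi> x) (ddv v \<Phi> x) = hs E x u v"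
  shows "\<Phi> \<in> isometries F"
proof -
  have b: "bij_betw \<Phi> punct punct"
    by (rule bij_betwI[where g=\<Psi>]) (use assms in auto)
  have "inv_into punct \<Phi> x = \<Psi> x" if "x \<in> punct" for x
    by (rule inv_into_f_eq) (use b assms that in \<open>auto simp: bij_betw_def\<close>)
  hence "smooth_map_on punct (inv_into punct \<Phi>)"
    using smooth_map_on_cong[OF assms(7) open_punct] by simp
  thus ?thesis using assms b unfolding isometries_def jacobian_mult by (auto simp: hess_metric_eq)
qed

text \<open>The explicit value at 0 restores the convention that isometries send the origin to
  itself, which \<open>inv_into punct\<close> does not ensure.\<close>

definition inv_iso :: "(real^'n \<Rightarrow> real^'n) \<Rightarrow> real^'n \<Rightarrow> real^'n" where
  "inv_iso \<Phi> x = (if x = 0 then 0 else inv_into punct \<Phi> x)"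

lemma inv_iso:
  assumes "\<Phi> \<in> isometries F"
  shows "inv_iso \<Phi> \<in> isometries F" "\<Phi> (inv_iso \<Phi> x) = x" "inv_iso \<Phi> (\<Phi> x) = x"
proof -
  note D = isometriesD[OF assms]
  have l: "\<Phi> (inv_iso \<Phi> x) = x" for x
    using D(1,2) f_inv_into_f[of x \<Phi> punct] by (auto simp: inv_iso_def bij_betw_def)
  have r: "inv_iso \<Phi> (\<Phi> x) = x" for x
  proof (cases "x = 0")
    case False
    hence "inv_into punct \<Phi> (\<Phi> x) = x" using D(2) by (intro inv_into_f_f) (auto simp: bij_betw_def)
    thus ?thesis using D(6)[OF False] by (simp add: inv_iso_def)
  qed (use D(1) in \<open>simp add: inv_iso_def\<close>)
  have n: "inv_iso \<Phi> x \<noteq> 0" if "x \<noteq> 0" for x using l[of x] D(1) that by metis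
  have s: "smooth_map_on punct (inv_iso \<Phi>)"
    by (rule smooth_map_on_cong[OF D(4) open_punct]) (auto simp: inv_iso_def)
  show "inv_iso \<Phi> \<in> isometries F"
  proof (rule isometriesI[where \<Psi>=\<Phi>])
    fix x u v :: "real^'n" assume x: "x \<noteq> 0"
    have "ddv (ddv u (inv_iso \<Phi>) x) \<Phi> (inv_iso \<Phi> x) = u" for u
    proof -
      have "ddv (ddv u (inv_iso \<Phi>) x) \<Phi> (inv_iso \<Phi> x) = ddv u (\<lambda>x. \<Phi> (inv_iso \<Phi> x)) x"
        by (rule ddv_comp[OF open_punct open_punct _ _ s D(3), symmetric]) (use x n in auto)
      also have "\<dots> = ddv u (\<lambda>x. x) x" using l by (simp add: ddv_def)
      also have "\<dots> = u" by (rule ddv_linear) (simp add: linear_id[unfolded id_def])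
      finally show ?thesis .
    qed
    thus "hs E (inv_iso \<Phi> x) (ddv u (inv_iso \<Phi>) x) (ddv v (inv_iso \<Phi>) x) = hs E x u v"
      using D(5)[OF n[OF x], of "ddv u (inv_iso \<Phi>) x" "ddv v (inv_iso \<Phi>) x"] l by simp
  qed (use D(1,3,6) l r n s in \<open>simp_all add: inv_iso_def[of _ 0]\<close>)
  show "\<Phi> (inv_iso \<Phi> x) = x" "inv_iso \<Phi> (\<Phi> x) = x" by (fact l r)+
qed

lemma compose_iso:
  assumes "\<Phi> \<in> isometries F" "\<Psi> \<in> isometries F"
  shows "(\<lambda>x. \<Phi> (\<Psi> x)) \<in> isometries F"
proof -
  note D = isometriesD[OF assms(1)] and D' = isometriesD[OF assms(2)]
  note I = isometriesD[OF inv_iso(1)[OF assms(1)]] and I' = isometriesD[OF inv_iso(1)[OF assms(2)]]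
  show ?thesis
  proof (rule isometriesI[where \<Psi>="\<lambda>x. inv_iso \<Psi> (inv_iso \<Phi> x)"])
    fix x u v :: "real^'n" assume x: "x \<noteq> 0"
    have "ddv u (\<lambda>x. \<Phi> (\<Psi> x)) x = ddv (ddv u \<Psi> x) \<Phi> (\<Psi> x)" for u
      by (rule ddv_comp[OF open_punct open_punct _ _ D'(3) D(3)]) (use x D' in auto)
    thus "hs E (\<Phi> (\<Psi> x)) (ddv u (\<lambda>x. \<Phi> (\<Psi> x)) x) (ddv v (\<lambda>x. \<Phi> (\<Psi> x)) x) = hs E x u v"
      using x D(5) D'(5,6) by simp
  next
    show "smooth_map_on punct (\<lambda>x. \<Phi> (\<Psi> x))"
      by (rule smooth_map_on_compose[OF open_punct open_punct]) (use D D' in auto)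
    show "smooth_map_on punct (\<lambda>x. inv_iso \<Psi> (inv_iso \<Phi> x))"
      by (rule smooth_map_on_compose[OF open_punct open_punct]) (use I I' in auto)
  qed (use D(1,6) D'(1,6) I(1,6) I'(1,6) inv_iso(2,3)[OF assms(1)] inv_iso(2,3)[OF assms(2)] in simp_all)
qed

lemma linear_isometry:
  assumes L: "linear L" "inj L" and eq: "\<And>x. F (L x) = F x"
  shows "L \<in> isometries F"
proof -
  have eqE: "E (L x) = 1 * E x" for x by (simp add: E_def eq)
  have surj: "surj L" using L linear_injective_imp_surjective by blast
  hence inv: "linear (inv L)" using L by (metis inj_linear_imp_inv_linear)
  show ?thesis
  proof (rule isometriesI[where \<Psi>="inv L"])
    show "hs E (L x) (ddv u L x) (ddv v L x) = hs E x u v" if "x \<noteq> 0" for x u v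
      using E_similarity(2)[OF L eqE that] by (simp add: ddv_linear[OF L(1)])
    show "L x \<noteq> 0" if "x \<noteq> 0" for x using that L by (auto simp: linear_injective_0)
    show "inv L x \<noteq> 0" if "x \<noteq> 0" for x using that surj L by (metis linear_0 surj_f_inv_f)
  qed (use L inv surj in \<open>auto intro!: smooth_map_on_linear open_punct simp: linear_0 surj_f_inv_f\<close>)
qed

lemma id_isometry: "id \<in> isometries F"
  by (rule linear_isometry) (auto simp: linear_id)

text \<open>The image of the ray from 0 to \<open>x\<close> has constant metric speed
  \<open>F x\<close>. If it starts at the origin, then \<open>F\<close>, being 1-Lipschitz, can grow
  by at most \<open>F x\<close> along it during the unit time that leads to
  \<open>\<Phi> x\<close>.\<close>

lemma iso_F_le:
  assumes \<Phi>: "\<Phi> \<in> isometries F" and x: "x \<noteq> 0"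
  shows "F (\<Phi> x) \<le> F x"
proof -
  note D = isometriesD[OF \<Phi>]
  obtain c where c: "c > 0" "\<And>x v. x \<noteq> 0 \<Longrightarrow> c * (norm v)\<^sup>2 \<le> hs E x v v"
    using hs_lower_bound by blast
  define \<gamma> where "\<gamma> t = \<Phi> (t *\<^sub>R x)" for t :: real
  define g where "g t = ddv x \<Phi> (t *\<^sub>R x)" for t :: real
  have \<gamma>0: "\<gamma> t \<noteq> 0" if "t > 0" for t using D(6) that x by (simp add: \<gamma>_def)
  have dg: "(\<gamma> has_vector_derivative g t) (at t)" if "t > 0" for t
    unfolding \<gamma>_def[abs_def] g_def
    by (rule smooth_map_curve[OF open_punct D(3) ray_deriv]) (use that x in auto)
  have hg: "hs E (\<gamma> t) (g t) (g t) = (F x)\<^sup>2" if "t > 0" for t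
    using D(5)[of "t *\<^sub>R x" x x] homogeneous_derivatives(2)[OF that x] euler(3)[OF x] that x
    by (simp add: \<gamma>_def g_def)
  have ng: "norm (g t) \<le> F x / sqrt c" if "t > 0" for t
  proof -
    have "c * (norm (g t))\<^sup>2 \<le> (F x)\<^sup>2" using c(2)[OF \<gamma>0[OF that], of "g t"] hg[OF that] by simp
    hence "(norm (g t))\<^sup>2 \<le> (F x)\<^sup>2 / c" using c(1) by (simp add: field_simps)
    hence "norm (g t) \<le> sqrt ((F x)\<^sup>2 / c)" by (rule real_le_rsqrt)
    thus ?thesis using F_nonneg by (simp add: real_sqrt_divide)
  qed
  \<comment> \<open>By \<open>hs_lower_bound\<close> the bounded metric speed bounds the Euclidean
    speed, so the image curve converges as the parameter tends to 0.\<close>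
  have lip: "norm (\<gamma> s - \<gamma> t) \<le> F x / sqrt c * norm (s - t)" if "s > 0" "t > 0" for s t
  proof (rule differentiable_bound[of "{0<..}"])
    show "(\<gamma> has_derivative (\<lambda>h. h *\<^sub>R g r)) (at r within {0<..})" if "r \<in> {0<..}" for r
      using dg[of r] that unfolding has_vector_derivative_def by (auto intro: has_derivative_at_withinI)
    show "onorm (\<lambda>h. h *\<^sub>R g r) \<le> F x / sqrt c" if "r \<in> {0<..}" for r
      by (rule onorm_bound) (use mult_left_mono[OF ng[of r] abs_ge_zero] that F_nonneg c in \<open>auto simp: mult.commute\<close>)
  qed (use that in auto)
  define tn where "tn n = inverse (real (Suc n))" for n
  have tn: "tn n > 0" "tn n \<le> 1" "tn \<longlonglongrightarrow> 0" for n
    using LIMSEQ_inverse_real_of_nat by (auto simp: tn_def[abs_def] divide_simps)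
  have "Cauchy (\<lambda>n. \<gamma> (tn n))"
  proof (rule metric_CauchyI)
    fix e :: real assume e: "e > 0"
    define K where "K = F x / sqrt c"
    have K: "K > 0" using F_pos[OF x] c by (simp add: K_def)
    have "Cauchy tn" using tn(3) by (rule LIMSEQ_imp_Cauchy)
    then obtain M where M: "\<And>m n. m \<ge> M \<Longrightarrow> n \<ge> M \<Longrightarrow> dist (tn m) (tn n) < e / K"
      using e K by (meson divide_pos_pos metric_CauchyD)
    have "dist (\<gamma> (tn m)) (\<gamma> (tn n)) < e" if "m \<ge> M" "n \<ge> M" for m n
    proof -
      have "dist (\<gamma> (tn m)) (\<gamma> (tn n)) \<le> K * dist (tn m) (tn n)"
        using lip[OF tn(1) tn(1), of m n] by (simp add: K_def dist_norm)
      also have "\<dots> < K * (e / K)" using M[OF that] K by (intro mult_strict_left_mono)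
      finally show ?thesis using K by simp
    qed
    thus "\<exists>M. \<forall>m\<ge>M. \<forall>n\<ge>M. dist (\<gamma> (tn m)) (\<gamma> (tn n)) < e" by blast
  qed
  then obtain p where p: "(\<lambda>n. \<gamma> (tn n)) \<longlonglongrightarrow> p" using Cauchy_convergent convergentD by blast
  \<comment> \<open>At a nonzero limit the inverse isometry would be continuous and would send it to
    the limit of \<open>tn n *\<^sub>R x\<close>, which is 0.\<close>
  have p0: "p = 0"
  proof (rule ccontr)
    assume "p \<noteq> 0"
    note I = isometriesD[OF inv_iso(1)[OF \<Phi>]]
    have "isCont (inv_iso \<Phi>) p"
      using smooth_map_continuous[OF I(3) open_punct] \<open>p \<noteq> 0\<close> continuous_on_eq_continuous_at[OF open_punct] by blast
    hence "(\<lambda>n. inv_iso \<Phi> (\<gamma> (tn n))) \<longlonglongrightarrow> inv_iso \<Phi> p" using p by (rule isCont_tendsto_compose)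
    hence "(\<lambda>n. tn n *\<^sub>R x) \<longlonglongrightarrow> inv_iso \<Phi> p" unfolding \<gamma>_def inv_iso(3)[OF \<Phi>] .
    moreover have "(\<lambda>n. tn n *\<^sub>R x) \<longlonglongrightarrow> 0 *\<^sub>R x" by (intro tendsto_intros tn)
    ultimately have "inv_iso \<Phi> p = 0" using LIMSEQ_unique by fastforce
    thus False using I(6) \<open>p \<noteq> 0\<close> by blast
  qed
  have dF: "((\<lambda>t. F (\<gamma> t)) has_real_derivative dd (g t) F (\<gamma> t)) (at t)" if "t > 0" for t
    by (rule smooth_fun.DERIV_curve[OF smooth_fun.intro[OF open_punct smooth_F] dg[OF that]])
       (use \<gamma>0[OF that] in auto)
  have bF: "\<bar>dd (g t) F (\<gamma> t)\<bar> \<le> F x" if "t > 0" for t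
    using dd_F_le[OF \<gamma>0[OF that], of "g t"] hg[OF that] F_nonneg by simp
  have est: "F (\<Phi> x) \<le> F (\<gamma> (tn n)) + F x" for n
  proof -
    have "norm (F (\<gamma> 1) - F (\<gamma> (tn n))) \<le> F x * norm (1 - tn n)"
    proof (rule field_differentiable_bound[of "{0<..}"])
      show "((\<lambda>t. F (\<gamma> t)) has_field_derivative dd (g t) F (\<gamma> t)) (at t within {0<..})" if "t \<in> {0<..}" for t
        using dF that by (auto intro: has_field_derivative_at_within)
    qed (use bF tn in auto)
    also have "\<dots> \<le> F x * 1" using tn(1,2)[of n] F_nonneg by (intro mult_left_mono) auto
    finally show ?thesis by (simp add: \<gamma>_def abs_le_iff)
  qed
  have "isCont F 0" using continuous_F by (simp add: continuous_on_eq_continuous_at)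
  hence "(\<lambda>n. F (\<gamma> (tn n))) \<longlonglongrightarrow> F 0" using p unfolding p0 by (rule isCont_tendsto_compose)
  hence "(\<lambda>n. F (\<gamma> (tn n)) + F x) \<longlonglongrightarrow> 0 + F x" by (intro tendsto_intros) simp
  from LIMSEQ_le_const[OF this] est show ?thesis by auto
qed

lemma iso_F:
  assumes \<Phi>: "\<Phi> \<in> isometries F"
  shows "F (\<Phi> x) = F x"
proof (cases "x = 0")
  case False
  have "F x \<le> F (\<Phi> x)"
    using iso_F_le[OF inv_iso(1)[OF \<Phi>], of "\<Phi> x"] inv_iso(3)[OF \<Phi>] isometriesD(6)[OF \<Phi> False] by metis
  with iso_F_le[OF \<Phi> False] show ?thesis by simp
qed (use isometriesD(1)[OF \<Phi>] in simp)

text \<open>Sectional curvatures determine the curvature tensor, so this says that the curvature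
  does not vanish at \<open>x\<close>.\<close>

definition nonflat :: "real^'n \<Rightarrow> bool" where
  "nonflat x \<longleftrightarrow> (\<exists>u v. kap E x u v \<noteq> 0)"

lemma nonflat_iso:
  assumes "\<Phi> \<in> isometries F" "x \<noteq> 0" "nonflat x"
  shows "nonflat (\<Phi> x)"
proof -
  note D = isometriesD[OF assms(1)]
  have "kap E (\<Phi> x) (ddv u \<Phi> x) (ddv v \<Phi> x) = kap E x u v" for u v
    by (rule kap_isometry[OF hess_fun_axioms hess_fun_axioms D(3)]) (use D assms in auto)
  thus ?thesis using assms(3) unfolding nonflat_def by metis
qed

lemma nonflat_iso_iff:
  assumes "\<Phi> \<in> isometries F" "x \<noteq> 0"
  shows "nonflat (\<Phi> x) \<longleftrightarrow> nonflat x"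
  using nonflat_iso[OF assms] nonflat_iso[OF inv_iso(1)[OF assms(1)], of "\<Phi> x"]
    isometriesD(6)[OF assms(1)] assms inv_iso(3)[OF assms(1)] by auto

lemma nonflat_scaleR: "c > 0 \<Longrightarrow> x \<noteq> 0 \<Longrightarrow> nonflat x \<Longrightarrow> nonflat (c *\<^sub>R x)"
proof -
  assume c: "c > 0" and x: "x \<noteq> 0" and "nonflat x"
  then obtain u v where "kap E x u v \<noteq> 0" unfolding nonflat_def by blast
  moreover have "kap E (c *\<^sub>R x) (c *\<^sub>R u) (c *\<^sub>R v) = c\<^sup>2 * kap E x u v"
    by (rule kap_similarity) (use c x in \<open>auto simp: linear_scale_self inj_on_def E_scaleR\<close>)
  ultimately show ?thesis using c unfolding nonflat_def by (metis mult_eq_0_iff power_eq_0_iff less_irrefl)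
qed

lemma open_nonflat: "open {x. x \<noteq> 0 \<and> nonflat x}"
proof -
  have "open (punct \<inter> (\<lambda>x. kap E x u v) -` (UNIV - {0}))" for u v
    by (rule continuous_open_preimage[OF continuous_on_kap open_punct]) (auto simp: open_delete)
  hence "open (\<Union>u. \<Union>v. punct \<inter> (\<lambda>x. kap E x u v) -` (UNIV - {0}))" by blast
  moreover have "(\<Union>u. \<Union>v. punct \<inter> (\<lambda>x. kap E x u v) -` (UNIV - {0})) = {x. x \<noteq> 0 \<and> nonflat x}"
    by (auto simp: nonflat_def)
  ultimately show ?thesis by simp
qed

end

subsection \<open>Norms with block symmetry\<close>

text \<open>\<open>\<pi>\<close> is the orthogonal projection onto one block. If that block is a line (\<open>k < 2\<close>), then the norm
  need not be reversible along it, and \<open>p0\<close> is a unit vector on the line.\<close>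

locale sym_minkowski = minkowski F for F :: "real^'n::finite \<Rightarrow> real" +
  fixes \<pi> :: "real^'n \<Rightarrow> real^'n" and k :: nat and p0 :: "real^'n"
  assumes lin: "linear \<pi>" and idem: "\<pi> (\<pi> x) = \<pi> x" and selfadj: "\<pi> x \<bullet> y = x \<bullet> \<pi> y"
    and sym2: "\<pi> x = \<pi> y \<Longrightarrow> norm (x - \<pi> x) = norm (y - \<pi> y) \<Longrightarrow> F x = F y"
    and sym1: "\<not> k < 2 \<Longrightarrow> x - \<pi> x = y - \<pi> y \<Longrightarrow> norm (\<pi> x) = norm (\<pi> y) \<Longrightarrow> F x = F y"
    and one: "k < 2 \<Longrightarrow> \<pi> x = (p0 \<bullet> x) *\<^sub>R p0"
    and p0: "norm p0 = 1" "\<pi> p0 = p0"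
    and dim2: "\<exists>Y. norm Y = 1 \<and> \<pi> Y = 0 \<and> Y \<bullet> q = 0"
begin

abbreviation one :: bool where "one \<equiv> k < 2"

lemmas \<pi>_simps [simp] = linear_add[OF lin] linear_diff[OF lin] linear_scale[OF lin] linear_0[OF lin]
  linear_neg[OF lin] idem

text \<open>On a line block the sign is kept, so that in both cases \<open>F\<close> is a function
  of \<open>aa\<close> and \<open>bb\<close>.\<close>

definition aa :: "real^'n \<Rightarrow> real" where "aa x = (if one then p0 \<bullet> x else norm (\<pi> x))"
definition bb :: "real^'n \<Rightarrow> real" where "bb x = norm (x - \<pi> x)"

text \<open>An orthonormal pair spanning a plane that meets every orbit of the symmetries. On a line
  block the orientation of \<open>p\<close> is part of the data.\<close>

definition frame :: "real^'n \<Rightarrow> real^'n \<Rightarrow> bool" where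
  "frame p q \<longleftrightarrow> norm p = 1 \<and> \<pi> p = p \<and> norm q = 1 \<and> \<pi> q = 0 \<and> (one \<longrightarrow> p = p0)"

lemma frameD:
  assumes "frame p q"
  shows "norm p = 1" "\<pi> p = p" "norm q = 1" "\<pi> q = 0" "one \<Longrightarrow> p = p0" "p \<bullet> q = 0" "q \<bullet> p = 0"
    "p \<bullet> p = 1" "q \<bullet> q = 1"
proof -
  show *: "norm p = 1" "\<pi> p = p" "norm q = 1" "\<pi> q = 0" "one \<Longrightarrow> p = p0"
    using assms by (auto simp: frame_def)
  show "p \<bullet> q = 0" "q \<bullet> p = 0" using selfadj[of p q] * by (auto simp: inner_commute)
  show "p \<bullet> p = 1" "q \<bullet> q = 1" using * by (auto simp: norm_eq_1)
qed

lemma frame_inner: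
  assumes "frame p q"
  shows "(\<alpha> *\<^sub>R p + \<beta> *\<^sub>R q) \<bullet> (\<gamma> *\<^sub>R p + \<delta> *\<^sub>R q) = \<alpha> * \<gamma> + \<beta> * \<delta>"
  using frameD[OF assms] by (simp add: inner_simps)

lemma frame_zero:
  assumes "frame p q"
  shows "\<alpha> *\<^sub>R p + \<beta> *\<^sub>R q = 0 \<longleftrightarrow> \<alpha> = 0 \<and> \<beta> = 0"
proof -
  have "\<alpha> *\<^sub>R p + \<beta> *\<^sub>R q = 0 \<longleftrightarrow> \<alpha> * \<alpha> + \<beta> * \<beta> = 0"
    using frame_inner[OF assms, of \<alpha> \<beta> \<alpha> \<beta>] by (metis inner_eq_zero_iff)
  thus ?thesis by (simp add: sum_squares_eq_zero_iff)
qed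

lemma frame_aa_bb:
  assumes "frame p q"
  shows "aa (\<alpha> *\<^sub>R p + \<beta> *\<^sub>R q) = (if one then \<alpha> else \<bar>\<alpha>\<bar>)" "bb (\<alpha> *\<^sub>R p + \<beta> *\<^sub>R q) = \<bar>\<beta>\<bar>"
    "\<pi> (\<alpha> *\<^sub>R p + \<beta> *\<^sub>R q) = \<alpha> *\<^sub>R p" "norm (\<alpha> *\<^sub>R p + \<beta> *\<^sub>R q) = sqrt (\<alpha>\<^sup>2 + \<beta>\<^sup>2)"
  using frameD[OF assms] frame_inner[OF assms, of \<alpha> \<beta> \<alpha> \<beta>]
  by (auto simp: aa_def bb_def inner_simps norm_eq_sqrt_inner power2_eq_square)

lemma frame_exists:
  obtains p q where "frame p q" "x = aa x *\<^sub>R p + bb x *\<^sub>R q"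
proof -
  obtain p where p: "norm p = 1" "\<pi> p = p" "one \<longrightarrow> p = p0" "\<pi> x = aa x *\<^sub>R p"
  proof (cases "one \<or> \<pi> x = 0")
    case True
    thus thesis using that[of p0] p0 one[of x] by (auto simp: aa_def)
  next
    case False
    thus thesis using that[of "(1 / norm (\<pi> x)) *\<^sub>R \<pi> x"] by (auto simp: aa_def)
  qed
  obtain q where q: "norm q = 1" "\<pi> q = 0" "x - \<pi> x = bb x *\<^sub>R q"
  proof (cases "x - \<pi> x = 0")
    case True
    thus thesis using that dim2[of 0] by (auto simp: bb_def)
  next
    case False
    thus thesis using that[of "(1 / norm (x - \<pi> x)) *\<^sub>R (x - \<pi> x)"] by (auto simp: bb_def)
  qed
  have "x = aa x *\<^sub>R p + bb x *\<^sub>R q" using p(4) q(3) by (metis add_diff_cancel_left' diff_add_cancel add.commute)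
  thus thesis using that[of p q] p q by (auto simp: frame_def)
qed

lemma frame_ex: "\<exists>p q. frame p q"
  using frame_exists[of 0] by blast

lemma norm_aa_bb: "(norm x)\<^sup>2 = (aa x)\<^sup>2 + (bb x)\<^sup>2"
proof -
  obtain p q where f: "frame p q" "x = aa x *\<^sub>R p + bb x *\<^sub>R q" by (rule frame_exists)
  have "norm x = sqrt ((aa x)\<^sup>2 + (bb x)\<^sup>2)" using frame_aa_bb(4)[OF f(1), of "aa x" "bb x"] f(2) by simp
  thus ?thesis by simp
qed

lemma bb_nonneg: "bb x \<ge> 0" by (simp add: bb_def)
lemma aa_nonneg: "\<not> one \<Longrightarrow> aa x \<ge> 0" by (simp add: aa_def)

text \<open>Reflections inside a block are included, so this is larger than the given group.
  \<open>F\<close> is still invariant because \<open>sym1\<close> and \<open>sym2\<close> compare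
  only norms of components.\<close>

definition sym_map :: "(real^'n \<Rightarrow> real^'n) \<Rightarrow> bool" where
  "sym_map L \<longleftrightarrow> linear L \<and> (\<forall>x. norm (L x) = norm x) \<and> (\<forall>x. \<pi> (L x) = L (\<pi> x)) \<and> (one \<longrightarrow> L p0 = p0)"

lemma sym_map_F:
  assumes "sym_map L"
  shows "F (L x) = F x"
proof -
  have L: "linear L" "\<And>x. norm (L x) = norm x" "\<And>x. \<pi> (L x) = L (\<pi> x)" "one \<Longrightarrow> L p0 = p0"
    using assms by (auto simp: sym_map_def)
  \<comment> \<open>An intermediate point: only the complementary component has been moved, so
    \<open>sym2\<close> compares it with \<open>x\<close> and \<open>sym1\<close> with
    \<open>L x\<close>.\<close>
  define z where "z = \<pi> x + L (x - \<pi> x)"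
  have z: "\<pi> z = \<pi> x" "z - \<pi> z = L (x - \<pi> x)" by (auto simp: z_def L linear_0[OF L(1)])
  have "F z = F x" by (rule sym2) (use z L in auto)
  moreover have "F (L x) = F z"
  proof (cases one)
    case True
    have "L (\<pi> x) = \<pi> x" using L(1,4) True one[OF True, of x] by (simp add: linear_scale)
    thus ?thesis by (simp add: z_def linear_diff[OF L(1)])
  next
    case False
    show ?thesis by (rule sym1[OF False]) (use z L in \<open>auto simp: linear_diff\<close>)
  qed
  ultimately show ?thesis by simp
qed

lemma sym_map_inj: "sym_map L \<Longrightarrow> linear L \<and> inj L"
  unfolding sym_map_def by (metis linear_injective_0 norm_eq_zero)

lemma sym_map_derivs:
  assumes L: "sym_map L" and x: "x \<noteq> 0"
  shows "dd (L u) E (L x) = dd u E x"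
    "hs E (L x) (L u) (L v) = hs E x u v"
    "td E (L x) (L u) (L v) (L w) = td E x u v w"
    "nonflat x \<Longrightarrow> nonflat (L x)"
proof -
  have eq: "E (L x) = 1 * E x" for x by (simp add: E_def sym_map_F[OF L])
  have L': "linear L" "inj L" using sym_map_inj[OF L] by auto
  show "dd (L u) E (L x) = dd u E x"
    "hs E (L x) (L u) (L v) = hs E x u v"
    "td E (L x) (L u) (L v) (L w) = td E x u v w"
    using E_similarity[OF L' eq x] by simp_all
  assume "nonflat x"
  then obtain u v where "kap E x u v \<noteq> 0" unfolding nonflat_def by blast
  hence "kap E (L x) (L u) (L v) \<noteq> 0" using kap_similarity[OF L' eq _ x, of u v] by simp
  thus "nonflat (L x)" unfolding nonflat_def by blast
qed

lemma sym_map_compose: "sym_map L \<Longrightarrow> sym_map M \<Longrightarrow> sym_map (\<lambda>x. L (M x))"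
  unfolding sym_map_def by (auto simp: linear_compose[unfolded o_def])

lemma sym_map_id: "sym_map (\<lambda>x. x)"
  by (simp add: sym_map_def linear_id[unfolded id_def])

lemma sym_map_reflection:
  assumes w: "norm w = 1" and "\<pi> w = 0 \<or> \<not> one \<and> \<pi> w = w"
  shows "sym_map (\<lambda>v. v - (2 * (w \<bullet> v)) *\<^sub>R w)"
proof -
  have ww: "w \<bullet> w = 1" using w by (simp add: norm_eq_1)
  have l: "linear (\<lambda>v. v - (2 * (w \<bullet> v)) *\<^sub>R w)"
    by (rule linearI) (simp_all add: inner_simps algebra_simps)
  have n: "norm (v - (2 * (w \<bullet> v)) *\<^sub>R w) = norm v" for v
    using ww by (simp add: norm_eq_sqrt_inner inner_simps inner_commute algebra_simps)
  have "\<pi> w = 0 \<Longrightarrow> w \<bullet> \<pi> v = 0" for v using selfadj[of w v] by simp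
  moreover have "\<pi> w = w \<Longrightarrow> w \<bullet> \<pi> v = w \<bullet> v" for v using selfadj[of w v] by simp
  moreover have "\<pi> w = 0 \<Longrightarrow> w \<bullet> p0 = 0" using selfadj[of w p0] p0 by simp
  ultimately show ?thesis unfolding sym_map_def using l n assms(2) by auto
qed

text \<open>These maps fix the plane of the frame, or only its first axis, and act by -1 on the
  orthogonal complement. At a fixed point, a derivative of \<open>E\<close> taken an odd number of
  times in complementary directions must vanish.\<close>

lemma sym_map_half_turn:
  assumes f: "frame p q"
  shows "sym_map (\<lambda>v. (2 * (p \<bullet> v)) *\<^sub>R p + (2 * (q \<bullet> v)) *\<^sub>R q - v)"
    and "sym_map (\<lambda>v. (2 * (p \<bullet> v)) *\<^sub>R p - v)"
proof -
  note D = frameD[OF f]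
  have pp: "p \<bullet> \<pi> v = p \<bullet> v" "q \<bullet> \<pi> v = 0" for v using selfadj[of p v] selfadj[of q v] D by auto
  show "sym_map (\<lambda>v. (2 * (p \<bullet> v)) *\<^sub>R p + (2 * (q \<bullet> v)) *\<^sub>R q - v)"
    unfolding sym_map_def
  proof (intro conjI allI impI)
    show "linear (\<lambda>v. (2 * (p \<bullet> v)) *\<^sub>R p + (2 * (q \<bullet> v)) *\<^sub>R q - v)"
      by (rule linearI) (simp_all add: inner_simps algebra_simps)
    show "norm ((2 * (p \<bullet> v)) *\<^sub>R p + (2 * (q \<bullet> v)) *\<^sub>R q - v) = norm v" for v
      using D by (simp add: norm_eq_sqrt_inner inner_simps inner_commute algebra_simps)
    show "one \<Longrightarrow> (2 * (p \<bullet> p0)) *\<^sub>R p + (2 * (q \<bullet> p0)) *\<^sub>R q - p0 = p0"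
      using D by (auto simp: algebra_simps scaleR_2)
  qed (use D pp in \<open>simp add: algebra_simps\<close>)
  show "sym_map (\<lambda>v. (2 * (p \<bullet> v)) *\<^sub>R p - v)"
    unfolding sym_map_def
  proof (intro conjI allI impI)
    show "linear (\<lambda>v. (2 * (p \<bullet> v)) *\<^sub>R p - v)"
      by (rule linearI) (simp_all add: inner_simps algebra_simps)
    show "norm ((2 * (p \<bullet> v)) *\<^sub>R p - v) = norm v" for v
      using D by (simp add: norm_eq_sqrt_inner inner_simps inner_commute algebra_simps)
    show "one \<Longrightarrow> (2 * (p \<bullet> p0)) *\<^sub>R p - p0 = p0"
      using D by (auto simp: algebra_simps scaleR_2)
  qed (use D pp in \<open>simp add: algebra_simps\<close>)
qed

lemma reflection_swap:
  assumes "norm u = 1" "norm v = (1::real)" "u \<noteq> v"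
  defines "w \<equiv> (1 / norm (u - v)) *\<^sub>R (u - v)"
  shows "u - (2 * (w \<bullet> u)) *\<^sub>R w = (v :: real^'n)"
proof -
  have n: "(norm (u - v))\<^sup>2 = 2 - 2 * (u \<bullet> v)" "u \<bullet> u = 1" "v \<bullet> v = 1"
    using assms(1,2) by (simp_all add: power2_norm_eq_inner inner_simps norm_eq_1 inner_commute)
  have nz: "norm (u - v) \<noteq> 0" using assms(3) by simp
  have "2 * (w \<bullet> u) * (1 / norm (u - v)) = 2 * ((u - v) \<bullet> u) / (norm (u - v))\<^sup>2"
    by (simp add: w_def power2_eq_square)
  also have "2 * ((u - v) \<bullet> u) = (norm (u - v))\<^sup>2" using n by (simp add: inner_simps inner_commute)
  also have "\<dots> / (norm (u - v))\<^sup>2 = 1" using nz by simp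
  finally have 1: "2 * (w \<bullet> u) * (1 / norm (u - v)) = 1" .
  have "(2 * (w \<bullet> u)) *\<^sub>R w = (2 * (w \<bullet> u) * (1 / norm (u - v))) *\<^sub>R (u - v)"
    by (subst (2) w_def) simp
  thus ?thesis unfolding 1 by simp
qed

text \<open>One reflection in each block: the first moves \<open>p\<close> and fixes
  \<open>q\<close>, the second moves \<open>q\<close> and fixes \<open>p'\<close>. On a line block
  the first is absent, because there \<open>p = p'\<close>.\<close>

lemma sym_map_frames:
  assumes f: "frame p q" and f': "frame p' q'"
  obtains L where "sym_map L" "L p = p'" "L q = q'"
proof -
  note D = frameD[OF f] and D' = frameD[OF f']
  obtain L where L: "sym_map L" "L p = p'" "L q = q"
  proof (cases "p = p'")
    case True
    thus thesis using that[of "\<lambda>x. x"] sym_map_id by simp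
  next
    case False
    hence no: "\<not> one" using D D' by auto
    define w where "w = (1 / norm (p - p')) *\<^sub>R (p - p')"
    have w: "norm w = 1" "\<pi> w = w" using False D D' by (auto simp: w_def)
    have wq: "w \<bullet> q = 0" using selfadj[of w q] w D by simp
    show thesis
    proof (rule that)
      show "sym_map (\<lambda>v. v - (2 * (w \<bullet> v)) *\<^sub>R w)" using sym_map_reflection w no by blast
      show "p - (2 * (w \<bullet> p)) *\<^sub>R w = p'" unfolding w_def by (rule reflection_swap[OF D(1) D'(1) False])
    qed (simp add: wq)
  qed
  obtain M where M: "sym_map M" "M p' = p'" "M q = q'"
  proof (cases "q = q'")
    case True
    thus thesis using that[of "\<lambda>x. x"] sym_map_id by simp
  next
    case False
    define w where "w = (1 / norm (q - q')) *\<^sub>R (q - q')"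
    have w: "norm w = 1" "\<pi> w = 0" using False D D' by (auto simp: w_def)
    have wp: "w \<bullet> p' = 0" using selfadj[of w p'] w D' by simp
    show thesis
    proof (rule that)
      show "sym_map (\<lambda>v. v - (2 * (w \<bullet> v)) *\<^sub>R w)" using sym_map_reflection w by blast
      show "q - (2 * (w \<bullet> q)) *\<^sub>R w = q'" unfolding w_def by (rule reflection_swap[OF D(3) D'(3) False])
    qed (simp add: wp)
  qed
  show thesis by (rule that[OF sym_map_compose[OF M(1) L(1)]]) (simp_all add: L M)
qed

lemma frame_transfer:
  assumes f: "frame p q" and f': "frame p' q'" and nz: "\<alpha> \<noteq> 0 \<or> \<beta> \<noteq> 0"
  shows "E (\<alpha> *\<^sub>R p + \<beta> *\<^sub>R q) = E (\<alpha> *\<^sub>R p' + \<beta> *\<^sub>R q')"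
    "hs E (\<alpha> *\<^sub>R p + \<beta> *\<^sub>R q) (a *\<^sub>R p + b *\<^sub>R q) (c *\<^sub>R p + d *\<^sub>R q)
      = hs E (\<alpha> *\<^sub>R p' + \<beta> *\<^sub>R q') (a *\<^sub>R p' + b *\<^sub>R q') (c *\<^sub>R p' + d *\<^sub>R q')"
    "nonflat (\<alpha> *\<^sub>R p + \<beta> *\<^sub>R q) \<Longrightarrow> nonflat (\<alpha> *\<^sub>R p' + \<beta> *\<^sub>R q')"
proof -
  obtain L where L: "sym_map L" "L p = p'" "L q = q'" using sym_map_frames[OF f f'] .
  have eq: "L (\<alpha> *\<^sub>R p + \<beta> *\<^sub>R q) = \<alpha> *\<^sub>R p' + \<beta> *\<^sub>R q'" for \<alpha> \<beta>
    using L by (simp add: sym_map_def linear_add linear_scale)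
  have "\<alpha> *\<^sub>R p + \<beta> *\<^sub>R q \<noteq> 0" using frame_zero[OF f] nz by simp
  note S = sym_map_derivs[OF L(1) this]
  show "E (\<alpha> *\<^sub>R p + \<beta> *\<^sub>R q) = E (\<alpha> *\<^sub>R p' + \<beta> *\<^sub>R q')"
    using sym_map_F[OF L(1), of "\<alpha> *\<^sub>R p + \<beta> *\<^sub>R q"] eq by (simp add: E_def)
  show "hs E (\<alpha> *\<^sub>R p + \<beta> *\<^sub>R q) (a *\<^sub>R p + b *\<^sub>R q) (c *\<^sub>R p + d *\<^sub>R q)
      = hs E (\<alpha> *\<^sub>R p' + \<beta> *\<^sub>R q') (a *\<^sub>R p' + b *\<^sub>R q') (c *\<^sub>R p' + d *\<^sub>R q')"
    using S(2)[of "a *\<^sub>R p + b *\<^sub>R q" "c *\<^sub>R p + d *\<^sub>R q"] unfolding eq by simp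
  show "nonflat (\<alpha> *\<^sub>R p + \<beta> *\<^sub>R q) \<Longrightarrow> nonflat (\<alpha> *\<^sub>R p' + \<beta> *\<^sub>R q')"
    using S(4) unfolding eq .
qed

text \<open>The half turn of the frame fixes \<open>x\<close>, \<open>p\<close> and \<open>q\<close>
  and negates vectors orthogonal to the plane, so every form with an odd number of such arguments
  vanishes.\<close>

lemma frame_orthogonal:
  assumes f: "frame p q" and nz: "\<alpha> \<noteq> 0 \<or> \<beta> \<noteq> 0" and w: "p \<bullet> w = 0" "q \<bullet> w = 0"
  defines "x \<equiv> \<alpha> *\<^sub>R p + \<beta> *\<^sub>R q"
  shows "hs E x (a *\<^sub>R p + b *\<^sub>R q) w = 0" "hs E x w (a *\<^sub>R p + b *\<^sub>R q) = 0"
    "td E x (a *\<^sub>R p + b *\<^sub>R q) (c *\<^sub>R p + d *\<^sub>R q) w = 0"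
    "p \<bullet> w' = 0 \<Longrightarrow> q \<bullet> w' = 0 \<Longrightarrow> p \<bullet> w'' = 0 \<Longrightarrow> q \<bullet> w'' = 0 \<Longrightarrow> td E x w w' w'' = 0"
proof -
  define L where "L = (\<lambda>v. (2 * (p \<bullet> v)) *\<^sub>R p + (2 * (q \<bullet> v)) *\<^sub>R q - v)"
  have L: "sym_map L" unfolding L_def by (rule sym_map_half_turn[OF f])
  have eq: "L (\<alpha> *\<^sub>R p + \<beta> *\<^sub>R q) = \<alpha> *\<^sub>R p + \<beta> *\<^sub>R q" for \<alpha> \<beta>
    using frameD[OF f] by (simp add: L_def inner_simps) (simp add: vec_eq_iff algebra_simps)
  have eq': "p \<bullet> w = 0 \<Longrightarrow> q \<bullet> w = 0 \<Longrightarrow> L w = - w" for w by (simp add: L_def)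
  have x: "x \<noteq> 0" using frame_zero[OF f] nz by (simp add: x_def)
  note S = sym_map_derivs[OF L x]
  have Lx: "L x = x" unfolding x_def by (rule eq)
  show 1: "hs E x (a *\<^sub>R p + b *\<^sub>R q) w = 0"
    using S(2)[of "a *\<^sub>R p + b *\<^sub>R q" w] x unfolding Lx eq eq'[OF w] by simp
  show "hs E x w (a *\<^sub>R p + b *\<^sub>R q) = 0" using 1 hs_commute[of x] x by simp
  define A B where "A = a *\<^sub>R p + b *\<^sub>R q" and "B = c *\<^sub>R p + d *\<^sub>R q"
  have "L A = A" "L B = B" unfolding A_def B_def by (rule eq)+
  hence "td E x A B w = 0" using S(3)[of A B w] x unfolding Lx eq'[OF w] by simp
  thus "td E x (a *\<^sub>R p + b *\<^sub>R q) (c *\<^sub>R p + d *\<^sub>R q) w = 0" unfolding A_def B_def .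
  show "p \<bullet> w' = 0 \<Longrightarrow> q \<bullet> w' = 0 \<Longrightarrow> p \<bullet> w'' = 0 \<Longrightarrow> q \<bullet> w'' = 0 \<Longrightarrow> td E x w w' w'' = 0"
    using S(3)[of w w' w''] x unfolding Lx by (simp add: eq' w)
qed

text \<open>On the block itself the third derivatives are odd under the half turn about the position
  vector, and by homogeneity they vanish in the radial direction.\<close>

lemma td_block:
  assumes x: "\<pi> x = x" "x \<noteq> 0"
  shows "td E x u v w = 0"
proof -
  have xp: "x \<in> punct" using x by simp
  obtain p q where f: "frame p q" "x = aa x *\<^sub>R p + bb x *\<^sub>R q" by (rule frame_exists)
  have b0: "bb x = 0" using x by (simp add: bb_def)
  hence xa: "x = aa x *\<^sub>R p" using f(2) by simp
  hence a0: "aa x \<noteq> 0" using x by auto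
  have pz: "td E x p a b = 0" for a b
    using euler(4)[OF x(2), of a b] a0 xa td_linear1(2)[of x "aa x" p a b] by (metis mult_eq_0_iff)
  define L where "L = (\<lambda>v. (2 * (p \<bullet> v)) *\<^sub>R p - v)"
  have L: "sym_map L" unfolding L_def by (rule sym_map_half_turn[OF f(1)])
  have Lx: "L x = x" by (subst (1 2) xa) (use frameD[OF f(1)] in \<open>simp add: L_def vec_eq_iff\<close>)
  have o: "td E x a b c = 0" if "p \<bullet> a = 0" "p \<bullet> b = 0" "p \<bullet> c = 0" for a b c
    using sym_map_derivs(3)[OF L x(2), of a b c] that xp unfolding Lx by (simp add: L_def)
  define pr where "pr v = v - (p \<bullet> v) *\<^sub>R p" for v
  have dec: "v = (p \<bullet> v) *\<^sub>R p + pr v" "p \<bullet> pr v = 0" for v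
    using frameD[OF f(1)] by (auto simp: pr_def inner_simps)
  have pz': "td E x a p b = 0" "td E x a b p = 0" for a b
    using pz td_commute[OF xp] by metis+
  have "td E x u v w = td E x (pr u) (pr v) (pr w)"
    using xp by (subst dec(1)[of u], subst dec(1)[of v], subst dec(1)[of w]) (simp add: pz pz')
  also have "\<dots> = 0" by (rule o) (rule dec)+
  finally show ?thesis .
qed

lemma flat_block:
  assumes "\<pi> x = x" "x \<noteq> 0"
  shows "\<not> nonflat x"
proof -
  have "cv E x u v = 0" for u v
    by (rule cv_unique) (use assms td_block[OF assms] in auto)
  thus ?thesis using assms by (simp add: nonflat_def kap_def)
qed

subsection \<open>The polar angle and its arc length\<close>

definition \<Theta> :: "real^'n \<Rightarrow> real" where "\<Theta> x = arccos (aa x / norm x)"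

definition \<Theta>max :: real where "\<Theta>max = (if one then pi else pi / 2)"

definition cc :: "real^'n \<Rightarrow> real^'n \<Rightarrow> real \<Rightarrow> real^'n" where
  "cc p q \<theta> = cos \<theta> *\<^sub>R p + sin \<theta> *\<^sub>R q"

definition cc' :: "real^'n \<Rightarrow> real^'n \<Rightarrow> real \<Rightarrow> real^'n" where
  "cc' p q \<theta> = - sin \<theta> *\<^sub>R p + cos \<theta> *\<^sub>R q"

lemma cos_sin_nonzero: "cos \<theta> \<noteq> 0 \<or> sin \<theta> \<noteq> 0" for \<theta> :: real
  by (metis sin_zero_abs_cos_one abs_zero zero_neq_one)

lemma cc_nz: "frame p q \<Longrightarrow> cc p q \<theta> \<noteq> 0"
  unfolding cc_def using frame_zero[of p q] cos_sin_nonzero by metis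

lemma norm_cc: "frame p q \<Longrightarrow> norm (cc p q \<theta>) = 1"
  unfolding cc_def by (simp add: frame_aa_bb)

lemma aa_quot:
  assumes x: "x \<noteq> 0"
  shows "-1 \<le> aa x / norm x" "aa x / norm x \<le> 1" "(aa x / norm x)\<^sup>2 + (bb x / norm x)\<^sup>2 = 1"
proof -
  have n: "norm x > 0" using x by simp
  have "(aa x)\<^sup>2 \<le> (norm x)\<^sup>2" using norm_aa_bb[of x] by simp
  hence "\<bar>aa x\<bar> \<le> norm x" using n by (simp add: abs_le_square_iff[symmetric])
  thus "-1 \<le> aa x / norm x" "aa x / norm x \<le> 1" using n by (auto simp: field_simps abs_le_iff)
  show "(aa x / norm x)\<^sup>2 + (bb x / norm x)\<^sup>2 = 1"
  proof -
    have "(aa x / norm x)\<^sup>2 + (bb x / norm x)\<^sup>2 = (norm x)\<^sup>2 / (norm x)\<^sup>2"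
      by (simp only: power_divide norm_aa_bb add_divide_distrib)
    also have "\<dots> = 1" by (rule divide_self) (use n in simp)
    finally show ?thesis .
  qed
qed

lemma cos_\<Theta>:
  assumes x: "x \<noteq> 0"
  shows "aa x = norm x * cos (\<Theta> x)" "bb x = norm x * sin (\<Theta> x)" "0 \<le> \<Theta> x" "\<Theta> x \<le> \<Theta>max"
proof -
  note q = aa_quot[OF x]
  show 1: "aa x = norm x * cos (\<Theta> x)" using q x by (simp add: \<Theta>_def cos_arccos)
  have "sin (\<Theta> x) = sqrt (1 - (aa x / norm x)\<^sup>2)" using q by (simp add: \<Theta>_def sin_arccos_abs)
  also have "1 - (aa x / norm x)\<^sup>2 = (bb x / norm x)\<^sup>2" using q(3) by simp
  also have "sqrt ((bb x / norm x)\<^sup>2) = bb x / norm x" using bb_nonneg by simp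
  finally show "bb x = norm x * sin (\<Theta> x)" using x by simp
  show "0 \<le> \<Theta> x" using q by (simp add: \<Theta>_def arccos_lbound)
  show "\<Theta> x \<le> \<Theta>max"
  proof (cases one)
    case True thus ?thesis using q by (simp add: \<Theta>_def \<Theta>max_def arccos_ubound)
  next
    case False
    hence "aa x / norm x \<ge> 0" using aa_nonneg by simp
    thus ?thesis using q False arccos_le_pi2 by (simp add: \<Theta>_def \<Theta>max_def)
  qed
qed

lemma \<Theta>max: "0 < \<Theta>max" "\<Theta>max \<le> pi" by (auto simp: \<Theta>max_def)

lemma \<Theta>_polar:
  assumes f: "frame p q" and r: "r > 0" and \<theta>: "0 \<le> \<theta>" "\<theta> \<le> \<Theta>max"
  shows "\<Theta> (r *\<^sub>R cc p q \<theta>) = \<theta>"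
proof -
  have "r *\<^sub>R cc p q \<theta> = (r * cos \<theta>) *\<^sub>R p + (r * sin \<theta>) *\<^sub>R q" by (simp add: cc_def algebra_simps)
  moreover have "cos \<theta> \<ge> 0" if "\<not> one" using \<theta> that by (auto simp: \<Theta>max_def intro!: cos_ge_zero)
  ultimately have "aa (r *\<^sub>R cc p q \<theta>) = r * cos \<theta>"
    using frame_aa_bb(1)[OF f, of "r * cos \<theta>" "r * sin \<theta>"] r by (auto simp: abs_mult)
  moreover have "norm (r *\<^sub>R cc p q \<theta>) = r" using norm_cc[OF f] r by simp
  ultimately show ?thesis using \<theta> \<Theta>max r by (simp add: \<Theta>_def arccos_cos)
qed

lemma polar_exists:
  assumes x: "x \<noteq> 0"
  obtains p q where "frame p q" "x = norm x *\<^sub>R cc p q (\<Theta> x)"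
proof -
  obtain p q where f: "frame p q" "x = aa x *\<^sub>R p + bb x *\<^sub>R q" by (rule frame_exists)
  have "x = norm x *\<^sub>R cc p q (\<Theta> x)" using f(2) unfolding cos_\<Theta>(1,2)[OF x]
    by (simp add: cc_def algebra_simps)
  thus thesis using that f by blast
qed

lemma continuous_on_\<Theta>: "continuous_on punct \<Theta>"
proof -
  have "bounded_linear \<pi>" using lin by (simp add: linear_linear)
  hence c: "continuous_on punct (\<lambda>x. \<pi> x)" by (rule bounded_linear.continuous_on) (rule continuous_on_id)
  have "continuous_on punct aa"
    unfolding aa_def[abs_def] by (cases one) (auto intro!: continuous_intros c)
  hence "continuous_on punct (\<lambda>x. aa x / norm x)" by (intro continuous_intros) auto
  thus ?thesis unfolding \<Theta>_def[abs_def]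
    by (rule continuous_on_arccos) (use aa_quot in auto)
qed

text \<open>A level of the angle is a single orbit of the symmetries and the positive homotheties,
  and both preserve flatness.\<close>

lemma nonflat_level:
  assumes "x \<noteq> 0" "y \<noteq> 0" "\<Theta> x = \<Theta> y" "nonflat x"
  shows "nonflat y"
proof -
  obtain p q where f: "frame p q" "x = norm x *\<^sub>R cc p q (\<Theta> x)" using polar_exists[OF assms(1)] .
  obtain p' q' where f': "frame p' q'" "y = norm y *\<^sub>R cc p' q' (\<Theta> y)" using polar_exists[OF assms(2)] .
  have "nonflat ((1 / norm x) *\<^sub>R x)" by (rule nonflat_scaleR) (use assms in auto)
  also have "(1 / norm x) *\<^sub>R x = cc p q (\<Theta> x)" using assms(1) by (subst (2) f(2)) simp
  finally have "nonflat (cc p q (\<Theta> y))" using assms(3) by simp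
  hence "nonflat (cc p' q' (\<Theta> y))"
    unfolding cc_def by (rule frame_transfer(3)[OF f(1) f'(1) cos_sin_nonzero])
  hence "nonflat (norm y *\<^sub>R cc p' q' (\<Theta> y))" by (rule nonflat_scaleR[rotated 2]) (use assms cc_nz[OF f'(1)] in auto)
  thus ?thesis using f'(2) by simp
qed

text \<open>The Gram determinant of \<open>cc\<close> and \<open>cc'\<close> for the metric at
  \<open>cc\<close>, where the radial entry is the square of \<open>F\<close> by Euler.\<close>

definition gram :: "real^'n \<Rightarrow> real^'n \<Rightarrow> real \<Rightarrow> real" where
  "gram p q \<theta> = hs E (cc p q \<theta>) (cc' p q \<theta>) (cc' p q \<theta>) * (F (cc p q \<theta>))\<^sup>2 - (hs E (cc p q \<theta>) (cc p q \<theta>) (cc' p q \<theta>))\<^sup>2"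

text \<open>The metric speed of the meridian on the level \<open>F = 1\<close> when it is
  parametrised by the angle; see \<open>meridian\<close>.\<close>

definition speed :: "real^'n \<Rightarrow> real^'n \<Rightarrow> real \<Rightarrow> real" where
  "speed p q \<theta> = sqrt (gram p q \<theta>) / (F (cc p q \<theta>))\<^sup>2"

lemma gram_pos:
  assumes f: "frame p q"
  shows "gram p q \<theta> > 0"
proof -
  let ?c = "cc p q \<theta>" and ?d = "cc' p q \<theta>"
  have c: "?c \<noteq> 0" by (rule cc_nz[OF f])
  define w where "w = hs E ?c ?c ?c *\<^sub>R ?d - hs E ?c ?c ?d *\<^sub>R ?c"
  have cd: "?c \<bullet> ?d = 0" "?d \<bullet> ?d = 1" unfolding cc_def cc'_def frame_inner[OF f]
    by (auto simp: power2_eq_square[symmetric])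
  have Fc: "hs E ?c ?c ?c > 0" using pos c by simp
  have "w \<bullet> ?d = hs E ?c ?c ?c" using cd by (simp add: w_def inner_simps)
  hence "w \<noteq> 0" using Fc by auto
  hence "0 < hs E ?c w w" using pos c by simp
  also have "hs E ?c w w = hs E ?c ?c ?c * gram p q \<theta>"
    using c hs_commute[of ?c ?d ?c] euler(3)[OF c]
    by (simp add: w_def gram_def algebra_simps power2_eq_square)
  finally show ?thesis using Fc by (simp add: zero_less_mult_iff)
qed

lemma speed_pos: "frame p q \<Longrightarrow> speed p q \<theta> > 0"
  using gram_pos[of p q \<theta>] F_pos[OF cc_nz[of p q \<theta>]] unfolding speed_def by simp

lemma speed_frame:
  assumes f: "frame p q" and f': "frame p' q'"
  shows "speed p q \<theta> = speed p' q' \<theta>"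
proof -
  note nz = cos_sin_nonzero[of \<theta>]
  have "F (cc p q \<theta>) = F (cc p' q' \<theta>)"
    using frame_transfer(1)[OF f f' nz] by (simp add: cc_def F_E)
  thus ?thesis unfolding speed_def gram_def cc_def cc'_def frame_transfer(2)[OF f f' nz] by simp
qed

text \<open>The angular component of \<open>v\<close> bounds its length from below: the part of
  \<open>v\<close> outside the meridian plane is metrically orthogonal to the plane and only adds
  length, and within the plane the radial component is removed by completing the square.\<close>

lemma speed_le:
  fixes \<theta> :: real
  assumes f: "frame p q"
  defines "c \<equiv> cc p q \<theta>" and "d \<equiv> cc' p q \<theta>"
  shows "(d \<bullet> v)\<^sup>2 * gram p q \<theta> \<le> (F c)\<^sup>2 * hs E c v v"
proof -
  note D = frameD[OF f]
  have c: "c \<noteq> 0" unfolding c_def by (rule cc_nz[OF f])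
  have cd: "c \<bullet> d = 0" "d \<bullet> d = 1" "c \<bullet> c = 1" unfolding c_def d_def cc_def cc'_def frame_inner[OF f]
    by (auto simp: power2_eq_square[symmetric])
  define w where "w = v - (c \<bullet> v) *\<^sub>R c - (d \<bullet> v) *\<^sub>R d"
  have pc: "p = cos \<theta> *\<^sub>R c - sin \<theta> *\<^sub>R d" "q = sin \<theta> *\<^sub>R c + cos \<theta> *\<^sub>R d"
    by (auto simp: c_def d_def cc_def cc'_def algebra_simps power2_eq_square[symmetric] simp flip: scaleR_left.add)
  have cw: "c \<bullet> w = 0" "d \<bullet> w = 0" using cd by (auto simp: w_def inner_simps inner_commute)
  have pw: "p \<bullet> w = 0" "q \<bullet> w = 0" unfolding pc using cw by (auto simp: inner_simps)
  note nz = cos_sin_nonzero[of \<theta>]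
  define u where "u = (c \<bullet> v) *\<^sub>R c + (d \<bullet> v) *\<^sub>R d"
  have u: "u = ((c \<bullet> v) * cos \<theta> - (d \<bullet> v) * sin \<theta>) *\<^sub>R p + ((c \<bullet> v) * sin \<theta> + (d \<bullet> v) * cos \<theta>) *\<^sub>R q"
    unfolding u_def by (simp add: c_def d_def cc_def cc'_def algebra_simps)
  have o: "hs E c u w = 0" "hs E c w u = 0" unfolding u c_def cc_def by (rule frame_orthogonal[OF f nz pw])+
  have "hs E c v v = hs E c (u + w) (u + w)" by (simp add: u_def w_def)
  also have "\<dots> = hs E c u u + hs E c w w" using c o by simp
  also have "\<dots> \<ge> hs E c u u" using hs_nonneg[OF c] by simp
  finally have 1: "hs E c v v \<ge> hs E c u u" .
  have "hs E c u u = (c \<bullet> v)\<^sup>2 * (F c)\<^sup>2 + 2 * (c \<bullet> v) * (d \<bullet> v) * hs E c c d + (d \<bullet> v)\<^sup>2 * hs E c d d"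
    using c hs_commute[of c d c] euler(3)[OF c] by (simp add: u_def algebra_simps power2_eq_square)
  hence "(F c)\<^sup>2 * hs E c u u - (d \<bullet> v)\<^sup>2 * gram p q \<theta> = ((c \<bullet> v) * (F c)\<^sup>2 + (d \<bullet> v) * hs E c c d)\<^sup>2"
    unfolding gram_def c_def[symmetric] d_def[symmetric] by (simp add: algebra_simps power2_eq_square)
  hence "(d \<bullet> v)\<^sup>2 * gram p q \<theta> \<le> (F c)\<^sup>2 * hs E c u u" by (metis diff_ge_0_iff_ge zero_le_power2)
  also have "\<dots> \<le> (F c)\<^sup>2 * hs E c v v" using 1 by (intro mult_left_mono) auto
  finally show ?thesis .
qed

lemma has_derivative_\<pi>:
  assumes "(y has_vector_derivative y') (at t)"
  shows "((\<lambda>t. \<pi> (y t)) has_vector_derivative \<pi> y') (at t)"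
proof -
  have "bounded_linear \<pi>" using lin by (simp add: linear_linear)
  from bounded_linear.has_vector_derivative[OF this assms] show ?thesis .
qed

lemma DERIV_norm_curve:
  fixes z :: "real \<Rightarrow> real^'n"
  assumes z: "(z has_vector_derivative z') (at t)" and zt: "z t = c *\<^sub>R u" and c: "c > 0" and u: "norm u = 1"
  shows "((\<lambda>t. norm (z t)) has_real_derivative u \<bullet> z') (at t)"
proof -
  have "z t \<noteq> 0" using zt c u by auto
  moreover have "(z has_derivative (\<lambda>h. h *\<^sub>R z')) (at t)" using z by (simp add: has_vector_derivative_def)
  ultimately have "((\<lambda>t. norm (z t)) has_derivative (\<lambda>h. (h *\<^sub>R z') \<bullet> sgn (z t))) (at t)"
    using has_derivative_compose[where g=norm and f=z, OF _ has_derivative_norm] by blast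
  moreover have "sgn (z t) = u" using zt c u by (simp add: sgn_div_norm)
  ultimately show ?thesis by (simp add: has_field_derivative_def mult_commute_abs inner_commute)
qed

lemma aa_derivative:
  assumes y: "(y has_vector_derivative y') (at t)" and f: "frame p q"
    and yt: "y t = \<alpha> *\<^sub>R p + \<beta> *\<^sub>R q" and \<alpha>: "one \<or> \<alpha> > 0"
  shows "((\<lambda>t. aa (y t)) has_real_derivative p \<bullet> y') (at t)"
proof (cases one)
  case True
  have "(y has_derivative (\<lambda>h. h *\<^sub>R y')) (at t)" using y by (simp add: has_vector_derivative_def)
  hence "((\<lambda>t. p0 \<bullet> y t) has_derivative (\<lambda>h. p0 \<bullet> (h *\<^sub>R y'))) (at t)"
    by (rule has_derivative_inner_right)
  thus ?thesis using True frameD(5)[OF f] by (simp add: aa_def has_field_derivative_def mult_commute_abs)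
next
  case False
  note D = frameD[OF f]
  have "((\<lambda>t. norm (\<pi> (y t))) has_real_derivative p \<bullet> \<pi> y') (at t)"
    by (rule DERIV_norm_curve[OF has_derivative_\<pi>[OF y], of \<alpha>]) (use False \<alpha> D yt in auto)
  moreover have "p \<bullet> \<pi> y' = p \<bullet> y'" using selfadj[of p y'] D by simp
  ultimately show ?thesis using False by (simp add: aa_def)
qed

lemma bb_derivative:
  assumes y: "(y has_vector_derivative y') (at t)" and f: "frame p q"
    and yt: "y t = \<alpha> *\<^sub>R p + \<beta> *\<^sub>R q" and \<beta>: "\<beta> > 0"
  shows "((\<lambda>t. bb (y t)) has_real_derivative q \<bullet> y') (at t)"
proof -
  note D = frameD[OF f]
  have "((\<lambda>t. norm (y t - \<pi> (y t))) has_real_derivative q \<bullet> (y' - \<pi> y')) (at t)"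
    by (rule DERIV_norm_curve[OF has_vector_derivative_diff[OF y has_derivative_\<pi>[OF y]], of \<beta>]) (use \<beta> D yt in auto)
  moreover have "q \<bullet> \<pi> y' = 0" using selfadj[of q y'] D by simp
  ultimately show ?thesis by (simp add: bb_def inner_simps)
qed

text \<open>Measured by arc length, the angle is 1-Lipschitz for the metric divided by
  \<open>F\<close>. The two end angles are excluded, since there the arc cosine or a component norm
  is not differentiable.\<close>

lemma \<Theta>_derivative:
  assumes y: "(y has_vector_derivative y') (at t)" and F: "y t \<noteq> 0"
    and \<theta>: "0 < \<Theta> (y t)" "\<Theta> (y t) < \<Theta>max"
  obtains \<tau> where "((\<lambda>t. \<Theta> (y t)) has_real_derivative \<tau>) (at t)"
    "\<And>p q. frame p q \<Longrightarrow> \<bar>\<tau>\<bar> * speed p q (\<Theta> (y t)) \<le> sqrt (hs E (y t) y' y') / F (y t)"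
proof -
  define x where "x = y t"
  define \<theta> where "\<theta> = \<Theta> x"
  have x: "x \<noteq> 0" using F by (simp add: x_def)
  have \<theta>': "0 < \<theta>" "\<theta> < \<Theta>max" using \<theta> by (auto simp: \<theta>_def x_def)
  have sp: "sin \<theta> > 0" using \<theta>' \<Theta>max by (intro sin_gt_zero) auto
  obtain p q where f: "frame p q" "x = norm x *\<^sub>R cc p q \<theta>" using polar_exists[OF x] unfolding \<theta>_def .
  note D = frameD[OF f(1)]
  define r where "r = norm x"
  have r: "r > 0" using x by (simp add: r_def)
  have aax: "aa x = r * cos \<theta>" unfolding r_def \<theta>_def by (rule cos_\<Theta>[OF x])
  have xpq: "x = (r * cos \<theta>) *\<^sub>R p + (r * sin \<theta>) *\<^sub>R q" using f(2) by (simp add: cc_def r_def algebra_simps)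
  have yd: "(y has_derivative (\<lambda>h. h *\<^sub>R y')) (at t)" using y by (simp add: has_vector_derivative_def)
  have "one \<or> r * cos \<theta> > 0"
    using \<theta>' r by (auto simp: \<Theta>max_def intro!: mult_pos_pos cos_gt_zero_pi)
  with aa_derivative[OF y f(1) xpq[unfolded x_def]]
  have da: "((\<lambda>t. aa (y t)) has_real_derivative p \<bullet> y') (at t)" by blast
  have dn: "((\<lambda>t. norm (y t)) has_real_derivative (x \<bullet> y') / r) (at t)"
  proof -
    have "((\<lambda>t. norm (y t)) has_derivative (\<lambda>h. sgn x \<bullet> (h *\<^sub>R y'))) (at t)"
      using has_derivative_compose[where g=norm, OF yd has_derivative_norm[OF F]] by (simp add: x_def inner_commute)
    thus ?thesis by (simp add: has_field_derivative_def sgn_div_norm r_def mult_commute_abs divide_inverse mult_ac)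
  qed
  have dq: "((\<lambda>t. aa (y t) / norm (y t)) has_real_derivative
      ((p \<bullet> y') * r - (r * cos \<theta>) * ((x \<bullet> y') / r)) / (r * r)) (at t)"
    using DERIV_divide[OF da dn] F r by (simp add: x_def[symmetric] aax r_def[symmetric])
  have cr: "aa (y t) / norm (y t) = cos \<theta>" using r by (simp add: x_def[symmetric] aax r_def[symmetric])
  have cs: "-1 < cos \<theta>" "cos \<theta> < 1"
    using cos_monotone_0_pi[of 0 \<theta>] cos_monotone_0_pi[of \<theta> pi] \<theta>' \<Theta>max by auto
  define d where "d = cc' p q \<theta>"
  have "DERIV arccos (cos \<theta>) :> inverse (- sqrt (1 - (cos \<theta>)\<^sup>2))" by (rule DERIV_arccos[OF cs])
  also have "inverse (- sqrt (1 - (cos \<theta>)\<^sup>2)) = - 1 / sin \<theta>"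
    using sp by (simp add: sin_squared_eq[symmetric] field_simps)
  finally have "((\<lambda>t. arccos (aa (y t) / norm (y t))) has_real_derivative
       (- 1 / sin \<theta>) * (((p \<bullet> y') * r - (r * cos \<theta>) * ((x \<bullet> y') / r)) / (r * r))) (at t)"
    by (intro DERIV_chain2[OF _ dq]) (simp add: cr)
  moreover have "(- 1 / sin \<theta>) * (((p \<bullet> y') * r - (r * cos \<theta>) * ((x \<bullet> y') / r)) / (r * r)) = (d \<bullet> y') / r"
  proof -
    have "x \<bullet> y' = r * (cos \<theta> * (p \<bullet> y') + sin \<theta> * (q \<bullet> y'))"
      by (subst xpq) (simp add: inner_simps algebra_simps)
    hence "((p \<bullet> y') * r - (r * cos \<theta>) * ((x \<bullet> y') / r))
        = r * ((p \<bullet> y') * (1 - (cos \<theta>)\<^sup>2) - sin \<theta> * cos \<theta> * (q \<bullet> y'))"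
      using r by (simp add: field_simps power2_eq_square)
    also have "\<dots> = - (r * sin \<theta> * (d \<bullet> y'))"
    proof -
      have "1 - (cos \<theta>)\<^sup>2 = sin \<theta> * sin \<theta>"
        using sin_squared_eq[of \<theta>] by (simp add: power2_eq_square)
      thus ?thesis unfolding \<open>1 - (cos \<theta>)\<^sup>2 = sin \<theta> * sin \<theta>\<close>
        by (simp add: d_def cc'_def inner_simps algebra_simps)
    qed
    finally have e: "((p \<bullet> y') * r - (r * cos \<theta>) * ((x \<bullet> y') / r)) = - (r * sin \<theta> * (d \<bullet> y'))" .
    show ?thesis unfolding e using r sp by (simp add: field_simps)
  qed
  ultimately have D\<Theta>: "((\<lambda>t. \<Theta> (y t)) has_real_derivative (d \<bullet> y') / r) (at t)"
    by (simp add: \<Theta>_def[abs_def])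
  have bnd: "\<bar>(d \<bullet> y') / r\<bar> * speed p q \<theta> \<le> sqrt (hs E x y' y') / F x"
  proof -
    let ?c = "cc p q \<theta>"
    have Fc: "F ?c > 0" using F_pos[OF cc_nz[OF f(1)]] .
    have Fx: "F x = r * F ?c" using f(2) F_scaleR r by (metis r_def less_imp_le)
    have hx: "hs E x y' y' = hs E ?c y' y'"
      using homogeneous_derivatives(2)[OF r cc_nz[OF f(1)]] f(2) by (metis r_def)
    have "(\<bar>d \<bullet> y'\<bar> * sqrt (gram p q \<theta>))\<^sup>2 \<le> (F ?c * sqrt (hs E ?c y' y'))\<^sup>2"
      using speed_le[OF f(1), of \<theta> y'] gram_pos[OF f(1), of \<theta>] hs_nonneg[OF cc_nz[OF f(1)]]
      by (simp add: power_mult_distrib d_def less_imp_le)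
    hence "\<bar>d \<bullet> y'\<bar> * sqrt (gram p q \<theta>) \<le> F ?c * sqrt (hs E ?c y' y')"
      by (rule power2_le_imp_le) (use Fc hs_nonneg[OF cc_nz[OF f(1)]] in auto)
    hence "\<bar>d \<bullet> y'\<bar> * sqrt (gram p q \<theta>) / (r * (F ?c)\<^sup>2) \<le> F ?c * sqrt (hs E ?c y' y') / (r * (F ?c)\<^sup>2)"
      using r Fc by (intro divide_right_mono) auto
    also have "F ?c * sqrt (hs E ?c y' y') / (r * (F ?c)\<^sup>2) = sqrt (hs E ?c y' y') / (r * F ?c)"
      using Fc by (simp add: power2_eq_square)
    finally show ?thesis unfolding Fx hx speed_def using r by (simp add: abs_divide)
  qed
  show thesis
  proof (rule that[OF D\<Theta>])
    fix p' q' assume "frame p' q'"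
    from speed_frame[OF this f(1)] bnd
    show "\<bar>d \<bullet> y' / r\<bar> * speed p' q' (\<Theta> (y t)) \<le> sqrt (hs E (y t) y' y') / F (y t)"
      by (simp add: x_def \<theta>_def)
  qed
qed

end

subsection \<open>The identity component\<close>

context minkowski
begin

abbreviation iso_top :: "(real^'n \<Rightarrow> real^'n) topology" where
  "iso_top \<equiv> subtopology compact_open (isometries F)"

abbreviation G0 :: "(real^'n \<Rightarrow> real^'n) set" where
  "G0 \<equiv> isom_identity_component F"

lemma openin_compact_open:
  "compact K \<Longrightarrow> K \<subseteq> punct \<Longrightarrow> open V \<Longrightarrow> openin compact_open {f. f ` K \<subseteq> V}"
  unfolding compact_open_def by (rule topology_generated_by_Basis) blast

lemma topspace_compact_open [simp]: "topspace (compact_open :: (real^'n \<Rightarrow> real^'n) topology) = UNIV"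
  using openin_subset[OF openin_compact_open[of "{}" UNIV]] by auto

lemma continuous_map_compact_open:
  assumes "\<And>K V. compact K \<Longrightarrow> K \<subseteq> punct \<Longrightarrow> open V \<Longrightarrow> openin T {z \<in> topspace T. h z ` K \<subseteq> V}"
  shows "continuous_map T (compact_open :: (real^'n \<Rightarrow> real^'n) topology) h"
  unfolding compact_open_def
proof (rule continuous_on_generated_topo)
  fix U assume "U \<in> {{f :: real^'n \<Rightarrow> real^'n. f ` K \<subseteq> V} |K V. compact K \<and> K \<subseteq> punct \<and> open V}"
  then obtain K V where KV: "U = {f. f ` K \<subseteq> V}" "compact K" "K \<subseteq> punct" "open V" by blast
  have "h -` U \<inter> topspace T = {z \<in> topspace T. h z ` K \<subseteq> V}" unfolding KV(1) by auto
  thus "openin T (h -` U \<inter> topspace T)" using assms[OF KV(2-4)] by simp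
next
  show "h ` topspace T \<subseteq> \<Union> {{f. f ` K \<subseteq> V} |K V. compact K \<and> K \<subseteq> punct \<and> open V}"
  proof -
    have "UNIV \<in> {{f :: real^'n \<Rightarrow> real^'n. f ` K \<subseteq> V} |K V. compact K \<and> K \<subseteq> punct \<and> open V}"
      by (rule CollectI, intro exI[of _ "{}"] exI[of _ UNIV]) auto
    thus ?thesis by blast
  qed
qed

lemma G0_iso: "\<Phi> \<in> G0 \<Longrightarrow> \<Phi> \<in> isometries F"
  using connected_component_of_subset_topspace[of iso_top id] unfolding isom_identity_component_def by auto

lemma G0_id: "id \<in> G0"
  unfolding isom_identity_component_def using id_isometry by (simp add: connected_component_of_refl)

lemma connectedin_G0: "connectedin iso_top G0"
  unfolding isom_identity_component_def by (rule connectedin_connected_component_of)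

lemma G0_maximal:
  assumes "connectedin iso_top S" "id \<in> S"
  shows "S \<subseteq> G0"
  using connected_component_of_maximal[OF assms] unfolding isom_identity_component_def by simp

lemma G0_image_connected:
  assumes "continuous_map iso_top euclidean h"
  shows "connected (h ` G0)"
  using connectedin_continuous_map_image[OF assms connectedin_G0] by simp

lemma continuous_map_eval:
  assumes x: "x \<noteq> 0"
  shows "continuous_map iso_top euclidean (\<lambda>\<Phi>. \<Phi> x)"
  unfolding continuous_map_def
proof (intro conjI allI impI)
  fix V :: "(real^'n) set" assume "openin euclidean V"
  hence "openin compact_open {f. f ` {x} \<subseteq> V}" using x by (intro openin_compact_open) auto
  hence "openin iso_top ({f. f ` {x} \<subseteq> V} \<inter> isometries F)" by (rule openin_subtopology_Int)
  moreover have "{f. f ` {x} \<subseteq> V} \<inter> isometries F = {\<Phi> \<in> topspace iso_top. \<Phi> x \<in> V}" by auto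
  ultimately show "openin iso_top {\<Phi> \<in> topspace iso_top. \<Phi> x \<in> V}" by simp
qed auto

lemma G0_orbit_connected:
  assumes x: "x \<noteq> 0" and f: "continuous_on punct f"
  shows "connected ((\<lambda>\<Phi>. f (\<Phi> x)) ` G0)"
proof -
  have "connected ((\<lambda>\<Phi>. \<Phi> x) ` G0)" by (rule G0_image_connected[OF continuous_map_eval[OF x]])
  moreover have "(\<lambda>\<Phi>. \<Phi> x) ` G0 \<subseteq> punct" using x isometriesD(6)[OF G0_iso] by auto
  ultimately have "connected (f ` (\<lambda>\<Phi>. \<Phi> x) ` G0)"
    by (intro connected_continuous_image[OF continuous_on_subset[OF f]])
  thus ?thesis by (simp add: image_image)
qed

lemma continuous_map_left_mult:
  assumes \<Psi>: "\<Psi> \<in> isometries F"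
  shows "continuous_map iso_top iso_top (\<lambda>\<Phi> x. \<Psi> (\<Phi> x))"
proof (rule continuous_map_into_subtopology)
  show "continuous_map iso_top compact_open (\<lambda>\<Phi> x. \<Psi> (\<Phi> x))"
  proof (rule continuous_map_compact_open)
    fix K V :: "(real^'n) set" assume K: "compact K" "K \<subseteq> punct" and V: "open V"
    define W where "W = punct \<inter> \<Psi> -` V"
    have "open W" unfolding W_def
      by (rule continuous_open_preimage[OF smooth_map_continuous[OF isometriesD(3)[OF \<Psi>] open_punct] open_punct V])
    hence "openin iso_top ({f. f ` K \<subseteq> W} \<inter> isometries F)"
      by (intro openin_subtopology_Int openin_compact_open K)
    moreover have "{f. f ` K \<subseteq> W} \<inter> isometries F = {\<Phi> \<in> topspace iso_top. (\<lambda>x. \<Psi> (\<Phi> x)) ` K \<subseteq> V}"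
      using K isometriesD(6) by (auto simp: W_def)
    ultimately show "openin iso_top {\<Phi> \<in> topspace iso_top. (\<lambda>x. \<Psi> (\<Phi> x)) ` K \<subseteq> V}" by simp
  qed
qed (use compose_iso[OF \<Psi>] in auto)

text \<open>Left translation by the inverse of \<open>\<Phi>\<close> maps the component onto a
  connected set that contains \<open>id\<close>, as the image of \<open>\<Phi>\<close>, and the
  inverse, as the image of \<open>id\<close>. Continuity of inversion never comes up.\<close>

lemma G0_inv:
  assumes \<Phi>: "\<Phi> \<in> G0"
  shows "inv_iso \<Phi> \<in> G0"
proof -
  note i = inv_iso[OF G0_iso[OF \<Phi>]]
  let ?S = "(\<lambda>\<Psi> x. inv_iso \<Phi> (\<Psi> x)) ` G0"
  have "connectedin iso_top ?S"
    by (rule connectedin_continuous_map_image[OF continuous_map_left_mult[OF i(1)] connectedin_G0])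
  moreover have "id \<in> ?S"
    by (rule image_eqI[OF _ \<Phi>]) (simp add: i(3) id_def)
  ultimately have "?S \<subseteq> G0" by (rule G0_maximal)
  moreover have "inv_iso \<Phi> \<in> ?S" by (rule image_eqI[OF _ G0_id]) simp
  ultimately show ?thesis by blast
qed

end

subsection \<open>The identity component preserves the polar angle\<close>

text \<open>The derivative comparison is available only while \<open>h\<close> lies strictly between
  its end values, so it is applied between the last time \<open>t1\<close> with
  \<open>h t <= h a\<close> and the first later time \<open>t2\<close> with
  \<open>h b <= h t\<close>. This allows for curves that touch the end angles, where the angle is
  not differentiable.\<close>

lemma growth_bound:
  fixes h S :: "real \<Rightarrow> real"
  assumes ab: "a \<le> b" and h: "continuous_on {a..b} h" and S: "continuous_on {a..b} S"
    and mono: "\<And>s t. a \<le> s \<Longrightarrow> s \<le> t \<Longrightarrow> t \<le> b \<Longrightarrow> S s \<le> S t"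
    and D: "\<And>t. a < t \<Longrightarrow> t < b \<Longrightarrow> h a < h t \<Longrightarrow> h t < h b \<Longrightarrow>
       \<exists>D D'. (h has_real_derivative D) (at t) \<and> (S has_real_derivative D') (at t) \<and> D \<le> D'"
  shows "h b - h a \<le> S b - S a"
proof (cases "h a < h b")
  case False
  thus ?thesis using mono[of a b] ab by simp
next
  case lt: True
  define A where "A = {t \<in> {a..b}. h t \<le> h a}"
  have "closed A" unfolding A_def by (rule continuous_on_closed_Collect_le) (auto intro: h)
  hence "compact A" using compact_Int_closed[of "{a..b}" A] by (simp add: A_def Int_def conj_commute conj_left_commute)
  moreover have "a \<in> A" using ab by (simp add: A_def)
  ultimately obtain t1 where t1: "t1 \<in> A" "\<And>t. t \<in> A \<Longrightarrow> t \<le> t1" using compact_attains_sup[of A] by blast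
  define B where "B = {t \<in> {t1..b}. h b \<le> h t}"
  have t1ab: "a \<le> t1" "t1 \<le> b" "h t1 \<le> h a" using t1 by (auto simp: A_def)
  have h1: "continuous_on {t1..b} h" by (rule continuous_on_subset[OF h]) (use t1ab in auto)
  have "closed B" unfolding B_def by (rule continuous_on_closed_Collect_le) (auto intro: h1)
  hence "compact B" using compact_Int_closed[of "{t1..b}" B] by (simp add: B_def Int_def conj_commute conj_left_commute)
  moreover have "b \<in> B" using t1ab by (simp add: B_def)
  ultimately obtain t2 where t2: "t2 \<in> B" "\<And>t. t \<in> B \<Longrightarrow> t2 \<le> t" using compact_attains_inf[of B] by blast
  have t2b: "t1 \<le> t2" "t2 \<le> b" "h b \<le> h t2" using t2 by (auto simp: B_def)
  have "t1 \<noteq> t2" using lt t1ab t2b by auto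
  hence t12: "t1 < t2" using t2b by simp
  have "(\<lambda>t. S t - h t) t1 \<le> (\<lambda>t. S t - h t) t2"
  proof (rule DERIV_nonneg_imp_increasing_open[of t1 t2 "\<lambda>t. S t - h t"])
    show "t1 \<le> t2" using t12 by simp
    fix t assume t: "t1 < t" "t < t2"
    have "h a < h t" using t1(2)[of t] t t1ab t2b by (force simp: A_def)
    moreover have "h t < h b" using t2(2)[of t] t t1ab t2b by (force simp: B_def)
    ultimately obtain D D' where "(h has_real_derivative D) (at t)" "(S has_real_derivative D') (at t)" "D \<le> D'"
      using D[of t] t t1ab t2b by auto
    thus "\<exists>y. ((\<lambda>t. S t - h t) has_real_derivative y) (at t) \<and> 0 \<le> y"
      by (intro exI[of _ "D' - D"]) (auto intro!: DERIV_diff)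
  next
    show "continuous_on {t1..t2} (\<lambda>t. S t - h t)"
      using t1ab t2b by (intro continuous_on_diff continuous_on_subset[OF S] continuous_on_subset[OF h]) auto
  qed
  moreover have "S t2 \<le> S b" "S a \<le> S t1" using mono t1ab t2b by auto
  ultimately show ?thesis using t1ab t2b by simp
qed

context sym_minkowski
begin

text \<open>The interval from -1 to 4 is an open neighbourhood of \<open>{0..pi}\<close>, so that
  the arc length has two-sided derivatives at the end angles too.\<close>

lemma speed_has_integral:
  assumes f: "frame p q"
  obtains s where "\<And>\<theta>. \<theta> \<in> {-1<..<4} \<Longrightarrow> (s has_real_derivative speed p q \<theta>) (at \<theta>)"
proof -
  have c: "continuous_on UNIV (cc p q)" "continuous_on UNIV (cc' p q)"
    unfolding cc_def cc'_def by (intro continuous_intros)+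
  have cF: "continuous_on UNIV (\<lambda>\<theta>. F (cc p q \<theta>))"
    using continuous_on_compose2[OF continuous_F c(1)] by simp
  have nz: "range (cc p q) \<subseteq> punct" using cc_nz[OF f] by auto
  have "continuous_on UNIV (gram p q)"
    unfolding gram_def by (intro continuous_intros continuous_on_hs_vary c cF nz)
  hence "continuous_on UNIV (speed p q)"
    unfolding speed_def using F_pos[OF cc_nz[OF f]]
    by (intro continuous_intros cF) (auto simp: less_imp_neq[symmetric])
  hence cs: "continuous_on {-1..4} (speed p q)" by (rule continuous_on_subset) simp
  show thesis
  proof (rule that[of "\<lambda>\<theta>. integral {-1..\<theta>} (speed p q)"])
    fix \<theta> :: real assume \<theta>: "\<theta> \<in> {-1<..<4}"
    have "((\<lambda>\<theta>. integral {-1..\<theta>} (speed p q)) has_real_derivative speed p q \<theta>) (at \<theta> within {-1..4})"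
      by (rule integral_has_real_derivative[OF cs]) (use \<theta> in auto)
    thus "((\<lambda>\<theta>. integral {-1..\<theta>} (speed p q)) has_real_derivative speed p q \<theta>) (at \<theta>)"
      using \<theta> at_within_Icc_at[of "-1" \<theta> 4] by simp
  qed
qed

lemma arc_length:
  assumes f: "frame p q" and s: "\<And>\<theta>. \<theta> \<in> {-1<..<4} \<Longrightarrow> (s has_real_derivative speed p q \<theta>) (at \<theta>)"
  shows "0 \<le> a \<Longrightarrow> a < b \<Longrightarrow> b \<le> \<Theta>max \<Longrightarrow> s a < s b" "continuous_on {0..\<Theta>max} s"
proof -
  have d: "(s has_real_derivative speed p q t) (at t)" if "0 \<le> t" "t \<le> \<Theta>max" for t
    by (rule s) (use that \<Theta>max pi_less_4 in auto)
  show "s a < s b" if "0 \<le> a" "a < b" "b \<le> \<Theta>max"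
    by (rule DERIV_pos_imp_increasing[OF that(2)]) (meson that d speed_pos[OF f] order_trans)
  show "continuous_on {0..\<Theta>max} s"
    by (rule continuous_at_imp_continuous_on) (meson atLeastAtMost_iff d DERIV_isCont)
qed

definition meridian :: "real^'n \<Rightarrow> real^'n \<Rightarrow> real \<Rightarrow> real \<Rightarrow> real^'n" where
  "meridian p q r \<theta> = (r / F (cc p q \<theta>)) *\<^sub>R cc p q \<theta>"

text \<open>On a level of \<open>F\<close> the meridian attains the bound of
  \<open>\<Theta>_derivative\<close>: while the angle moves at unit rate, its metric speed divided
  by \<open>F\<close> is exactly \<open>speed\<close>.\<close>

lemma meridian:
  assumes f: "frame p q" and r: "r > 0"
  shows "meridian p q r \<theta> \<noteq> 0" "F (meridian p q r \<theta>) = r"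
    "0 \<le> \<theta> \<Longrightarrow> \<theta> \<le> \<Theta>max \<Longrightarrow> \<Theta> (meridian p q r \<theta>) = \<theta>"
    "\<exists>m'. (meridian p q r has_vector_derivative m') (at \<theta>)
        \<and> hs E (meridian p q r \<theta>) m' m' = (r * speed p q \<theta>)\<^sup>2"
proof -
  let ?c = "cc p q \<theta>" and ?d = "cc' p q \<theta>"
  have Fc: "F (cc p q \<theta>) > 0" for \<theta> using F_pos[OF cc_nz[OF f]] .
  have c: "?c \<noteq> 0" by (rule cc_nz[OF f])
  define k where "k = r / F ?c"
  have k: "k > 0" using r Fc by (simp add: k_def)
  have m: "meridian p q r \<theta> = k *\<^sub>R ?c" by (simp add: meridian_def k_def)
  show "meridian p q r \<theta> \<noteq> 0" using k c by (simp add: m)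
  show "F (meridian p q r \<theta>) = r" using F_scaleR[of k ?c] k Fc[of \<theta>] by (simp add: m k_def)
  show "0 \<le> \<theta> \<Longrightarrow> \<theta> \<le> \<Theta>max \<Longrightarrow> \<Theta> (meridian p q r \<theta>) = \<theta>"
    unfolding m by (rule \<Theta>_polar[OF f k])
  have dc: "(cc p q has_vector_derivative ?d) (at \<theta>)"
    unfolding cc_def[abs_def] cc'_def by (auto intro!: derivative_eq_intros)
  have dF: "((\<lambda>\<theta>. F (cc p q \<theta>)) has_real_derivative dd ?d F ?c) (at \<theta>)"
    by (rule smooth_fun.DERIV_curve[OF smooth_fun.intro[OF open_punct smooth_F] dc]) (use c in auto)
  have dk: "((\<lambda>\<theta>. r / F (cc p q \<theta>)) has_real_derivative - (k * dd ?d F ?c / F ?c)) (at \<theta>)"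
    using Fc[of \<theta>] by (auto intro!: derivative_eq_intros dF simp: k_def)
  define m' where "m' = k *\<^sub>R ?d - (k * dd ?d F ?c / F ?c) *\<^sub>R ?c"
  have "(meridian p q r has_vector_derivative m') (at \<theta>)"
    using has_vector_derivative_scaleR[OF dk dc] unfolding meridian_def[abs_def] m'_def k_def by simp
  moreover have "hs E (meridian p q r \<theta>) m' m' = (r * speed p q \<theta>)\<^sup>2"
  proof -
    define G where "G = hs E ?c ?c ?d"
    define A where "A = hs E ?c ?d ?d"
    define f where "f = F ?c"
    have fp: "f > 0" using Fc by (simp add: f_def)
    have "f * dd ?d F ?c = G" using dd_E_F[OF c, of ?d] euler(2)[OF c, of ?d] by (simp add: f_def G_def)
    hence dFG: "dd ?d F ?c = G / f" using fp by (simp add: field_simps)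
    have cc: "hs E ?c ?c ?c = f\<^sup>2" using euler(3)[OF c] by (simp add: f_def)
    have G': "hs E ?c ?d ?c = G" using hs_commute[of ?c] c by (simp add: G_def)
    \<comment> \<open>Staying on a level of \<open>F\<close> subtracts precisely the radial
      projection, so the metric square of \<open>m'\<close> is a quotient of the Gram
      determinant.\<close>
    have m'eq: "m' = k *\<^sub>R (?d - (G / f\<^sup>2) *\<^sub>R ?c)"
      unfolding m'_def dFG f_def[symmetric] by (simp add: algebra_simps power2_eq_square)
    have "hs E (meridian p q r \<theta>) m' m' = hs E ?c m' m'"
      unfolding m by (rule homogeneous_derivatives(2)[OF k c])
    also have "\<dots> = k\<^sup>2 * (A - G\<^sup>2 / f\<^sup>2)"
      unfolding m'eq using c fp by (simp add: G_def[symmetric] A_def[symmetric] cc G' power2_eq_square field_simps)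
    also have "\<dots> = (r * speed p q \<theta>)\<^sup>2"
      using fp gram_pos[OF f, of \<theta>]
      by (simp add: speed_def power_mult_distrib power_divide k_def gram_def G_def[symmetric] A_def[symmetric] f_def[symmetric]
          less_imp_le field_simps power2_eq_square)
    finally show ?thesis .
  qed
  ultimately show "\<exists>m'. (meridian p q r has_vector_derivative m') (at \<theta>)
        \<and> hs E (meridian p q r \<theta>) m' m' = (r * speed p q \<theta>)\<^sup>2" by blast
qed

lemma meridian_through:
  assumes x: "x \<noteq> 0"
  obtains p q where "frame p q" "x = meridian p q (F x) (\<Theta> x)"
proof -
  obtain p q where f: "frame p q" "x = norm x *\<^sub>R cc p q (\<Theta> x)" using polar_exists[OF x] .
  have "F x = norm x * F (cc p q (\<Theta> x))" using f(2) F_scaleR by (metis norm_ge_zero)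
  hence "F x / F (cc p q (\<Theta> x)) = norm x" using F_pos[OF cc_nz[OF f(1)], of "\<Theta> x"] by (simp add: field_simps)
  thus thesis using that[OF f(1)] f(2) by (simp add: meridian_def)
qed

text \<open>An isometry that preserves a level of the polar angle does not increase the distance to it:
  the angle, measured by arc length \<open>s\<close>, is 1-Lipschitz, and meridians realise the distance.\<close>

lemma level_distance:
  assumes s: "frame p q" "\<And>\<theta>. \<theta> \<in> {-1<..<4} \<Longrightarrow> (s has_real_derivative speed p q \<theta>) (at \<theta>)"
    and \<Phi>: "\<Phi> \<in> isometries F" and \<alpha>: "0 \<le> \<alpha>" "\<alpha> \<le> \<Theta>max"
    and lev: "\<And>y. y \<noteq> 0 \<Longrightarrow> \<Theta> y = \<alpha> \<Longrightarrow> \<Theta> (\<Phi> y) = \<alpha>" and x: "x \<noteq> 0"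
  shows "\<bar>s (\<Theta> (\<Phi> x)) - s \<alpha>\<bar> \<le> \<bar>s (\<Theta> x) - s \<alpha>\<bar>"
proof -
  note D = isometriesD[OF \<Phi>]
  obtain p' q' where f: "frame p' q'" "x = meridian p' q' (F x) (\<Theta> x)" using meridian_through[OF x] .
  define r where "r = F x"
  have r: "r > 0" using F_pos[OF x] by (simp add: r_def)
  note M = meridian[OF f(1) r]
  define y where "y \<theta> = \<Phi> (meridian p' q' r \<theta>)" for \<theta>
  define h where "h \<theta> = s (\<Theta> (y \<theta>))" for \<theta>
  have y0: "y \<theta> \<noteq> 0" for \<theta> using D(6) M(1) by (simp add: y_def)
  have Fy: "F (y \<theta>) = r" for \<theta> using iso_F[OF \<Phi>] M(2) by (simp add: y_def)
  have yb: "0 \<le> \<Theta> (y \<theta>)" "\<Theta> (y \<theta>) \<le> \<Theta>max" for \<theta> using cos_\<Theta>[OF y0] by auto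
  have pi4: "\<Theta>max < 4" using \<Theta>max pi_less_4 by linarith
  have smono: "s a < s b" if "0 \<le> a" "a < b" "b \<le> \<Theta>max" for a b by (rule arc_length(1)[OF s that])
  have dy: "\<exists>y'. (y has_vector_derivative y') (at \<theta>) \<and> sqrt (hs E (y \<theta>) y' y') / F (y \<theta>) = speed p q \<theta>" for \<theta>
  proof -
    obtain m' where m': "(meridian p' q' r has_vector_derivative m') (at \<theta>)"
        "hs E (meridian p' q' r \<theta>) m' m' = (r * speed p' q' \<theta>)\<^sup>2" using M(4) by blast
    have "(y has_vector_derivative ddv m' \<Phi> (meridian p' q' r \<theta>)) (at \<theta>)"
      unfolding y_def[abs_def] by (rule smooth_map_curve[OF open_punct D(3) m'(1)]) (use M(1) in auto)
    moreover have "sqrt (hs E (y \<theta>) (ddv m' \<Phi> (meridian p' q' r \<theta>)) (ddv m' \<Phi> (meridian p' q' r \<theta>))) / F (y \<theta>) = speed p q \<theta>"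
      unfolding y_def D(5)[OF M(1)] m'(2) Fy[unfolded y_def]
      using r speed_pos[OF f(1), of \<theta>] speed_frame[OF f(1) s(1)] by (simp add: abs_mult)
    ultimately show ?thesis by blast
  qed
  have dh: "\<exists>D. (h has_real_derivative D) (at \<theta>) \<and> \<bar>D\<bar> \<le> speed p q \<theta>" if th: "0 < \<Theta> (y \<theta>)" "\<Theta> (y \<theta>) < \<Theta>max" for \<theta>
  proof -
    obtain y' where y': "(y has_vector_derivative y') (at \<theta>)" "sqrt (hs E (y \<theta>) y' y') / F (y \<theta>) = speed p q \<theta>"
      using dy by blast
    obtain \<tau> where \<tau>: "((\<lambda>t. \<Theta> (y t)) has_real_derivative \<tau>) (at \<theta>)"
      "\<And>p q. frame p q \<Longrightarrow> \<bar>\<tau>\<bar> * speed p q (\<Theta> (y \<theta>)) \<le> sqrt (hs E (y \<theta>) y' y') / F (y \<theta>)"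
      using \<Theta>_derivative[OF y'(1) y0 th] by blast
    have "(h has_real_derivative speed p q (\<Theta> (y \<theta>)) * \<tau>) (at \<theta>)"
      unfolding h_def[abs_def] by (rule DERIV_chain2[OF s(2) \<tau>(1)]) (use th pi4 in auto)
    moreover have "\<bar>speed p q (\<Theta> (y \<theta>)) * \<tau>\<bar> \<le> speed p q \<theta>"
      using \<tau>(2)[OF s(1)] y'(2) speed_pos[OF s(1), of "\<Theta> (y \<theta>)"] by (simp add: abs_mult mult.commute)
    ultimately show ?thesis by blast
  qed
  have cy: "continuous_on UNIV y" using dy by (meson continuous_at_imp_continuous_on has_vector_derivative_continuous)
  have cs: "continuous_on {0..\<Theta>max} s" by (rule arc_length(2)[OF s])
  have "continuous_on UNIV (\<lambda>\<theta>. \<Theta> (y \<theta>))"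
    by (rule continuous_on_compose2[OF continuous_on_\<Theta> cy]) (use y0 in auto)
  hence ch: "continuous_on UNIV h" unfolding h_def[abs_def]
    by (rule continuous_on_compose2[OF cs]) (use yb in auto)
  have key: "\<bar>h b - h a\<bar> \<le> s b - s a" if ab: "0 \<le> a" "a \<le> b" "b \<le> \<Theta>max" for a b
  proof -
    \<comment> \<open>Arc length is strictly increasing in the angle, so a value strictly between
      two others cannot belong to an end angle. This supplies the differentiability that
      \<open>growth_bound\<close> asks for.\<close>
    have inn: "0 < \<Theta> (y t) \<and> \<Theta> (y t) < \<Theta>max" if "h u < h t" "h t < h v" for t u v
    proof -
      have "\<Theta> (y t) \<noteq> 0" using that(1) yb[of u] smono[of 0 "\<Theta> (y u)"] by (auto simp: h_def) (metis less_asym less_eq_real_def)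
      moreover have "\<Theta> (y t) \<noteq> \<Theta>max" using that(2) yb[of v] smono[of "\<Theta> (y v)" \<Theta>max] by (auto simp: h_def) (metis less_asym less_eq_real_def)
      ultimately show ?thesis using yb[of t] by simp
    qed
    have sab: "continuous_on {a..b} s" by (rule continuous_on_subset[OF cs]) (use ab in auto)
    have hab: "continuous_on {a..b} h" by (rule continuous_on_subset[OF ch]) auto
    have mon: "s u \<le> s t" if "a \<le> u" "u \<le> t" "t \<le> b" for u t
      using smono[of u t] that ab by (cases "u = t") auto
    have sd: "(s has_real_derivative speed p q t) (at t)" if "a < t" "t < b" for t
      by (rule s(2)) (use that ab pi4 in auto)
    have "h b - h a \<le> s b - s a"
    proof (rule growth_bound[OF ab(2) hab sab mon])
      fix t assume t: "a < t" "t < b" "h a < h t" "h t < h b"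
      obtain D where "(h has_real_derivative D) (at t)" "\<bar>D\<bar> \<le> speed p q t" using dh inn[OF t(3,4)] by blast
      thus "\<exists>D D'. (h has_real_derivative D) (at t) \<and> (s has_real_derivative D') (at t) \<and> D \<le> D'"
        using sd[OF t(1,2)] by (intro exI[of _ D] exI[of _ "speed p q t"]) auto
    qed
    moreover have "(- h b) - (- h a) \<le> s b - s a"
    proof (rule growth_bound[OF ab(2) continuous_on_minus[OF hab] sab mon])
      fix t assume t: "a < t" "t < b" "- h a < - h t" "- h t < - h b"
      obtain D where D: "(h has_real_derivative D) (at t)" "\<bar>D\<bar> \<le> speed p q t" using dh inn[of b t a] t by auto
      have "((\<lambda>x. - h x) has_real_derivative - D) (at t)" by (rule DERIV_minus[OF D(1)])
      thus "\<exists>D D'. ((\<lambda>x. - h x) has_real_derivative D) (at t) \<and> (s has_real_derivative D') (at t) \<and> D \<le> D'"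
        using sd[OF t(1,2)] D(2) by (intro exI[of _ "- D"] exI[of _ "speed p q t"]) auto
    qed
    ultimately show ?thesis by linarith
  qed
  have "\<Theta> (y \<alpha>) = \<alpha>" unfolding y_def by (rule lev[OF M(1) M(3)]) (use \<alpha> in auto)
  hence h\<alpha>: "h \<alpha> = s \<alpha>" by (simp add: h_def)
  have hx: "h (\<Theta> x) = s (\<Theta> (\<Phi> x))" using f(2) by (simp add: h_def y_def r_def)
  have tx: "0 \<le> \<Theta> x" "\<Theta> x \<le> \<Theta>max" using cos_\<Theta>[OF x] by auto
  show ?thesis
  proof (cases "\<alpha> \<le> \<Theta> x")
    case True
    from key[OF \<alpha>(1) True tx(2)] show ?thesis unfolding h\<alpha> hx by linarith
  next
    case False
    hence "\<Theta> x \<le> \<alpha>" by simp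
    from key[OF tx(1) this \<alpha>(2)] show ?thesis unfolding h\<alpha> hx by linarith
  qed
qed

text \<open>The angle \<open>\<alpha>\<close> is chosen flat with all angles between it and
  \<open>\<theta>0\<close> curved. Its level is preserved by the whole component, and then
  \<open>level_distance\<close>, applied to an isometry and its inverse, fixes the arc length
  distance of every angle to \<open>\<alpha>\<close>.\<close>

theorem G0_preserves_angle:
  assumes x0: "x0 \<noteq> 0" "nonflat x0" and \<Phi>: "\<Phi> \<in> G0" and x: "x \<noteq> 0"
  shows "\<Theta> (\<Phi> x) = \<Theta> x"
proof -
  obtain p q where f: "frame p q" using frame_ex by blast
  define \<theta>0 where "\<theta>0 = \<Theta> x0"
  have t0: "0 \<le> \<theta>0" "\<theta>0 \<le> \<Theta>max" using cos_\<Theta>[OF x0(1)] by (auto simp: \<theta>0_def)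
  have Tc: "\<Theta> (cc p q \<theta>) = \<theta>" if "0 \<le> \<theta>" "\<theta> \<le> \<Theta>max" for \<theta>
    using \<Theta>_polar[OF f, of 1 \<theta>] that by simp
  \<comment> \<open>The flat angles up to \<open>\<theta>0\<close>: a compact set, since nonflatness
    is an open condition, and nonempty, since it contains 0 by \<open>flat_block\<close>. Its
    maximum is \<open>\<alpha>\<close>.\<close>
  define A where "A = {0..\<theta>0} \<inter> cc p q -` (- {x. x \<noteq> 0 \<and> nonflat x})"
  have "continuous_on {0..\<theta>0} (cc p q)" unfolding cc_def by (intro continuous_intros)
  hence "closed A" unfolding A_def using open_nonflat by (intro continuous_closed_preimage) auto
  hence "compact A" using compact_Int_closed[of "{0..\<theta>0}" A] by (simp add: A_def)
  moreover have "0 \<in> A" using t0 flat_block[of p] frameD[OF f] by (auto simp: A_def cc_def)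
  ultimately obtain \<alpha> where \<alpha>: "\<alpha> \<in> A" "\<And>t. t \<in> A \<Longrightarrow> t \<le> \<alpha>" using compact_attains_sup[of A] by blast
  have a0: "0 \<le> \<alpha>" "\<alpha> \<le> \<theta>0" "\<not> nonflat (cc p q \<alpha>)" using \<alpha>(1) cc_nz[OF f] by (auto simp: A_def)
  have flat: "\<not> nonflat y" if "y \<noteq> 0" "\<Theta> y = \<alpha>" for y
    using nonflat_level[OF that(1) cc_nz[OF f], of \<alpha>] that Tc[of \<alpha>] a0 t0 by auto
  have nf: "nonflat y" if "y \<noteq> 0" "\<alpha> < \<Theta> y" "\<Theta> y \<le> \<theta>0" for y
  proof -
    have "\<Theta> y \<notin> A" using \<alpha>(2) that by force
    hence "nonflat (cc p q (\<Theta> y))" using that a0 by (auto simp: A_def)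
    thus ?thesis using nonflat_level[OF cc_nz[OF f] that(1), of "\<Theta> y"] Tc[of "\<Theta> y"] cos_\<Theta>[OF that(1)] by auto
  qed
  have "\<alpha> \<noteq> \<theta>0" using flat[OF x0(1)] x0(2) by (auto simp: \<theta>0_def)
  hence at0: "\<alpha> < \<theta>0" using a0 by simp
  have conn: "connected ((\<lambda>\<Psi>. \<Theta> (\<Psi> y)) ` G0)" if "y \<noteq> 0" for y
    by (rule G0_orbit_connected[OF that continuous_on_\<Theta>])
  have mem: "\<Theta> y \<in> (\<lambda>\<Psi>. \<Theta> (\<Psi> y)) ` G0" for y
    by (rule image_eqI[OF _ G0_id]) simp
  have lvl: "\<Theta> (\<Psi> y) = \<alpha>" if y: "y \<noteq> 0" "\<Theta> y = \<alpha>" and \<Psi>: "\<Psi> \<in> G0" for \<Psi> y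
  proof (rule antisym)
    show "\<Theta> (\<Psi> y) \<le> \<alpha>"
    proof (rule ccontr)
      assume "\<not> \<Theta> (\<Psi> y) \<le> \<alpha>"
      hence "\<alpha> < min (\<Theta> (\<Psi> y)) \<theta>0" "min (\<Theta> (\<Psi> y)) \<theta>0 \<le> \<Theta> (\<Psi> y)" using at0 by auto
      \<comment> \<open>Otherwise the connected orbit of the flat point \<open>y\<close> would meet
        an angle that is known to be curved.\<close>
      hence "min (\<Theta> (\<Psi> y)) \<theta>0 \<in> (\<lambda>\<Psi>. \<Theta> (\<Psi> y)) ` G0"
        using connectedD_interval[OF conn[OF y(1)] mem[of y], of "\<Theta> (\<Psi> y)" "min (\<Theta> (\<Psi> y)) \<theta>0"] \<Psi> y(2) by auto
      then obtain \<Psi>' where \<Psi>': "\<Psi>' \<in> G0" "\<Theta> (\<Psi>' y) = min (\<Theta> (\<Psi> y)) \<theta>0" by auto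
      have "\<Psi>' y \<noteq> 0" using isometriesD(6)[OF G0_iso[OF \<Psi>'(1)] y(1)] .
      hence "nonflat (\<Psi>' y)" using nf[of "\<Psi>' y"] \<Psi>'(2) \<open>\<alpha> < min _ _\<close> by auto
      hence "nonflat y" using nonflat_iso_iff[OF G0_iso[OF \<Psi>'(1)] y(1)] by simp
      thus False using flat[OF y] by simp
    qed
    \<comment> \<open>Nothing yet keeps the flat point \<open>y\<close> itself from reaching smaller
      angles. It is approached by curved points \<open>z \<theta>\<close> of larger angle, whose
      orbits cannot cross the flat level \<open>\<alpha>\<close>, and the inequality passes to the
      limit.\<close>
    obtain p' q' where f': "frame p' q'" "y = norm y *\<^sub>R cc p' q' \<alpha>" using polar_exists[OF y(1)] y(2) by metis
    define z where "z \<theta> = norm y *\<^sub>R cc p' q' \<theta>" for \<theta>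
    have ny: "norm y > 0" using y by simp
    have z0: "z \<theta> \<noteq> 0" for \<theta> using cc_nz[OF f'(1)] ny by (simp add: z_def)
    have Tz: "\<Theta> (z \<theta>) = \<theta>" if "0 \<le> \<theta>" "\<theta> \<le> \<Theta>max" for \<theta> unfolding z_def by (rule \<Theta>_polar[OF f'(1) ny that])
    have "continuous_on UNIV z" unfolding z_def cc_def by (intro continuous_intros)
    moreover have "continuous_on punct \<Psi>" by (rule smooth_map_continuous[OF isometriesD(3)[OF G0_iso[OF \<Psi>]] open_punct])
    ultimately have "continuous_on UNIV (\<lambda>\<theta>. \<Psi> (z \<theta>))" using z0 by (intro continuous_on_compose2[of punct \<Psi> UNIV z]) auto
    hence "continuous_on UNIV (\<lambda>\<theta>. \<Theta> (\<Psi> (z \<theta>)))"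
      by (intro continuous_on_compose2[OF continuous_on_\<Theta>]) (use z0 isometriesD(6)[OF G0_iso[OF \<Psi>]] in auto)
    hence "isCont (\<lambda>\<theta>. \<Theta> (\<Psi> (z \<theta>))) \<alpha>" by (simp add: continuous_on_eq_continuous_at)
    hence lim: "((\<lambda>\<theta>. \<Theta> (\<Psi> (z \<theta>))) \<longlongrightarrow> \<Theta> (\<Psi> y)) (at_right \<alpha>)"
      using f'(2) by (auto simp: isCont_def z_def intro: tendsto_within_subset)
    have "\<forall>\<^sub>F \<theta> in at_right \<alpha>. \<alpha> \<le> \<Theta> (\<Psi> (z \<theta>))"
      unfolding eventually_at_right_field
    proof (intro exI[of _ \<theta>0] conjI allI impI at0)
      fix \<theta> assume th: "\<alpha> < \<theta>" "\<theta> < \<theta>0"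
      show "\<alpha> \<le> \<Theta> (\<Psi> (z \<theta>))"
      proof (rule ccontr)
        assume c: "\<not> \<alpha> \<le> \<Theta> (\<Psi> (z \<theta>))"
        have Tzt: "\<Theta> (z \<theta>) = \<theta>" using th a0 t0 by (intro Tz) auto
        have "\<alpha> \<in> (\<lambda>\<Psi>. \<Theta> (\<Psi> (z \<theta>))) ` G0"
          using connectedD_interval[OF conn[OF z0] _ mem[of "z \<theta>"], of "\<Theta> (\<Psi> (z \<theta>))" \<alpha>] c th \<Psi> Tzt by auto
        then obtain \<Psi>' where \<Psi>': "\<Psi>' \<in> G0" "\<Theta> (\<Psi>' (z \<theta>)) = \<alpha>" by auto
        have "\<not> nonflat (\<Psi>' (z \<theta>))" using flat[OF isometriesD(6)[OF G0_iso[OF \<Psi>'(1)] z0] \<Psi>'(2)] .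
        moreover have "nonflat (z \<theta>)" using nf[OF z0, of \<theta>] Tzt th by auto
        ultimately show False using nonflat_iso_iff[OF G0_iso[OF \<Psi>'(1)] z0] by simp
      qed
    qed
    with lim show "\<alpha> \<le> \<Theta> (\<Psi> y)" by (rule tendsto_lowerbound) simp
  qed
  obtain s where s: "\<And>\<theta>. \<theta> \<in> {-1<..<4} \<Longrightarrow> (s has_real_derivative speed p q \<theta>) (at \<theta>)"
    using speed_has_integral[OF f] by blast
  have a1: "\<alpha> \<le> \<Theta>max" using a0 t0 by simp
  have le: "\<bar>s (\<Theta> (\<Psi> y)) - s \<alpha>\<bar> \<le> \<bar>s (\<Theta> y) - s \<alpha>\<bar>" if "\<Psi> \<in> G0" "y \<noteq> 0" for \<Psi> y
    by (rule level_distance[OF f s G0_iso[OF that(1)] a0(1) a1 lvl[OF _ _ that(1)] that(2)])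
  have eq: "\<bar>s (\<Theta> (\<Psi> x)) - s \<alpha>\<bar> = \<bar>s (\<Theta> x) - s \<alpha>\<bar>" if "\<Psi> \<in> G0" for \<Psi>
    using le[OF that x] le[OF G0_inv[OF that] isometriesD(6)[OF G0_iso[OF that] x]]
      inv_iso(3)[OF G0_iso[OF that]] by simp
  have cs: "continuous_on {0..\<Theta>max} s" by (rule arc_length(2)[OF f s])
  have "continuous_on punct (\<lambda>x. s (\<Theta> x))"
    by (rule continuous_on_compose2[OF cs continuous_on_\<Theta>]) (auto intro!: cos_\<Theta>(3) cos_\<Theta>(4))
  hence cn: "connected ((\<lambda>\<Psi>. s (\<Theta> (\<Psi> x))) ` G0)" by (rule G0_orbit_connected[OF x])
  \<comment> \<open>Only two values are possible, mirror images about \<open>s \<alpha>\<close>. A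
    connected orbit takes just one of them, and \<open>id\<close> shows which.\<close>
  have "(\<lambda>\<Psi>. s (\<Theta> (\<Psi> x))) ` G0 \<subseteq> {s \<alpha> + \<bar>s (\<Theta> x) - s \<alpha>\<bar>, s \<alpha> - \<bar>s (\<Theta> x) - s \<alpha>\<bar>}"
  proof (rule image_subsetI)
    fix \<Psi> assume "\<Psi> \<in> G0"
    from eq[OF this] show "s (\<Theta> (\<Psi> x)) \<in> {s \<alpha> + \<bar>s (\<Theta> x) - s \<alpha>\<bar>, s \<alpha> - \<bar>s (\<Theta> x) - s \<alpha>\<bar>}"
      by (auto simp: abs_if split: if_splits)
  qed
  hence "finite ((\<lambda>\<Psi>. s (\<Theta> (\<Psi> x))) ` G0)" by (rule finite_subset) simp
  then obtain c where "(\<lambda>\<Psi>. s (\<Theta> (\<Psi> x))) ` G0 = {c}"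
    using connected_finite_iff_sing[OF cn] G0_id by auto
  hence seq: "s (\<Theta> (\<Phi> x)) = s (\<Theta> x)" using \<Phi> G0_id by (metis (no_types, lifting) id_apply image_eqI singletonD)
  have smono: "s a < s b" if "0 \<le> a" "a < b" "b \<le> \<Theta>max" for a b by (rule arc_length(1)[OF f s that])
  have "\<Phi> x \<noteq> 0" using isometriesD(6)[OF G0_iso[OF \<Phi>] x] .
  thus ?thesis using seq smono[of "\<Theta> x" "\<Theta> (\<Phi> x)"] smono[of "\<Theta> (\<Phi> x)" "\<Theta> x"] cos_\<Theta>(3,4)[OF x] cos_\<Theta>(3,4)[of "\<Phi> x"]
    by (metis less_irrefl linorder_neqE_linordered_idom)
qed

lemma G0_preserves_aa_bb:
  assumes x0: "x0 \<noteq> 0" "nonflat x0" and \<Phi>: "\<Phi> \<in> G0" and x: "x \<noteq> 0"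
  shows "aa (\<Phi> x) = aa x" "bb (\<Phi> x) = bb x"
proof -
  have y: "\<Phi> x \<noteq> 0" using isometriesD(6)[OF G0_iso[OF \<Phi>] x] .
  have T: "\<Theta> (\<Phi> x) = \<Theta> x" by (rule G0_preserves_angle[OF assms])
  have Fe: "F (\<Phi> x) = F x" by (rule iso_F[OF G0_iso[OF \<Phi>]])
  obtain p q where f: "frame p q" "x = norm x *\<^sub>R cc p q (\<Theta> x)" using polar_exists[OF x] .
  obtain p' q' where f': "frame p' q'" "\<Phi> x = norm (\<Phi> x) *\<^sub>R cc p' q' (\<Theta> (\<Phi> x))" using polar_exists[OF y] .
  note nz = cos_sin_nonzero
  have "F (cc p q \<theta>) = F (cc p' q' \<theta>)" for \<theta>
    using frame_transfer(1)[OF f(1) f'(1) nz] by (simp add: cc_def F_E)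
  hence "norm (\<Phi> x) * F (cc p q (\<Theta> x)) = norm x * F (cc p q (\<Theta> x))"
    using f(2) f'(2) F_scaleR Fe T by (metis norm_ge_zero)
  hence "norm (\<Phi> x) = norm x" using F_pos[OF cc_nz[OF f(1)], of "\<Theta> x"] by simp
  thus "aa (\<Phi> x) = aa x" "bb (\<Phi> x) = bb x" using cos_\<Theta>(1,2)[OF x] cos_\<Theta>(1,2)[OF y] T by auto
qed

end

subsection \<open>Flat norms with block symmetry are Euclidean\<close>

context sym_minkowski
begin

lemma DERIV_hs_const:
  assumes g: "(\<gamma> has_vector_derivative g') (at t)" and x: "\<gamma> t \<in> punct"
  shows "((\<lambda>t. hs E (\<gamma> t) u v) has_real_derivative td E (\<gamma> t) g' u v) (at t)"
  using DERIV_hs_curve[OF g x has_vector_derivative_const[of u] has_vector_derivative_const[of v]] x by simp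

lemma \<pi>_norm: "(aa x)\<^sup>2 = (norm (\<pi> x))\<^sup>2"
proof (cases one)
  case True
  have "norm (\<pi> x) = \<bar>p0 \<bullet> x\<bar>" by (subst one[OF True]) (simp add: p0)
  thus ?thesis using True by (simp add: aa_def)
qed (simp add: aa_def)

text \<open>The derivative at time 0 of the invariance of \<open>E\<close> under rotations in the
  plane of \<open>q\<close> and \<open>Y\<close>.\<close>

lemma rotation_identity:
  assumes q: "norm q = 1" "\<pi> q = 0" and Y: "norm Y = 1" "\<pi> Y = 0" and qY: "q \<bullet> Y = 0" and x: "x \<noteq> 0"
  shows "(q \<bullet> x) * dd Y E x = (Y \<bullet> x) * dd q E x"
proof -
  \<comment> \<open>The rotation by \<open>t\<close> in the plane of \<open>q\<close> and
    \<open>Y\<close>, with the orthogonal complement fixed, applied to \<open>x\<close>.\<close>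
  define z where "z t = x + ((cos t - 1) * (q \<bullet> x) - sin t * (Y \<bullet> x)) *\<^sub>R q
                         + (sin t * (q \<bullet> x) + (cos t - 1) * (Y \<bullet> x)) *\<^sub>R Y" for t :: real
  have n: "q \<bullet> q = 1" "Y \<bullet> Y = 1" "Y \<bullet> q = 0" using q Y qY by (auto simp: norm_eq_1 inner_commute)
  have F: "F (z t) = F x" for t
  proof (rule sym2)
    show "\<pi> (z t) = \<pi> x" using q Y by (simp add: z_def)
    define w where "w = x - \<pi> x"
    have "q \<bullet> \<pi> x = 0" "Y \<bullet> \<pi> x = 0" using selfadj[of q x] selfadj[of Y x] q Y by auto
    hence wx: "q \<bullet> x = q \<bullet> w" "Y \<bullet> x = Y \<bullet> w" by (auto simp: w_def inner_simps)
    define a where "a = q \<bullet> w"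
    define b where "b = Y \<bullet> w"
    have e: "z t - \<pi> (z t) = w + ((cos t - 1) * a - sin t * b) *\<^sub>R q + (sin t * a + (cos t - 1) * b) *\<^sub>R Y"
      unfolding \<open>\<pi> (z t) = \<pi> x\<close> by (simp add: z_def w_def wx[unfolded w_def] a_def b_def)
    have cs: "cos t * cos t + sin t * sin t - 1 = 0" using sin_cos_squared_add[of t] by (simp add: power2_eq_square)
    have ab: "w \<bullet> q = a" "w \<bullet> Y = b" "q \<bullet> w = a" "Y \<bullet> w = b" by (auto simp: a_def b_def inner_commute)
    define A B where "A = (cos t - 1) * a - sin t * b" and "B = sin t * a + (cos t - 1) * b"
    have "(z t - \<pi> (z t)) \<bullet> (z t - \<pi> (z t)) = w \<bullet> w + (2 * a * A + 2 * b * B + A * A + B * B)"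
      unfolding e A_def[symmetric] B_def[symmetric]
      by (simp add: inner_add_left inner_add_right ab n qY algebra_simps)
    also have "\<dots> = w \<bullet> w + (a * a + b * b) * (cos t * cos t + sin t * sin t - 1)"
    proof -
      have "2 * a * ((c - 1) * a - s * b) + 2 * b * (s * a + (c - 1) * b)
          + ((c - 1) * a - s * b) * ((c - 1) * a - s * b) + (s * a + (c - 1) * b) * (s * a + (c - 1) * b)
          = (a * a + b * b) * (c * c + s * s - 1)" for c s :: real
        by (simp add: algebra_simps)
      from this[of "cos t" "sin t"] show ?thesis unfolding A_def B_def by linarith
    qed
    also have "\<dots> = w \<bullet> w" unfolding cs by simp
    finally show "norm (z t - \<pi> (z t)) = norm (x - \<pi> x)" by (simp add: norm_eq_sqrt_inner w_def)
  qed
  have dz: "(z has_vector_derivative ((- (Y \<bullet> x)) *\<^sub>R q + (q \<bullet> x) *\<^sub>R Y)) (at 0)"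
    unfolding z_def[abs_def] by (auto intro!: derivative_eq_intros)
  have "((\<lambda>t. E (z t)) has_real_derivative dd ((- (Y \<bullet> x)) *\<^sub>R q + (q \<bullet> x) *\<^sub>R Y) E (z 0)) (at 0)"
    by (rule DERIV_curve[OF dz]) (use x in \<open>simp add: z_def\<close>)
  moreover have "(\<lambda>t. E (z t)) = (\<lambda>t. E x)" using F by (simp add: E_def)
  ultimately have "dd ((- (Y \<bullet> x)) *\<^sub>R q + (q \<bullet> x) *\<^sub>R Y) E x = 0"
    using DERIV_unique[of "\<lambda>t. E x" _ 0 0] by (simp add: z_def)
  thus ?thesis by (simp add: linear_diff[OF linear_dd] dd_scaleR)
qed

text \<open>The rotation identity differentiated in direction \<open>Y\<close> at a point where the
  \<open>Y\<close> coordinate vanishes.\<close>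

lemma hs_rotation:
  assumes q: "norm q = 1" "\<pi> q = 0" and Y: "norm Y = 1" "\<pi> Y = 0" and qY: "q \<bullet> Y = 0" and x: "x \<noteq> 0" "Y \<bullet> x = 0"
  shows "(q \<bullet> x) * hs E x Y Y = dd q E x"
proof -
  have eq: "(q \<bullet> y) * dd Y E y = (Y \<bullet> y) * dd q E y" if "y \<in> punct" for y
    using rotation_identity[OF q Y qY] that by auto
  have YY: "Y \<bullet> Y = 1" using Y by (simp add: norm_eq_1)
  note L = line_has_vector_derivative[of x Y 0]
  have x': "x + 0 *\<^sub>R Y \<in> punct" using x by simp
  have 1: "((\<lambda>t. dd v E (x + t *\<^sub>R Y)) has_real_derivative hs E x Y v) (at 0)" for v
    using smooth_fun.DERIV_curve[OF smooth_fun_dd L x'] by (simp add: hs_def)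
  have 2: "((\<lambda>t. (q \<bullet> (x + t *\<^sub>R Y)) * dd Y E (x + t *\<^sub>R Y)) has_real_derivative (q \<bullet> x) * hs E x Y Y) (at 0)"
    using DERIV_cmult[OF 1, of "q \<bullet> x" Y] qY by (simp add: inner_simps)
  have 3: "((\<lambda>t. (Y \<bullet> (x + t *\<^sub>R Y)) * dd q E (x + t *\<^sub>R Y)) has_real_derivative dd q E x) (at 0)"
    using DERIV_mult[OF DERIV_ident 1[of q]] x(2) YY by (simp add: inner_simps)
  show ?thesis by (rule line_DERIV_unique[OF open_punct _ eq 2 3]) (use x in auto)
qed

text \<open>The profile \<open>\<tau> \<mapsto> E (\<tau> p + q)\<close>; the other values of \<open>E\<close> follow by homogeneity. Here
  \<open>el\<close> carries all third derivatives in the plane of \<open>p\<close> and \<open>q\<close>, because they vanish in the radial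
  direction.\<close>

context
  fixes p q Y :: "real^'n"
  assumes f: "frame p q" and Y: "norm Y = 1" "\<pi> Y = 0" "Y \<bullet> q = 0"
begin

definition pt :: "real \<Rightarrow> real^'n" where "pt \<tau> = \<tau> *\<^sub>R p + q"

definition ey :: "real \<Rightarrow> real" where "ey \<tau> = hs E (pt \<tau>) p q"
definition eA :: "real \<Rightarrow> real" where "eA \<tau> = hs E (pt \<tau>) p p"
definition eB :: "real \<Rightarrow> real" where "eB \<tau> = hs E (pt \<tau>) q q"
definition eP :: "real \<Rightarrow> real" where "eP \<tau> = dd p E (pt \<tau>)"
definition eQ :: "real \<Rightarrow> real" where "eQ \<tau> = dd q E (pt \<tau>)"
definition el :: "real \<Rightarrow> real" where "el \<tau> = td E (pt \<tau>) p p p"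
definition eD :: "real \<Rightarrow> real" where "eD \<tau> = eA \<tau> * eB \<tau> - (ey \<tau>)\<^sup>2"

lemma pt_nz: "pt \<tau> \<noteq> 0"
  using frame_zero[OF f, of \<tau> 1] by (simp add: pt_def)

lemma ptp: "pt \<tau> \<in> punct" by (simp add: pt_nz)

lemma hs_comm: "hs E (pt \<tau>) u v = hs E (pt \<tau>) v u"
  by (rule hs_commute[OF ptp])

lemma td_comm: "td E (pt \<tau>) u v w = td E (pt \<tau>) v u w" "td E (pt \<tau>) u v w = td E (pt \<tau>) u w v"
  by (rule td_commute[OF ptp])+

lemma pt_alt: "pt \<tau> = \<tau> *\<^sub>R p + 1 *\<^sub>R q" by (simp add: pt_def)

lemma Yp: "Y \<bullet> p = 0" "p \<bullet> Y = 0" "q \<bullet> Y = 0" "Y \<bullet> Y = 1"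
proof -
  show "Y \<bullet> p = 0" using selfadj[of Y p] frameD[OF f] Y by simp
  thus "p \<bullet> Y = 0" "q \<bullet> Y = 0" "Y \<bullet> Y = 1" using Y by (auto simp: inner_commute norm_eq_1)
qed

text \<open>The position vector is \<open>\<tau> *\<^sub>R p + q\<close>, and Euler's relations in
  this direction eliminate \<open>q\<close>: in third derivatives it can be traded for
  \<open>- \<tau>\<close> times \<open>p\<close>.\<close>

lemma euler_profile:
  shows "eP \<tau> = \<tau> * eA \<tau> + ey \<tau>" "eQ \<tau> = \<tau> * ey \<tau> + eB \<tau>" "2 * E (pt \<tau>) = \<tau> * eP \<tau> + eQ \<tau>"
    "td E (pt \<tau>) q u v = - \<tau> * td E (pt \<tau>) p u v"
    "td E (pt \<tau>) p p q = - \<tau> * el \<tau>" "td E (pt \<tau>) p q q = \<tau>\<^sup>2 * el \<tau>"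
proof -
  have 1: "hs E (pt \<tau>) (pt \<tau>) v = \<tau> * hs E (pt \<tau>) p v + hs E (pt \<tau>) q v" for v
    using ptp by (subst (2) pt_def) simp
  show "eP \<tau> = \<tau> * eA \<tau> + ey \<tau>"
    using euler(2)[OF pt_nz, of \<tau> p] 1[of p] hs_comm[of \<tau> q p] by (simp add: eP_def eA_def ey_def)
  show "eQ \<tau> = \<tau> * ey \<tau> + eB \<tau>"
    using euler(2)[OF pt_nz, of \<tau> q] 1[of q] by (simp add: eQ_def eB_def ey_def)
  have "dd (pt \<tau>) E (pt \<tau>) = \<tau> * eP \<tau> + eQ \<tau>"
    by (subst (1) pt_def) (simp add: dd_add dd_scaleR eP_def eQ_def)
  thus "2 * E (pt \<tau>) = \<tau> * eP \<tau> + eQ \<tau>" using euler(1)[OF pt_nz, of \<tau>] by simp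
  have t: "td E (pt \<tau>) q u v = - \<tau> * td E (pt \<tau>) p u v" for u v
  proof -
    have "td E (pt \<tau>) (pt \<tau>) u v = \<tau> * td E (pt \<tau>) p u v + td E (pt \<tau>) q u v"
      by (subst (2) pt_def) simp
    thus ?thesis using euler(4)[OF pt_nz, of \<tau> u v] by simp
  qed
  show "td E (pt \<tau>) q u v = - \<tau> * td E (pt \<tau>) p u v" by (rule t)
  show ppq: "td E (pt \<tau>) p p q = - \<tau> * el \<tau>"
    using t[of p p] td_comm[of \<tau>] unfolding el_def by metis
  have "td E (pt \<tau>) p q q = td E (pt \<tau>) q p q" using td_comm[of \<tau>] by metis
  thus "td E (pt \<tau>) p q q = \<tau>\<^sup>2 * el \<tau>" using t[of p q] ppq by (simp add: power2_eq_square)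
qed

lemma pt_deriv: "(pt has_vector_derivative p) (at \<tau>)"
  unfolding pt_def[abs_def] by (auto intro!: derivative_eq_intros)

lemma profile_derivs:
  shows "(ey has_real_derivative - \<tau> * el \<tau>) (at \<tau>)"
    "(eA has_real_derivative el \<tau>) (at \<tau>)"
    "(eB has_real_derivative \<tau>\<^sup>2 * el \<tau>) (at \<tau>)"
    "(eP has_real_derivative eA \<tau>) (at \<tau>)"
    "(eQ has_real_derivative ey \<tau>) (at \<tau>)"
    "((\<lambda>\<tau>. E (pt \<tau>)) has_real_derivative eP \<tau>) (at \<tau>)"
    "(eD has_real_derivative el \<tau> * (2 * E (pt \<tau>))) (at \<tau>)"
proof -
  have h: "((\<lambda>\<tau>. hs E (pt \<tau>) u v) has_real_derivative td E (pt \<tau>) p u v) (at \<tau>)" for u v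
    by (rule DERIV_hs_const[OF pt_deriv ptp])
  have d: "((\<lambda>\<tau>. dd u E (pt \<tau>)) has_real_derivative hs E (pt \<tau>) p u) (at \<tau>)" for u
    using smooth_fun.DERIV_curve[OF smooth_fun_dd pt_deriv ptp] by (simp add: hs_def)
  show 1: "(ey has_real_derivative - \<tau> * el \<tau>) (at \<tau>)"
    using h[of p q] unfolding ey_def[abs_def] euler_profile(5) .
  show 2: "(eA has_real_derivative el \<tau>) (at \<tau>)"
    using h[of p p] unfolding eA_def[abs_def] el_def .
  show 3: "(eB has_real_derivative \<tau>\<^sup>2 * el \<tau>) (at \<tau>)"
    using h[of q q] unfolding eB_def[abs_def] euler_profile(6) .
  show "(eP has_real_derivative eA \<tau>) (at \<tau>)" using d[of p] unfolding eP_def[abs_def] eA_def .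
  show "(eQ has_real_derivative ey \<tau>) (at \<tau>)" using d[of q] unfolding eQ_def[abs_def] ey_def .
  show "((\<lambda>\<tau>. E (pt \<tau>)) has_real_derivative eP \<tau>) (at \<tau>)"
    using DERIV_curve[OF pt_deriv ptp] unfolding eP_def .
  have "(eD has_real_derivative (el \<tau> * eB \<tau> + \<tau>\<^sup>2 * el \<tau> * eA \<tau> - 2 * ey \<tau> * (- \<tau> * el \<tau>))) (at \<tau>)"
    unfolding eD_def[abs_def]
    by (rule derivative_eq_intros 1 2 3 | simp)+
  moreover have "el \<tau> * eB \<tau> + \<tau>\<^sup>2 * el \<tau> * eA \<tau> - 2 * ey \<tau> * (- \<tau> * el \<tau>) = el \<tau> * (2 * E (pt \<tau>))"
    unfolding euler_profile(3) euler_profile(1,2) by (simp add: algebra_simps power2_eq_square)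
  ultimately show "(eD has_real_derivative el \<tau> * (2 * E (pt \<tau>))) (at \<tau>)" by simp
qed

lemma hs_YY: "hs E (pt \<tau>) Y Y = eQ \<tau>"
proof -
  have "q \<bullet> pt \<tau> = 1" "Y \<bullet> pt \<tau> = 0" using frameD[OF f] Yp Y by (auto simp: pt_def inner_simps)
  thus ?thesis using hs_rotation[of q Y "pt \<tau>"] frameD[OF f] Y Yp pt_nz by (simp add: eQ_def)
qed

lemma eQ_pos: "eQ \<tau> > 0"
  using pos[OF ptp, of Y \<tau>] Y hs_YY by fastforce

lemma eD_pos: "eD \<tau> > 0"
proof -
  have B: "eB \<tau> > 0" unfolding eB_def using pos[OF ptp, of q \<tau>] frameD[OF f] by fastforce
  define w where "w = eB \<tau> *\<^sub>R p - ey \<tau> *\<^sub>R q"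
  have "w \<noteq> 0" using frame_zero[OF f, of "eB \<tau>" "- ey \<tau>"] B by (simp add: w_def)
  hence "0 < hs E (pt \<tau>) w w" using pos[OF ptp] by blast
  also have "\<dots> = eB \<tau> * eD \<tau>"
    using ptp hs_comm[of \<tau> q p]
    by (simp add: w_def eD_def algebra_simps power2_eq_square flip: eA_def eB_def ey_def)
  finally show ?thesis using B by (simp add: zero_less_mult_iff)
qed

lemma td_YY: "td E (pt \<tau>) p Y Y = ey \<tau>"
proof (rule DERIV_unique)
  show "((\<lambda>\<tau>. hs E (pt \<tau>) Y Y) has_real_derivative td E (pt \<tau>) p Y Y) (at \<tau>)"
    by (rule DERIV_hs_const[OF pt_deriv ptp])
  show "((\<lambda>\<tau>. hs E (pt \<tau>) Y Y) has_real_derivative ey \<tau>) (at \<tau>)"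
    unfolding hs_YY by (rule profile_derivs)
qed

lemma plane_decomp:
  obtains w' where "w = (p \<bullet> w) *\<^sub>R p + (q \<bullet> w) *\<^sub>R q + w'" "p \<bullet> w' = 0" "q \<bullet> w' = 0"
  by (rule that[of "w - (p \<bullet> w) *\<^sub>R p - (q \<bullet> w) *\<^sub>R q"])
     (use frameD[OF f] in \<open>auto simp: inner_simps\<close>)

text \<open>The symmetries make both \<open>cv\<close> vectors explicit: the one for
  \<open>Y Y\<close> lies in the plane of the frame, the one for \<open>p Y\<close> is a multiple of
  \<open>Y\<close>.\<close>

lemma kap_profile:
  "kap E (pt \<tau>) p Y = (ey \<tau>)\<^sup>2 / eQ \<tau> - ey \<tau> * el \<tau> * (2 * E (pt \<tau>)) / eD \<tau>"
proof -
  let ?x = "pt \<tau>"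
  have nz: "\<tau> \<noteq> 0 \<or> (1::real) \<noteq> 0" by simp
  note O = frame_orthogonal[OF f nz, folded pt_alt]
  have Q: "eQ \<tau> > 0" and D: "eD \<tau> > 0" by (rule eQ_pos, rule eD_pos)
  have O1: "hs E ?x (a *\<^sub>R p + b *\<^sub>R q) w = 0" "hs E ?x w (a *\<^sub>R p + b *\<^sub>R q) = 0"
    "hs E ?x p w = 0" "hs E ?x q w = 0"
    "td E ?x p p w = 0" "td E ?x p q w = 0" "td E ?x q q w = 0"
    if "p \<bullet> w = 0" "q \<bullet> w = 0" for a b w
    using O(1)[OF that, of a b] O(2)[OF that, of a b] O(1)[OF that, of 1 0] O(1)[OF that, of 0 1]
      O(3)[OF that, of 1 0 1 0] O(3)[OF that, of 1 0 0 1] O(3)[OF that, of 0 1 0 1] by auto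
  have YYw: "td E ?x Y Y w = 0" if "p \<bullet> w = 0" "q \<bullet> w = 0" for w
    by (rule O(4)) (use that Yp in auto)
  have YYp: "td E ?x Y Y p = ey \<tau>" "td E ?x Y Y q = - \<tau> * ey \<tau>"
    using td_YY[of \<tau>] euler_profile(4)[of \<tau> Y Y] td_comm[of \<tau>] by metis+
  \<comment> \<open>The solution of the 2 by 2 system with entries \<open>eA\<close>,
    \<open>ey\<close>, \<open>eB\<close>, determinant \<open>eD\<close> and right sides
    \<open>ey\<close> and \<open>- \<tau> * ey\<close>; Euler's relations collect its numerators
    into \<open>eQ\<close> and \<open>eP\<close>.\<close>
  define c where "c = (ey \<tau> * eQ \<tau> / eD \<tau>) *\<^sub>R p + (- (ey \<tau> * eP \<tau> / eD \<tau>)) *\<^sub>R q"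
  have cvYY: "cv E ?x Y Y = c"
  proof (rule cv_unique[OF ptp])
    fix w
    obtain w' where w: "w = (p \<bullet> w) *\<^sub>R p + (q \<bullet> w) *\<^sub>R q + w'" and w': "p \<bullet> w' = 0" "q \<bullet> w' = 0" by (rule plane_decomp)
    have cp: "hs E ?x c p = ey \<tau>"
    proof -
      have "hs E ?x c p = (ey \<tau> / eD \<tau>) * (eQ \<tau> * eA \<tau> - eP \<tau> * ey \<tau>)"
        using ptp hs_comm[of \<tau> q p] by (simp add: c_def eA_def ey_def diff_divide_distrib algebra_simps)
      also have "eQ \<tau> * eA \<tau> - eP \<tau> * ey \<tau> = eD \<tau>"
        unfolding euler_profile(1,2) eD_def by (simp add: algebra_simps power2_eq_square)
      finally show ?thesis using D by simp
    qed
    have cq: "hs E ?x c q = - \<tau> * ey \<tau>"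
    proof -
      have "hs E ?x c q = (ey \<tau> / eD \<tau>) * (eQ \<tau> * ey \<tau> - eP \<tau> * eB \<tau>)"
        using ptp by (simp add: c_def eB_def ey_def diff_divide_distrib algebra_simps)
      also have "eQ \<tau> * ey \<tau> - eP \<tau> * eB \<tau> = - \<tau> * eD \<tau>"
        unfolding euler_profile(1,2) eD_def by (simp add: algebra_simps power2_eq_square)
      finally show ?thesis using D by simp
    qed
    have "hs E ?x c w' = 0" unfolding c_def by (rule O1(1)[OF w'])
    thus "hs E ?x c w = td E ?x Y Y w"
      using ptp by (subst (1 2) w) (simp add: cp cq YYp YYw[OF w'])
  qed
  define d where "d = (ey \<tau> / eQ \<tau>) *\<^sub>R Y"
  have cvpY: "cv E ?x p Y = d"
  proof (rule cv_unique[OF ptp])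
    fix w
    obtain w' where w: "w = (p \<bullet> w) *\<^sub>R p + (q \<bullet> w) *\<^sub>R q + w'" and w': "p \<bullet> w' = 0" "q \<bullet> w' = 0" by (rule plane_decomp)
    define w'' where "w'' = w' - (Y \<bullet> w') *\<^sub>R Y"
    have ww: "w' = (Y \<bullet> w') *\<^sub>R Y + w''" "Y \<bullet> w'' = 0" "p \<bullet> w'' = 0" "q \<bullet> w'' = 0"
      using Yp w' by (auto simp: w''_def inner_simps)
    \<comment> \<open>This reflection negates \<open>Y\<close> and fixes everything orthogonal to
      it, which removes the mixed terms of \<open>Y\<close> with \<open>w''\<close>.\<close>
    define L where "L = (\<lambda>v. v - (2 * (Y \<bullet> v)) *\<^sub>R Y)"
    have L: "sym_map L" unfolding L_def by (rule sym_map_reflection) (use Y in auto)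
    have Yq: "Y \<bullet> q = 0" by (rule Y)
    have Lv: "L ?x = ?x" "L p = p" "L w'' = w''" "L Y = - Y"
      using Yp Yq ww(2) by (auto simp: L_def pt_def inner_simps scaleR_2)
    have z1: "hs E ?x Y w'' = 0" "td E ?x p Y w'' = 0"
      using sym_map_derivs(2)[OF L pt_nz, of \<tau> Y w''] sym_map_derivs(3)[OF L pt_nz, of \<tau> p Y w''] ptp
      unfolding Lv by simp_all
    have z2: "hs E ?x Y p = 0" "hs E ?x Y q = 0" "td E ?x p Y p = 0" "td E ?x p Y q = 0"
      using O1(3-6)[OF Yp(2,3)] hs_comm[of \<tau>] td_comm[of \<tau>] by metis+
    have 1: "hs E ?x Y w = (Y \<bullet> w') * eQ \<tau>"
      using ptp by (subst w, subst ww(1)) (simp add: z1 z2 hs_YY)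
    have 2: "td E ?x p Y w = (Y \<bullet> w') * ey \<tau>"
      using ptp by (subst w, subst ww(1)) (simp add: z1 z2 td_YY)
    show "hs E ?x d w = td E ?x p Y w" using Q ptp by (simp add: d_def 1 2)
  qed
  have "hs E ?x d d = (ey \<tau>)\<^sup>2 / eQ \<tau>"
    using ptp Q by (simp add: d_def hs_YY power2_eq_square)
  moreover have "hs E ?x (cv E ?x p p) c = ey \<tau> * el \<tau> * (2 * E ?x) / eD \<tau>"
  proof -
    have "hs E ?x (cv E ?x p p) c = td E ?x p p c" by (rule hs_cv[OF ptp])
    also have "\<dots> = (ey \<tau> / eD \<tau>) * (eQ \<tau> * el \<tau> + eP \<tau> * (\<tau> * el \<tau>))"
      unfolding c_def using ptp euler_profile(5)[of \<tau>] by (simp add: add_divide_distrib algebra_simps flip: el_def)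
    also have "eQ \<tau> * el \<tau> + eP \<tau> * (\<tau> * el \<tau>) = el \<tau> * (2 * E ?x)"
      unfolding euler_profile(3) by (simp add: algebra_simps)
    finally show ?thesis by simp
  qed
  ultimately show ?thesis unfolding kap_def cvYY cvpY by simp
qed

text \<open>Flatness makes \<open>N = ey\<^sup>2 E / (eD eQ)\<close> constant in \<open>\<tau>\<close>, and \<open>N\<close> tends to 0 at
  the block spanned by \<open>p\<close>, where the third derivatives vanish.\<close>

lemma flat_mixed_derivative:
  assumes flat: "\<And>x. x \<noteq> 0 \<Longrightarrow> \<not> nonflat x"
  shows "ey \<tau> = 0"
proof -
  define N where "N \<tau> = (ey \<tau>)\<^sup>2 * E (pt \<tau>) / (eD \<tau> * eQ \<tau>)" for \<tau>
  have Ep: "E (pt \<tau>) > 0" for \<tau> by (rule E_pos[OF pt_nz])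
  have dN: "(N has_real_derivative 0) (at \<tau>)" for \<tau>
  proof -
    have Q: "eQ \<tau> > 0" and D: "eD \<tau> > 0" by (rule eQ_pos, rule eD_pos)
    have "kap E (pt \<tau>) p Y = 0" using flat[OF pt_nz] unfolding nonflat_def by blast
    \<comment> \<open>Vanishing curvature as a first order ODE for the profile, cleared of
      denominators.\<close>
    hence k: "(ey \<tau>)\<^sup>2 * eD \<tau> = ey \<tau> * el \<tau> * (2 * E (pt \<tau>)) * eQ \<tau>"
      unfolding kap_profile using Q D by (simp add: field_simps)
    have "((\<lambda>\<tau>. (ey \<tau>)\<^sup>2 * E (pt \<tau>)) has_real_derivative
         2 * ey \<tau> * (- \<tau> * el \<tau>) * E (pt \<tau>) + eP \<tau> * (ey \<tau>)\<^sup>2) (at \<tau>)"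
      by (rule derivative_eq_intros profile_derivs(1,6) | simp)+
    moreover have "((\<lambda>\<tau>. eD \<tau> * eQ \<tau>) has_real_derivative
         el \<tau> * (2 * E (pt \<tau>)) * eQ \<tau> + ey \<tau> * eD \<tau>) (at \<tau>)"
      by (rule DERIV_mult[OF profile_derivs(7,5)])
    ultimately have "(N has_real_derivative
        ((2 * ey \<tau> * (- \<tau> * el \<tau>) * E (pt \<tau>) + eP \<tau> * (ey \<tau>)\<^sup>2) * (eD \<tau> * eQ \<tau>)
          - (ey \<tau>)\<^sup>2 * E (pt \<tau>) * (el \<tau> * (2 * E (pt \<tau>)) * eQ \<tau> + ey \<tau> * eD \<tau>)) / (eD \<tau> * eQ \<tau> * (eD \<tau> * eQ \<tau>))) (at \<tau>)"
      unfolding N_def[abs_def] using Q D by (intro DERIV_divide) auto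
    moreover have "(2 * ey \<tau> * (- \<tau> * el \<tau>) * E (pt \<tau>) + eP \<tau> * (ey \<tau>)\<^sup>2) * (eD \<tau> * eQ \<tau>)
          - (ey \<tau>)\<^sup>2 * E (pt \<tau>) * (el \<tau> * (2 * E (pt \<tau>)) * eQ \<tau> + ey \<tau> * eD \<tau>) = 0"
    proof -
      define y l e P Q D A where a: "y = ey \<tau>" "l = el \<tau>" "e = E (pt \<tau>)" "P = eP \<tau>" "Q = eQ \<tau>" "D = eD \<tau>" "A = eA \<tau>"
      have k': "y * l * (2 * e) * Q = y\<^sup>2 * D" using k by (simp add: a)
      have P: "P = \<tau> * A + y" and e: "2 * e = \<tau> * P + Q" unfolding a by (rule euler_profile)+
      \<comment> \<open>After the ODE is substituted, the numerator of the derivative of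
        \<open>N\<close> is a multiple of the difference of the two sides of this identity.\<close>
      have tD: "\<tau> * D = P * Q - 2 * e * y"
      proof -
        have D: "D = A * (Q - \<tau> * y) - y\<^sup>2" using euler_profile(2)[of \<tau>] by (simp add: a eD_def)
        show ?thesis unfolding e unfolding P D by (simp add: algebra_simps power2_eq_square)
      qed
      have "(2 * y * (- \<tau> * l) * e + P * y\<^sup>2) * (D * Q) - y\<^sup>2 * e * (l * (2 * e) * Q + y * D)
        = - \<tau> * D * (y * l * (2 * e) * Q) + P * y\<^sup>2 * D * Q - y * e * (y * l * (2 * e) * Q) - y\<^sup>2 * e * y * D"
        by (simp add: algebra_simps power2_eq_square)
      also have "\<dots> = y\<^sup>2 * D * (- (\<tau> * D) + P * Q - 2 * e * y)"
        unfolding k' by (simp add: algebra_simps power2_eq_square)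
      also have "\<dots> = 0" unfolding tD by simp
      finally show ?thesis unfolding a .
    qed
    ultimately show ?thesis by simp
  qed
  have const: "N \<tau> = N 0" for \<tau> by (rule DERIV_isconst_all) (use dN in auto)
  have lim: "(N \<longlongrightarrow> 0) at_top"
  proof -
    \<comment> \<open>The substitution \<open>s = 1/\<tau>\<close> brings the end of the profile to
      \<open>g 0 = p\<close>. Second derivatives are homogeneous of degree 0, while
      \<open>E (pt \<tau>)\<close> contributes the factor \<open>1/s\<close> squared; this is
      absorbed by the mixed derivative, which vanishes to higher than first order at
      \<open>s = 0\<close>.\<close>
    define g where "g s = p + s *\<^sub>R q" for s :: real
    have g0: "g 0 = p" by (simp add: g_def)
    have gnz: "g s \<noteq> 0" for s using frame_zero[OF f, of 1 s] by (simp add: g_def)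
    hence gp: "g s \<in> punct" for s by simp
    have dg: "(g has_vector_derivative q) (at s)" for s
      unfolding g_def[abs_def] by (auto intro!: derivative_eq_intros)
    have dh: "((\<lambda>s. hs E (g s) u v) has_real_derivative td E (g s) q u v) (at s)" for u v s
      by (rule DERIV_hs_const[OF dg gp])
    have p0': "\<pi> p = p" "p \<noteq> 0" using frameD[OF f] by auto
    have hp0: "hs E p p q = 0"
    proof -
      define L where "L = (\<lambda>v. (2 * (p \<bullet> v)) *\<^sub>R p - v)"
      have L: "sym_map L" unfolding L_def by (rule sym_map_half_turn[OF f])
      have Lv: "L p = p" "L q = - q" using frameD[OF f] by (auto simp: L_def scaleR_2)
      show ?thesis using sym_map_derivs(2)[OF L p0'(2), of p q] p0' unfolding Lv by simp
    qed
    have "((\<lambda>s. hs E (g s) p q) has_real_derivative 0) (at 0)"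
      using dh[of p q 0] td_block[OF p0'] unfolding g0 by simp
    hence l1: "((\<lambda>s. hs E (g s) p q / s) \<longlongrightarrow> 0) (at 0)"
      unfolding has_field_derivative_iff by (simp add: g0 hp0)
    have cont: "isCont (\<lambda>s. hs E (g s) u v) 0" for u v by (rule DERIV_isCont[OF dh])
    have cE: "isCont (\<lambda>s. E (g s)) 0" by (rule DERIV_isCont[OF DERIV_curve[OF dg gp]])
    define M where "M s = (hs E (g s) p q / s)\<^sup>2 * E (g s) /
       ((hs E (g s) p p * hs E (g s) q q - (hs E (g s) p q)\<^sup>2) * hs E (g s) Y Y)" for s
    have Dp: "hs E p p p * hs E p q q - (hs E p p q)\<^sup>2 > 0"
      unfolding hp0 using pos[of p p] pos[of p q] p0' frameD[OF f] by fastforce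
    have Yn: "hs E p Y Y > 0" using pos[of p Y] p0' Y by fastforce
    have "(M \<longlongrightarrow> 0\<^sup>2 * E (g 0) / ((hs E (g 0) p p * hs E (g 0) q q - (hs E (g 0) p q)\<^sup>2) * hs E (g 0) Y Y)) (at 0)"
      unfolding M_def[abs_def]
      by (intro tendsto_intros l1 cont[unfolded isCont_def] cE[unfolded isCont_def])
         (use Dp Yn in \<open>simp add: g0\<close>)
    hence "(M \<longlongrightarrow> 0) (at 0)" by simp
    hence "(M \<longlongrightarrow> 0) (at_right 0)" by (rule tendsto_within_subset) simp
    hence "((\<lambda>\<tau>. M (inverse \<tau>)) \<longlongrightarrow> 0) at_top"
      by (rule filterlim_compose[OF _ filterlim_inverse_at_right_top])
    moreover have "\<forall>\<^sub>F \<tau> in at_top. M (inverse \<tau>) = N \<tau>"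
      using eventually_gt_at_top[of 0]
    proof eventually_elim
      fix \<tau> :: real assume t: "\<tau> > 0"
      have pg: "pt \<tau> = \<tau> *\<^sub>R g (inverse \<tau>)" using t by (simp add: pt_def g_def algebra_simps)
      note H = homogeneous_derivatives[OF t gnz[of "inverse \<tau>"], folded pg]
      have "q \<bullet> pt \<tau> = 1" using frameD[OF f] by (simp add: pt_def inner_simps)
      have Qe: "eQ \<tau> = hs E (g (inverse \<tau>)) Y Y" using hs_YY[of \<tau>] H(2) by simp
      have Ee: "E (pt \<tau>) = \<tau>\<^sup>2 * E (g (inverse \<tau>))" unfolding pg using t by (simp add: E_scaleR)
      show "M (inverse \<tau>) = N \<tau>"
        unfolding N_def M_def eD_def Qe Ee ey_def eA_def eB_def H(2) using t
        by (simp add: power_mult_distrib power_divide field_simps)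
    qed
    ultimately show ?thesis by (rule Lim_transform_eventually)
  qed
  have "(N \<longlongrightarrow> N 0) at_top" using const by (metis (mono_tags, lifting) eventually_at_top_linorderI tendsto_eventually)
  hence "N 0 = 0" using tendsto_unique[OF _ _ lim] by simp
  hence "N \<tau> = 0" using const by simp
  thus ?thesis using Ep[of \<tau>] eQ_pos[of \<tau>] eD_pos[of \<tau>] by (auto simp: N_def)
qed

text \<open>Since \<open>ey\<close> vanishes, its derivative \<open>- \<tau> * el \<tau>\<close>
  does too, so \<open>el\<close> is 0 away from 0 and then at 0 by continuity. Hence
  \<open>eA\<close> and \<open>eQ\<close> are constant, and Euler's relations give the quadratic
  formula.\<close>

lemma flat_profile:
  assumes flat: "\<And>x. x \<noteq> 0 \<Longrightarrow> \<not> nonflat x"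
  obtains c j where "c > 0" "j > 0" "\<And>\<tau>. E (pt \<tau>) = (c * \<tau>\<^sup>2 + j) / 2"
proof -
  have y: "ey \<tau> = 0" for \<tau> by (rule flat_mixed_derivative[OF flat])
  have "el \<tau> = 0" if "\<tau> \<noteq> 0" for \<tau>
  proof -
    have "- \<tau> * el \<tau> = 0"
      by (rule DERIV_unique[OF profile_derivs(1)]) (simp add: y[abs_def])
    thus ?thesis using that by simp
  qed
  moreover have "continuous_on UNIV el"
    unfolding el_def[abs_def]
    by (rule continuous_on_compose2[OF continuous_on_td]) (use ptp in \<open>auto simp: pt_def intro!: continuous_intros\<close>)
  hence "(el \<longlongrightarrow> el 0) (at 0)" by (simp add: continuous_on_eq_continuous_at isCont_def)
  moreover have "(el \<longlongrightarrow> 0) (at 0)" if "\<And>\<tau>. \<tau> \<noteq> 0 \<Longrightarrow> el \<tau> = 0"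
    by (rule tendsto_eventually) (use that in \<open>simp add: eventually_at_filter\<close>)
  ultimately have l: "el \<tau> = 0" for \<tau> using tendsto_unique[of "at 0" el] by (metis at_neq_bot)
  have A: "eA \<tau> = eA 0" for \<tau> by (rule DERIV_isconst_all) (use profile_derivs(2) l in auto)
  have Q: "eQ \<tau> = eQ 0" for \<tau> by (rule DERIV_isconst_all) (use profile_derivs(5) y in auto)
  show thesis
  proof (rule that)
    show "eA 0 > 0" unfolding eA_def using pos[OF ptp, of p 0] frameD[OF f] by fastforce
    show "eQ 0 > 0" by (rule eQ_pos)
    show "E (pt \<tau>) = (eA 0 * \<tau>\<^sup>2 + eQ 0) / 2" for \<tau>
      using euler_profile(1,3)[of \<tau>] A[of \<tau>] Q[of \<tau>] y[of \<tau>] by (simp add: power2_eq_square algebra_simps)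
  qed
qed

end

theorem flat_euclidean:
  assumes flat: "\<And>x. x \<noteq> 0 \<Longrightarrow> \<not> nonflat x"
  shows "euclidean_norm F"
proof -
  obtain p q where f: "frame p q" using frame_ex by blast
  obtain Y where Y: "norm Y = 1" "\<pi> Y = 0" "Y \<bullet> q = 0" using dim2 by blast
  obtain c j where cj: "c > 0" "j > 0" "\<And>\<tau>. E (\<tau> *\<^sub>R p + q) = (c * \<tau>\<^sup>2 + j) / 2"
    by (rule flat_profile[OF f Y flat, unfolded pt_def[OF f Y]], assumption, rule that)
  have pos: "E (\<alpha> *\<^sub>R p + \<beta> *\<^sub>R q) = (c * \<alpha>\<^sup>2 + j * \<beta>\<^sup>2) / 2" if b: "\<beta> > 0" for \<alpha> \<beta>
  proof -
    have "\<alpha> *\<^sub>R p + \<beta> *\<^sub>R q = \<beta> *\<^sub>R ((\<alpha> / \<beta>) *\<^sub>R p + q)" using b by (simp add: algebra_simps)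
    hence "E (\<alpha> *\<^sub>R p + \<beta> *\<^sub>R q) = \<beta>\<^sup>2 * ((c * (\<alpha> / \<beta>)\<^sup>2 + j) / 2)" using b cj(3) by (simp add: E_scaleR)
    moreover have "\<beta>\<^sup>2 * (c * (\<alpha> / \<beta>)\<^sup>2 + j) = c * \<alpha>\<^sup>2 + j * \<beta>\<^sup>2"
      using b by (simp add: power_divide distrib_left mult.commute)
    ultimately show ?thesis by simp
  qed
  have nn: "E (\<alpha> *\<^sub>R p + \<beta> *\<^sub>R q) = (c * \<alpha>\<^sup>2 + j * \<beta>\<^sup>2) / 2" if b: "\<beta> \<ge> 0" for \<alpha> \<beta>
  proof (cases "\<beta> = 0")
    case True
    \<comment> \<open>Points on the axis of \<open>p\<close> are not multiples of profile points, so
      they are reached as limits.\<close>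
    have cE: "continuous_on UNIV E" unfolding E_def[abs_def] by (intro continuous_intros continuous_F) auto
    have "continuous_on UNIV (\<lambda>b. E (\<alpha> *\<^sub>R p + b *\<^sub>R q))"
      by (rule continuous_on_compose2[OF cE]) (auto intro!: continuous_intros)
    hence "isCont (\<lambda>b. E (\<alpha> *\<^sub>R p + b *\<^sub>R q)) 0" by (simp add: continuous_on_eq_continuous_at)
    hence "((\<lambda>b. E (\<alpha> *\<^sub>R p + b *\<^sub>R q)) \<longlongrightarrow> E (\<alpha> *\<^sub>R p + 0 *\<^sub>R q)) (at_right 0)"
      unfolding isCont_def by (rule tendsto_within_subset) simp
    moreover have "((\<lambda>b. (c * \<alpha>\<^sup>2 + j * b\<^sup>2) / 2) \<longlongrightarrow> (c * \<alpha>\<^sup>2 + j * 0\<^sup>2) / 2) (at_right 0)"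
      by (intro tendsto_intros) auto
    hence "((\<lambda>b. E (\<alpha> *\<^sub>R p + b *\<^sub>R q)) \<longlongrightarrow> (c * \<alpha>\<^sup>2 + j * 0\<^sup>2) / 2) (at_right 0)"
      by (rule Lim_transform_eventually) (use pos in \<open>auto simp: eventually_at_right_field intro!: exI[of _ 1]\<close>)
    ultimately show ?thesis using True by (metis tendsto_unique trivial_limit_at_right_real)
  qed (use pos b in auto)
  have E: "E x = (c * (norm (\<pi> x))\<^sup>2 + j * (norm (x - \<pi> x))\<^sup>2) / 2" for x
  proof (cases "x = 0")
    case False
    obtain p' q' where f': "frame p' q'" "x = aa x *\<^sub>R p' + bb x *\<^sub>R q'" by (rule frame_exists)
    have "aa x \<noteq> 0 \<or> bb x \<noteq> 0" using False f'(2) by (metis add_0 scaleR_zero_left)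
    from frame_transfer(1)[OF f f'(1) this] nn[OF bb_nonneg[of x], of "aa x"] f'(2)
    show ?thesis by (simp add: \<pi>_norm) (simp add: bb_def)
  qed (simp add: E_def)
  \<comment> \<open>The self-adjoint operator of the quadratic form \<open>2 * E\<close>, acting by
    \<open>c\<close> on one block and by \<open>j\<close> on the other.\<close>
  define M where "M x = c *\<^sub>R \<pi> x + j *\<^sub>R (x - \<pi> x)" for x
  have lM: "linear M" unfolding M_def by (rule linearI) (simp_all add: algebra_simps)
  define \<alpha> where "\<alpha> = matrix M"
  have \<alpha>: "\<alpha> *v x = M x" for x unfolding \<alpha>_def using lM by simp
  have "M x \<bullet> y = x \<bullet> M y" for x y
    using selfadj[of x y] by (simp add: M_def inner_simps)
  hence "(\<alpha> *v x) \<bullet> y = x \<bullet> (\<alpha> *v y)" for x y by (simp add: \<alpha>)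
  hence "x \<bullet> (transpose \<alpha> *v y) = x \<bullet> (\<alpha> *v y)" for x y
    by (metis dot_lmul_matrix transpose_matrix_vector inner_commute vector_transpose_matrix transpose_transpose)
  hence "transpose \<alpha> *v y = \<alpha> *v y" for y using vector_eq_ldot by blast
  hence tr: "transpose \<alpha> = \<alpha>" by (simp add: matrix_eq)
  have q: "x \<bullet> (\<alpha> *v x) = 2 * E x" for x
  proof -
    have o: "\<pi> x \<bullet> \<pi> x = x \<bullet> \<pi> x" using selfadj[of x "\<pi> x"] by simp
    have "(norm (\<pi> x))\<^sup>2 = x \<bullet> \<pi> x" using o by (simp add: power2_norm_eq_inner)
    moreover have "(norm (x - \<pi> x))\<^sup>2 = x \<bullet> x - x \<bullet> \<pi> x"
      using o by (simp add: power2_norm_eq_inner inner_simps inner_commute)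
    ultimately show ?thesis unfolding E \<alpha> M_def by (simp add: inner_simps)
  qed
  show ?thesis unfolding euclidean_norm_def
  proof (intro exI[of _ \<alpha>] conjI allI tr)
    show "pos_def_matrix \<alpha>" unfolding pos_def_matrix_def q using E_pos by simp
    show "F x = sqrt (x \<bullet> (\<alpha> *v x))" for x unfolding q by (rule F_E)
  qed
qed

end

subsection \<open>Linearity of isometries\<close>

text \<open>The derivative is known only for positive times; continuity at 0 supplies the end point.
  In \<open>G0_split\<close> time 0 lies in a block, where \<open>G0_frame\<close> gives no
  information.\<close>

lemma constant_from_zero:
  fixes k :: "real \<Rightarrow> 'a::real_normed_vector"
  assumes dk: "\<And>t. t > 0 \<Longrightarrow> (k has_vector_derivative 0) (at t)" and c: "isCont k 0"
  shows "k 0 = k 1"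
proof -
  have "\<exists>c. \<forall>t\<in>{0<..}. k t = c"
    by (rule has_derivative_zero_constant)
       (use dk in \<open>auto simp: has_vector_derivative_def intro: has_derivative_at_withinI\<close>)
  hence kc: "k t = k 1" if "t > 0" for t using that by auto
  have "(k \<longlongrightarrow> k 0) (at_right 0)" using c unfolding isCont_def by (rule tendsto_within_subset) simp
  moreover have "(k \<longlongrightarrow> k 1) (at_right 0)"
    by (rule tendsto_eventually, unfold eventually_at_right_field, rule exI[of _ 1]) (use kc zero_less_one in blast)
  ultimately show ?thesis using tendsto_unique trivial_limit_at_right_real by blast
qed

context minkowski
begin

text \<open>On a subspace where the metric is constant, it is the square of \<open>F\<close>, and an isometry that
  preserves the subspace preserves the distance \<open>F (x - y)\<close>.\<close>

lemma iso_nonexpansive: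
  assumes V: "subspace V" and c: "\<And>x v. x \<in> V \<Longrightarrow> x \<noteq> 0 \<Longrightarrow> v \<in> V \<Longrightarrow> hs E x v v = (F v)\<^sup>2"
    and \<Phi>: "\<Phi> \<in> isometries F" and inv: "\<And>x. x \<in> V \<Longrightarrow> \<Phi> x \<in> V" and xy: "x \<in> V" "y \<in> V"
  shows "F (\<Phi> x - \<Phi> y) \<le> F (x - y)"
proof (cases "\<Phi> x = \<Phi> y \<or> x = 0 \<or> y = 0")
  case True
  have minus: "F (- v) = F v" if v: "v \<in> V" for v
  proof (cases "v = 0")
    case False
    have "(F (- v))\<^sup>2 = (F v)\<^sup>2" using c[OF v False, of v] c[OF v False, of "- v"] v V False
      by (simp add: subspace_neg)
    thus ?thesis using F_nonneg power2_eq_imp_eq by blast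
  qed simp
  from True show ?thesis
    using F_nonneg iso_F[OF \<Phi>] isometriesD(1)[OF \<Phi>] minus xy inv by (elim disjE) auto
next
  case False
  hence nz: "x \<noteq> 0" "y \<noteq> 0" "\<Phi> x \<noteq> \<Phi> y" by auto
  note D = isometriesD[OF \<Phi>]
  define b where "b = hs E x"
  have xp: "x \<in> punct" using nz by simp
  have bF: "b v v = (F v)\<^sup>2" if "v \<in> V" for v unfolding b_def by (rule c[OF xy(1) nz(1) that])
  define w where "w = \<Phi> x - \<Phi> y"
  have wV: "w \<in> V" unfolding w_def using V inv xy by (simp add: subspace_diff)
  have Fw: "F w > 0" using F_pos nz by (simp add: w_def)
  show ?thesis
  \<comment> \<open>An isometry need not be differentiable at the origin, so a segment through it is
    treated apart: then \<open>x\<close> and \<open>y\<close> lie on opposite rays,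
    \<open>F (x - y)\<close> is \<open>F x + F y\<close>, and the triangle inequality
    suffices.\<close>
  proof (cases "\<exists>t\<in>{0..1}. y + t *\<^sub>R (x - y) = 0")
    case True
    then obtain t where t: "0 \<le> t" "t \<le> 1" "y + t *\<^sub>R (x - y) = 0" by auto
    have yt: "(1 - t) *\<^sub>R y = - (t *\<^sub>R x)"
      using t(3) by (simp add: algebra_simps)
    have t0: "t > 0" using yt t nz by (cases "t = 0") auto
    have t1: "t < 1" using yt t nz by (cases "t = 1") auto
    define s where "s = t / (1 - t)"
    have s: "s > 0" using t0 t1 by (simp add: s_def)
    have "y = (1 / (1 - t)) *\<^sub>R ((1 - t) *\<^sub>R y)" using t1 by simp
    hence ys: "y = - (s *\<^sub>R x)" unfolding yt s_def by simp
    have mm: "F (- v) = F v" if v: "v \<in> V" for v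
    proof -
      have "(F (- v))\<^sup>2 = (F v)\<^sup>2" using bF[OF v] bF[of "- v"] v V xp by (simp add: b_def subspace_neg)
      thus ?thesis using F_nonneg power2_eq_imp_eq by blast
    qed
    have tri: "F (u + v) \<le> F u + F v" if u: "u \<in> V" and v: "v \<in> V" for u v
    proof -
      have "b u v \<le> \<bar>b u v\<bar>" by simp
      also have "\<dots> \<le> F u * F v"
      proof (rule power2_le_imp_le)
        show "\<bar>b u v\<bar>\<^sup>2 \<le> (F u * F v)\<^sup>2"
          using cauchy_schwarz[OF nz(1), of u v] bF[OF u] bF[OF v] by (simp add: b_def power_mult_distrib)
      qed (use F_nonneg in auto)
      finally have 1: "b u v \<le> F u * F v" .
      have "(F (u + v))\<^sup>2 = b u u + 2 * b u v + b v v"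
        using bF[of "u + v"] u v V xp hs_commute[OF xp, of v u] by (simp add: b_def subspace_add)
      also have "\<dots> \<le> (F u + F v)\<^sup>2" using 1 bF u v by (simp add: power2_eq_square algebra_simps)
      finally show ?thesis by (rule power2_le_imp_le) (use F_nonneg in auto)
    qed
    have "F (\<Phi> x - \<Phi> y) \<le> F (\<Phi> x) + F (\<Phi> y)"
      using tri[of "\<Phi> x" "- \<Phi> y"] mm[of "\<Phi> y"] inv xy V by (simp add: subspace_neg)
    also have "\<dots> = F x + F y" using iso_F[OF \<Phi>] by simp
    also have "F y = s * F x" unfolding ys using mm[of "s *\<^sub>R x"] s xy V by (simp add: subspace_scale F_scaleR)
    also have "F x + s * F x = F ((1 + s) *\<^sub>R x)" using F_scaleR[of "1 + s" x] s by (simp add: distrib_right)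
    also have "(1 + s) *\<^sub>R x = x - y" unfolding ys by (simp add: algebra_simps)
    finally show ?thesis .
  next
    case False
    define l where "l t = y + t *\<^sub>R (x - y)" for t :: real
    have lV: "l t \<in> V" for t using V xy by (simp add: l_def subspace_add subspace_scale subspace_diff)
    have l0: "l t \<noteq> 0" if "0 \<le> t" "t \<le> 1" for t using False that by (auto simp: l_def)
    define g where "g t = ddv (x - y) \<Phi> (l t)" for t
    have dl: "((\<lambda>t. \<Phi> (l t)) has_vector_derivative g t) (at t)" if "0 \<le> t" "t \<le> 1" for t
      unfolding g_def l_def
      by (rule smooth_map_curve[OF open_punct D(3) line_has_vector_derivative]) (use l0[OF that] in \<open>simp add: l_def\<close>)
    \<comment> \<open>The image curve stays in \<open>V\<close>, so its velocity is orthogonal to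
      the complement of \<open>V\<close>.\<close>
    have gV: "g t \<in> V" if t: "0 \<le> t" "t \<le> 1" for t
    proof -
      have "orthogonal u (g t)" if u: "u \<in> orthogonal_comp V" for u
      proof -
        have "u \<bullet> \<Phi> (l s) = 0" for s
          using u inv[OF lV] by (auto simp: orthogonal_comp_def orthogonal_def inner_commute)
        moreover have "((\<lambda>s. u \<bullet> \<Phi> (l s)) has_vector_derivative u \<bullet> g t) (at t)"
          by (rule bounded_linear.has_vector_derivative[OF bounded_linear_inner_right dl[OF t]])
        ultimately have "((\<lambda>s. 0 :: real) has_vector_derivative u \<bullet> g t) (at t)" by simp
        thus ?thesis
          using vector_derivative_unique_at[OF _ has_vector_derivative_const] by (auto simp: orthogonal_def)
      qed
      hence "g t \<in> orthogonal_comp (orthogonal_comp V)" by (simp add: orthogonal_comp_def)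
      thus ?thesis using orthogonal_comp_self[OF V] by simp
    qed
    have bg: "b (g t) (g t) = (F (x - y))\<^sup>2" if t: "0 \<le> t" "t \<le> 1" for t
    proof -
      have "b (g t) (g t) = (F (g t))\<^sup>2" by (rule bF[OF gV[OF t]])
      also have "\<dots> = hs E (\<Phi> (l t)) (g t) (g t)" by (rule c[symmetric]) (use inv lV D(6)[OF l0[OF t]] gV[OF t] in auto)
      also have "\<dots> = hs E (l t) (x - y) (x - y)" unfolding g_def by (rule D(5)[OF l0[OF t]])
      also have "\<dots> = (F (x - y))\<^sup>2" by (rule c[OF lV l0[OF t]]) (use V xy in \<open>simp add: subspace_diff\<close>)
      finally show ?thesis .
    qed
    have "linear (b w)" by (rule linearI) (use xp in \<open>simp_all add: b_def\<close>)
    hence bl: "bounded_linear (b w)" by (simp add: linear_linear)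
    \<comment> \<open>The curve from \<open>\<Phi> y\<close> to \<open>\<Phi> x\<close> is projected
      onto the chord \<open>w\<close>: the increment of \<open>b w\<close> is the square of
      \<open>F w\<close>, and by Cauchy-Schwarz its rate is at most
      \<open>F w * F (x - y)\<close>.\<close>
    have "norm (b w (\<Phi> (l 1)) - b w (\<Phi> (l 0))) \<le> (F w * F (x - y)) * norm (1 - 0 :: real)"
    proof (rule field_differentiable_bound[of "{0..1}"])
      show "((\<lambda>t. b w (\<Phi> (l t))) has_field_derivative b w (g t)) (at t within {0..1})" if "t \<in> {0..1}" for t
        using bounded_linear.has_vector_derivative[OF bl dl[of t]] that
        by (auto simp: has_real_derivative_iff_has_vector_derivative intro: has_vector_derivative_at_within)
      show "norm (b w (g t)) \<le> F w * F (x - y)" if "t \<in> {0..1}" for t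
      proof (rule power2_le_imp_le)
        show "(norm (b w (g t)))\<^sup>2 \<le> (F w * F (x - y))\<^sup>2"
          using cauchy_schwarz[OF nz(1), of w "g t"] bF[OF wV] bg[of t] that by (simp add: b_def power_mult_distrib)
      qed (use F_nonneg in auto)
    qed auto
    moreover have "l 1 = x" "l 0 = y" by (auto simp: l_def)
    moreover have "b w (\<Phi> x) - b w (\<Phi> y) = b w w" using xp by (simp add: b_def w_def)
    ultimately have "F w * F w \<le> F w * F (x - y)"
      using bF[OF wV] by (simp add: power2_eq_square)
    thus ?thesis using Fw by (simp add: w_def)
  qed
qed

text \<open>A distance preserving map that fixes 0 preserves the inner product by polarisation. The
  square of \<open>\<Phi> (x + y) - \<Phi> x - \<Phi> y\<close> then expands exactly as that of
  \<open>x + y - x - y\<close>, and homogeneity is treated alike.\<close>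

lemma iso_linear_on:
  assumes V: "subspace V" and c: "\<And>x v. x \<in> V \<Longrightarrow> x \<noteq> 0 \<Longrightarrow> v \<in> V \<Longrightarrow> hs E x v v = (F v)\<^sup>2"
    and \<Phi>: "\<Phi> \<in> isometries F" and inv: "\<And>x. x \<in> V \<Longrightarrow> \<Phi> x \<in> V" "\<And>x. x \<in> V \<Longrightarrow> inv_iso \<Phi> x \<in> V"
    and xy: "x \<in> V" "y \<in> V"
  shows "\<Phi> (x + y) = \<Phi> x + \<Phi> y" "\<Phi> (r *\<^sub>R x) = r *\<^sub>R \<Phi> x"
proof -
  have dist: "F (\<Phi> u - \<Phi> v) = F (u - v)" if "u \<in> V" "v \<in> V" for u v
  proof (rule antisym)
    show "F (\<Phi> u - \<Phi> v) \<le> F (u - v)" by (rule iso_nonexpansive[OF V c \<Phi> inv(1) that])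
    show "F (u - v) \<le> F (\<Phi> u - \<Phi> v)"
      using iso_nonexpansive[OF V c inv_iso(1)[OF \<Phi>] inv(2), of "\<Phi> u" "\<Phi> v"] inv(1) that inv_iso(3)[OF \<Phi>] by simp
  qed
  have "\<Phi> (x + y) = \<Phi> x + \<Phi> y \<and> \<Phi> (r *\<^sub>R x) = r *\<^sub>R \<Phi> x"
  proof (cases "\<exists>z\<in>V. z \<noteq> 0")
    case False
    hence "x = 0" "y = 0" using xy by auto
    thus ?thesis using isometriesD(1)[OF \<Phi>] by simp
  next
    case True
    then obtain z where z: "z \<in> V" "z \<noteq> 0" by blast
    hence zp: "z \<in> punct" by simp
    define b where "b = hs E z"
    have bF: "b v v = (F v)\<^sup>2" if "v \<in> V" for v unfolding b_def by (rule c[OF z that])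
    have bc: "b u v = b v u" for u v unfolding b_def by (rule hs_commute[OF zp])
    have bl: "b (u + v) w = b u w + b v w" "b w (u + v) = b w u + b w v" "b (u - v) w = b u w - b v w"
      "b w (u - v) = b w u - b w v" "b (r *\<^sub>R u) v = r * b u v" "b u (r *\<^sub>R v) = r * b u v" for u v w r
      unfolding b_def using zp by simp_all
    have pres: "b (\<Phi> u) (\<Phi> v) = b u v" if uv: "u \<in> V" "v \<in> V" for u v
    proof -
      have "b (\<Phi> u - \<Phi> v) (\<Phi> u - \<Phi> v) = b (u - v) (u - v)"
        using bF[of "\<Phi> u - \<Phi> v"] bF[of "u - v"] dist[OF uv] V inv(1) uv by (simp add: subspace_diff)
      moreover have "b (\<Phi> u) (\<Phi> u) = b u u" "b (\<Phi> v) (\<Phi> v) = b v v" using bF inv(1) uv iso_F[OF \<Phi>] by auto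
      ultimately show ?thesis using bc[of "\<Phi> v" "\<Phi> u"] bc[of v u] by (simp add: bl)
    qed
    have zero: "u = 0" if "b u u = 0" for u using pos[OF zp, of u] that unfolding b_def by fastforce
    have sV: "x + y \<in> V" "r *\<^sub>R x \<in> V" using V xy by (auto simp: subspace_add subspace_scale)
    have "b (\<Phi> (x + y) - \<Phi> x - \<Phi> y) (\<Phi> (x + y) - \<Phi> x - \<Phi> y) = b (x + y - x - y) (x + y - x - y)"
      unfolding bl(3,4) using pres sV xy by simp
    also have "\<dots> = 0" using zp by (simp add: b_def)
    finally have "\<Phi> (x + y) - \<Phi> x - \<Phi> y = 0" by (rule zero)
    moreover have "b (\<Phi> (r *\<^sub>R x) - r *\<^sub>R \<Phi> x) (\<Phi> (r *\<^sub>R x) - r *\<^sub>R \<Phi> x) = b (r *\<^sub>R x - r *\<^sub>R x) (r *\<^sub>R x - r *\<^sub>R x)"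
      unfolding bl(3,4) bl(5,6) using pres sV xy by (simp add: bl(5,6))
    hence "b (\<Phi> (r *\<^sub>R x) - r *\<^sub>R \<Phi> x) (\<Phi> (r *\<^sub>R x) - r *\<^sub>R \<Phi> x) = 0" using zp by (simp add: b_def)
    hence "\<Phi> (r *\<^sub>R x) - r *\<^sub>R \<Phi> x = 0" by (rule zero)
    ultimately show ?thesis by (simp add: algebra_simps)
  qed
  thus "\<Phi> (x + y) = \<Phi> x + \<Phi> y" "\<Phi> (r *\<^sub>R x) = r *\<^sub>R \<Phi> x" by auto
qed

text \<open>Only the values of \<open>E\<close> on \<open>V\<close> are given, so both derivatives
  are computed along lines in direction \<open>v\<close>, which stay in \<open>V\<close>.\<close>

lemma quadratic_on_subspace:
  assumes V: "subspace V" and q: "\<And>x. x \<in> V \<Longrightarrow> E x = (x \<bullet> M x) / 2"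
    and M: "linear M" "\<And>x y. M x \<bullet> y = x \<bullet> M y"
    and x: "x \<in> V" "x \<noteq> 0" and v: "v \<in> V"
  shows "hs E x v v = (F v)\<^sup>2"
proof -
  have Mc: "M x \<bullet> y = M y \<bullet> x" for x y using M(2)[of x y] by (simp add: inner_commute)
  have l: "((\<lambda>t. E (y + t *\<^sub>R v)) has_real_derivative M y \<bullet> v) (at 0)" if "y \<in> V" for y
  proof -
    have Ey: "E (y + t *\<^sub>R v) = (y \<bullet> M y + 2 * t * (M y \<bullet> v) + t\<^sup>2 * (v \<bullet> M v)) / 2" for t
    proof -
      have "E (y + t *\<^sub>R v) = ((y + t *\<^sub>R v) \<bullet> M (y + t *\<^sub>R v)) / 2"
        by (rule q) (use V v that in \<open>simp add: subspace_add subspace_scale\<close>)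
      moreover have "M (y + t *\<^sub>R v) = M y + t *\<^sub>R M v" by (simp add: linear_add[OF M(1)] linear_scale[OF M(1)])
      moreover have "y \<bullet> M v = M y \<bullet> v" "v \<bullet> M y = M y \<bullet> v" using M(2)[of y v] by (simp_all add: inner_commute)
      ultimately show ?thesis by (simp add: inner_add_left inner_add_right power2_eq_square distrib_left)
    qed
    moreover have "((\<lambda>t. (y \<bullet> M y + 2 * t * (M y \<bullet> v) + t\<^sup>2 * (v \<bullet> M v)) / 2) has_real_derivative M y \<bullet> v) (at 0)"
      by (auto intro!: derivative_eq_intros)
    ultimately show ?thesis unfolding Ey by blast
  qed
  have d: "dd v E y = M y \<bullet> v" if "y \<in> V" "y \<noteq> 0" for y
    using DERIV_unique[OF _ l[OF that(1)]] DERIV_curve[OF line_has_vector_derivative[of y v 0]] that by simp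
  have ev: "\<forall>\<^sub>F t in nhds 0. x + t *\<^sub>R v \<noteq> 0"
  proof -
    have "isCont (\<lambda>t. x + t *\<^sub>R v) 0" by (intro continuous_intros)
    hence "\<forall>\<^sub>F t in at 0. x + t *\<^sub>R v \<noteq> 0" using x(2) tendsto_imp_eventually_ne[of "\<lambda>t. x + t *\<^sub>R v" x "at 0" 0]
      by (simp add: isCont_def)
    thus ?thesis using x(2) by (simp add: eventually_nhds_conv_at)
  qed
  have "((\<lambda>t. dd v E (x + t *\<^sub>R v)) has_real_derivative hs E x v v) (at 0)"
    using smooth_fun.DERIV_curve[OF smooth_fun_dd line_has_vector_derivative[of x v 0]] x by (simp add: hs_def)
  moreover have "((\<lambda>t. M x \<bullet> v + t * (M v \<bullet> v)) has_real_derivative M v \<bullet> v) (at 0)"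
    by (auto intro!: derivative_eq_intros)
  hence "((\<lambda>t. dd v E (x + t *\<^sub>R v)) has_real_derivative M v \<bullet> v) (at 0)"
  proof (rule DERIV_cong_ev[THEN iffD1, rotated 3])
    show "\<forall>\<^sub>F t in nhds 0. M x \<bullet> v + t * (M v \<bullet> v) = dd v E (x + t *\<^sub>R v)"
      using ev
    proof eventually_elim
      fix t :: real assume "x + t *\<^sub>R v \<noteq> 0"
      thus "M x \<bullet> v + t * (M v \<bullet> v) = dd v E (x + t *\<^sub>R v)"
        using d[of "x + t *\<^sub>R v"] V x v
        by (simp add: subspace_add subspace_scale linear_add[OF M(1)] linear_scale[OF M(1)] inner_simps)
    qed
  qed auto
  ultimately have "hs E x v v = M v \<bullet> v" by (rule DERIV_unique)
  also have "\<dots> = (F v)\<^sup>2" using q[OF v] by (simp add: E_def inner_commute)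
  finally show ?thesis .
qed

theorem euclidean_isometry_linear:
  assumes e: "euclidean_norm F" and \<Phi>: "\<Phi> \<in> isometries F"
  shows "linear \<Phi>"
proof -
  obtain \<alpha> :: "real^'n^'n" where \<alpha>: "transpose \<alpha> = \<alpha>" "pos_def_matrix \<alpha>" "\<And>x. F x = sqrt (x \<bullet> (\<alpha> *v x))"
    using e unfolding euclidean_norm_def by blast
  have nn: "x \<bullet> (\<alpha> *v x) \<ge> 0" for x
    using \<alpha>(2) unfolding pos_def_matrix_def by (cases "x = 0") (auto simp: less_imp_le)
  have sym: "(\<alpha> *v x) \<bullet> y = x \<bullet> (\<alpha> *v y)" for x y
    by (metis \<alpha>(1) dot_lmul_matrix vector_transpose_matrix inner_commute)
  have q: "hs E x v v = (F v)\<^sup>2" if "x \<noteq> 0" for x v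
    by (rule quadratic_on_subspace[OF subspace_UNIV _ _ sym]) (use that nn in \<open>auto simp: E_def \<alpha>(3)\<close>)
  show ?thesis
    using iso_linear_on[OF subspace_UNIV q \<Phi>] by (intro linearI) auto
qed

end

section \<open>Rigidity of the identity component in the curved case\<close>

context sym_minkowski
begin

context
  fixes x0 \<Phi>
  assumes x0: "x0 \<noteq> 0" "nonflat x0" and \<Phi>: "\<Phi> \<in> G0"
begin

lemma G0_aa: "aa (\<Phi> x) = aa x" and G0_bb: "bb (\<Phi> x) = bb x"
  using G0_preserves_aa_bb[OF x0 \<Phi>] isometriesD(1)[OF G0_iso[OF \<Phi>]] by (cases "x = 0"; simp)+

lemma G0_block1: "\<pi> x = x \<Longrightarrow> \<pi> (\<Phi> x) = \<Phi> x"
  using G0_bb[of x] by (simp add: bb_def)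

lemma G0_block2: "\<pi> x = 0 \<Longrightarrow> \<pi> (\<Phi> x) = 0"
  using G0_aa[of x] \<pi>_norm[of x] \<pi>_norm[of "\<Phi> x"] by simp

text \<open>The metric dual of \<open>p\<close> factors through the derivatives of \<open>aa\<close> and \<open>bb\<close>, which \<open>\<Phi>\<close>
  preserves. Hence \<open>\<Phi>\<close> maps the frame at \<open>x\<close> to the frame at its image.\<close>

lemma G0_frame:
  assumes f: "frame p q" and x: "x = \<alpha> *\<^sub>R p + \<beta> *\<^sub>R q" and \<alpha>: "one \<or> \<alpha> > 0" and \<beta>: "\<beta> > 0"
  obtains p' q' where "frame p' q'" "\<Phi> x = \<alpha> *\<^sub>R p' + \<beta> *\<^sub>R q'" "ddv p \<Phi> x = p'" "ddv q \<Phi> x = q'"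
proof -
  note I = isometriesD[OF G0_iso[OF \<Phi>]]
  have xz: "x \<noteq> 0" using frame_zero[OF f] \<beta> x by simp
  have yz: "\<Phi> x \<noteq> 0" by (rule I(6)[OF xz])
  have ab: "aa x = \<alpha>" "bb x = \<beta>" using frame_aa_bb(1,2)[OF f, of \<alpha> \<beta>] \<alpha> \<beta> x by auto
  obtain p' q' where f': "frame p' q'" "\<Phi> x = \<alpha> *\<^sub>R p' + \<beta> *\<^sub>R q'"
    using frame_exists[of "\<Phi> x"] unfolding G0_aa G0_bb ab by blast
  define J where "J v = ddv v \<Phi> x" for v
  have lv: "((\<lambda>t. x + t *\<^sub>R v) has_vector_derivative v) (at 0)" for v by (rule line_has_vector_derivative)
  have dJ: "((\<lambda>t. \<Phi> (x + t *\<^sub>R v)) has_vector_derivative J v) (at 0)" for v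
    using smooth_map_curve[OF open_punct I(3) lv] xz by (simp add: J_def)
  have da: "p' \<bullet> J v = p \<bullet> v" for v
  proof (rule DERIV_unique)
    show "((\<lambda>t. aa (\<Phi> (x + t *\<^sub>R v))) has_real_derivative p' \<bullet> J v) (at 0)"
      by (rule aa_derivative[OF dJ f'(1)]) (use f'(2) \<alpha> in auto)
    show "((\<lambda>t. aa (\<Phi> (x + t *\<^sub>R v))) has_real_derivative p \<bullet> v) (at 0)"
      unfolding G0_aa by (rule aa_derivative[OF lv f]) (use x \<alpha> in auto)
  qed
  have db: "q' \<bullet> J v = q \<bullet> v" for v
  proof (rule DERIV_unique)
    show "((\<lambda>t. bb (\<Phi> (x + t *\<^sub>R v))) has_real_derivative q' \<bullet> J v) (at 0)"
      by (rule bb_derivative[OF dJ f'(1)]) (use f'(2) \<beta> in auto)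
    show "((\<lambda>t. bb (\<Phi> (x + t *\<^sub>R v))) has_real_derivative q \<bullet> v) (at 0)"
      unfolding G0_bb by (rule bb_derivative[OF lv f]) (use x \<beta> in auto)
  qed
  have nz: "\<alpha> \<noteq> 0 \<or> \<beta> \<noteq> 0" using \<beta> by simp
  \<comment> \<open>A vector in the frame plane pairs only with the plane part of \<open>v\<close>.
    By \<open>da\<close> and \<open>db\<close> this part has the same coefficients before and after
    \<open>\<Phi>\<close>.\<close>
  have dual: "hs E (\<alpha> *\<^sub>R a + \<beta> *\<^sub>R b) (c *\<^sub>R a + d *\<^sub>R b) v
      = hs E (\<alpha> *\<^sub>R a + \<beta> *\<^sub>R b) (c *\<^sub>R a + d *\<^sub>R b) ((a \<bullet> v) *\<^sub>R a + (b \<bullet> v) *\<^sub>R b)"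
    if ff: "frame a b" for a b c d v
  proof -
    have z: "\<alpha> *\<^sub>R a + \<beta> *\<^sub>R b \<in> punct" using frame_zero[OF ff] nz by auto
    define w where "w = v - ((a \<bullet> v) *\<^sub>R a + (b \<bullet> v) *\<^sub>R b)"
    have w: "a \<bullet> w = 0" "b \<bullet> w = 0" using frameD[OF ff] by (auto simp: w_def inner_simps)
    have "hs E (\<alpha> *\<^sub>R a + \<beta> *\<^sub>R b) (c *\<^sub>R a + d *\<^sub>R b) w = 0" by (rule frame_orthogonal(1)[OF ff nz w])
    thus ?thesis unfolding w_def using hs_linear(6)[OF z] by simp
  qed
  have lin: "linear J" unfolding J_def by (rule linear_ddv)
  have "inj J"
  proof (rule linear_injective_0[OF lin, THEN iffD2], intro allI impI)
    fix v assume "J v = 0"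
    hence "hs E x v w = 0" for w using I(5)[OF xz, of v w] yz unfolding J_def by simp
    thus "v = 0" using hs_eq_0D xz by blast
  qed
  hence surj: "surj J" using lin linear_injective_imp_surjective by blast
  have J: "J (c *\<^sub>R p + d *\<^sub>R q) = c *\<^sub>R p' + d *\<^sub>R q'" for c d
  proof -
    have "J (c *\<^sub>R p + d *\<^sub>R q) - (c *\<^sub>R p' + d *\<^sub>R q') = 0"
    proof (rule hs_eq_0D[of "\<Phi> x"])
      fix w
      obtain v where w: "w = J v" using surj by blast
      have "hs E (\<Phi> x) (J (c *\<^sub>R p + d *\<^sub>R q)) (J v) = hs E x (c *\<^sub>R p + d *\<^sub>R q) v"
        unfolding J_def by (rule I(5)[OF xz])
      also have "\<dots> = hs E x (c *\<^sub>R p + d *\<^sub>R q) ((p \<bullet> v) *\<^sub>R p + (q \<bullet> v) *\<^sub>R q)"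
        unfolding x by (rule dual[OF f])
      also have "\<dots> = hs E (\<Phi> x) (c *\<^sub>R p' + d *\<^sub>R q') ((p' \<bullet> J v) *\<^sub>R p' + (q' \<bullet> J v) *\<^sub>R q')"
        using frame_transfer(2)[OF f f'(1) nz, of c d "p \<bullet> v" "q \<bullet> v"]
        by (simp only: da db f'(2) x[symmetric])
      also have "\<dots> = hs E (\<Phi> x) (c *\<^sub>R p' + d *\<^sub>R q') (J v)"
        unfolding f'(2) by (rule dual[OF f'(1), symmetric])
      finally show "hs E (\<Phi> x) (J (c *\<^sub>R p + d *\<^sub>R q) - (c *\<^sub>R p' + d *\<^sub>R q')) w = 0"
        using yz by (simp add: w)
    qed (use yz in simp)
    thus ?thesis by simp
  qed
  show thesis using that[OF f'] J[of 1 0] J[of 0 1] by (simp add: J_def)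
qed

text \<open>Moving along \<open>q\<close> changes \<open>\<Phi>\<close> only by a vector
  \<open>q'\<close> in the kernel of \<open>\<pi>\<close>, so \<open>\<pi> (\<Phi> x)\<close> can be
  computed at \<open>\<pi> x\<close>. Moving along \<open>p\<close> gives the other component in the
  same way.\<close>

lemma G0_split: "\<Phi> x = \<Phi> (\<pi> x) + \<Phi> (x - \<pi> x)"
proof (cases "\<pi> x = 0 \<or> x - \<pi> x = 0")
  case True
  thus ?thesis using isometriesD(1)[OF G0_iso[OF \<Phi>]] by auto
next
  case False
  note I = isometriesD[OF G0_iso[OF \<Phi>]]
  obtain p q where f: "frame p q" "x = aa x *\<^sub>R p + bb x *\<^sub>R q" by (rule frame_exists)
  define a b where "a = aa x" and "b = bb x"
  have b: "b > 0" using False by (simp add: b_def bb_def)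
  have a: "one \<or> a > 0" "a \<noteq> 0" using False \<pi>_norm[of x] by (auto simp: a_def aa_def)
  have x: "x = a *\<^sub>R p + b *\<^sub>R q" using f(2) by (simp add: a_def b_def)
  have px: "\<pi> x = a *\<^sub>R p" "x - \<pi> x = b *\<^sub>R q" using frameD[OF f(1)] by (auto simp: x)
  have cont: "isCont \<Phi> z" if "z \<noteq> 0" for z
    using smooth_map_continuous[OF I(3) open_punct] that continuous_on_eq_continuous_at[OF open_punct] by blast
  have nz: "\<alpha> *\<^sub>R p + \<beta> *\<^sub>R q \<noteq> 0" if "\<alpha> \<noteq> 0 \<or> \<beta> \<noteq> 0" for \<alpha> \<beta> using frame_zero[OF f(1)] that by auto
  have lin: "bounded_linear \<pi>" using lin by (simp add: linear_linear)
  have z1: "\<pi> (\<Phi> x) = \<Phi> (\<pi> x)"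
  proof -
    define k where "k t = \<pi> (\<Phi> (a *\<^sub>R p + (t * b) *\<^sub>R q))" for t
    have dk: "(k has_vector_derivative 0) (at t)" if t: "t > 0" for t
    proof -
      obtain p' q' where pq: "frame p' q'" "ddv q \<Phi> (a *\<^sub>R p + (t * b) *\<^sub>R q) = q'"
        using G0_frame[OF f(1) refl a(1), of "t * b"] t b by (metis mult_pos_pos)
      have "((\<lambda>t. a *\<^sub>R p + (t * b) *\<^sub>R q) has_vector_derivative b *\<^sub>R q) (at t)"
        by (auto intro!: derivative_eq_intros simp: has_vector_derivative_def)
      from smooth_map_curve[OF open_punct I(3) this] nz a
      have "((\<lambda>t. \<Phi> (a *\<^sub>R p + (t * b) *\<^sub>R q)) has_vector_derivative b *\<^sub>R q') (at t)"
        by (simp add: ddv_scaleR pq)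
      from bounded_linear.has_vector_derivative[OF lin this] frameD[OF pq(1)]
      show ?thesis by (simp add: k_def[abs_def])
    qed
    have "isCont k 0" unfolding k_def
      by (intro bounded_linear.isCont[OF lin] isCont_o2[OF _ cont] continuous_intros) (use nz[of a 0] a in auto)
    from constant_from_zero[OF dk this] have "k 0 = k 1" .
    moreover have "\<pi> (\<Phi> (a *\<^sub>R p)) = \<Phi> (a *\<^sub>R p)" by (rule G0_block1) (use frameD[OF f(1)] in simp)
    ultimately show ?thesis by (simp add: k_def px x[symmetric])
  qed
  have z2: "\<Phi> x - \<pi> (\<Phi> x) = \<Phi> (x - \<pi> x)"
  proof -
    define P where "P v = v - \<pi> v" for v
    have P: "bounded_linear P" unfolding P_def by (intro bounded_linear_sub bounded_linear_ident lin)
    define k where "k t = P (\<Phi> ((t * a) *\<^sub>R p + b *\<^sub>R q))" for t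
    have dk: "(k has_vector_derivative 0) (at t)" if t: "t > 0" for t
    proof -
      have "one \<or> t * a > 0" using a t by auto
      then obtain p' q' where pq: "frame p' q'" "ddv p \<Phi> ((t * a) *\<^sub>R p + b *\<^sub>R q) = p'"
        using G0_frame[OF f(1) refl _ b, of "t * a"] by metis
      have "((\<lambda>t. (t * a) *\<^sub>R p + b *\<^sub>R q) has_vector_derivative a *\<^sub>R p) (at t)"
        by (auto intro!: derivative_eq_intros simp: has_vector_derivative_def)
      from smooth_map_curve[OF open_punct I(3) this] nz b
      have "((\<lambda>t. \<Phi> ((t * a) *\<^sub>R p + b *\<^sub>R q)) has_vector_derivative a *\<^sub>R p') (at t)"
        by (simp add: ddv_scaleR pq)
      from bounded_linear.has_vector_derivative[OF P this] frameD[OF pq(1)]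
      show ?thesis by (simp add: k_def[abs_def] P_def)
    qed
    have "isCont k 0" unfolding k_def
      by (intro bounded_linear.isCont[OF P] isCont_o2[OF _ cont] continuous_intros) (use nz[of 0 b] b in auto)
    from constant_from_zero[OF dk this] have "k 0 = k 1" .
    moreover have "\<pi> (\<Phi> (b *\<^sub>R q)) = 0" by (rule G0_block2) (use frameD[OF f(1)] in simp)
    ultimately show ?thesis by (simp add: k_def P_def px(2) x[symmetric])
  qed
  have "\<Phi> x = \<pi> (\<Phi> x) + (\<Phi> x - \<pi> (\<Phi> x))" by simp
  thus ?thesis unfolding z2 unfolding z1 .
qed

end

text \<open>Within a block \<open>F\<close> is a function of the Euclidean norm, hence a multiple of
  it, so the metric is constant there and \<open>iso_linear_on\<close> applies.
  \<open>G0_split\<close> assembles the two blocks.\<close>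

theorem G0_rigid:
  assumes x0: "x0 \<noteq> 0" "nonflat x0" and \<Phi>: "\<Phi> \<in> G0"
  shows "linear \<Phi>" "norm (\<Phi> x) = norm x" "\<pi> (\<Phi> x) = \<Phi> (\<pi> x)"
proof -
  note aa = G0_aa[OF x0 \<Phi>] and bb = G0_bb[OF x0 \<Phi>] and split = G0_split[OF x0 \<Phi>]
  note b1 = G0_block1[OF x0 \<Phi>] and b2 = G0_block2[OF x0 \<Phi>]
  note c1 = G0_block1[OF x0 G0_inv[OF \<Phi>]] and c2 = G0_block2[OF x0 G0_inv[OF \<Phi>]]
  have quad: "hs E x v v = (F v)\<^sup>2"
    if V: "subspace V" and q: "\<And>x y. x \<in> V \<Longrightarrow> y \<in> V \<Longrightarrow> norm x = norm y \<Longrightarrow> F x = F y"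
      and xv: "x \<in> V" "x \<noteq> 0" "v \<in> V" for V x v
  proof (rule quadratic_on_subspace[OF V _ _ _ xv])
    \<comment> \<open>The value of \<open>2 * E\<close> on the unit sphere of \<open>V\<close>, read
      off at the direction of \<open>x\<close>.\<close>
    define c where "c = (F ((1 / norm x) *\<^sub>R x))\<^sup>2"
    show "linear (\<lambda>x::real^'n. c *\<^sub>R x)" by (simp add: linear_scale_self)
    show "E y = (y \<bullet> (c *\<^sub>R y)) / 2" if y: "y \<in> V" for y
    proof -
      have "F y = F (norm y *\<^sub>R (1 / norm x) *\<^sub>R x)"
        by (rule q) (use y xv V in \<open>auto simp: subspace_scale\<close>)
      also have "\<dots> = norm y * F ((1 / norm x) *\<^sub>R x)" by (rule F_scaleR) simp
      finally show ?thesis by (simp add: E_def c_def power_mult_distrib power2_norm_eq_inner mult.commute)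
    qed
  qed simp
  have V1: "subspace {x. \<pi> x = x}" and V2: "subspace {x. \<pi> x = 0}" by (auto simp: subspace_def)
  have q2: "hs E x v v = (F v)\<^sup>2" if "x \<in> {x. \<pi> x = 0}" "x \<noteq> 0" "v \<in> {x. \<pi> x = 0}" for x v
  proof (rule quad[OF V2 _ that])
    fix x y :: "real^'n" assume "x \<in> {x. \<pi> x = 0}" "y \<in> {x. \<pi> x = 0}" "norm x = norm y"
    thus "F x = F y" by (intro sym2) auto
  qed
  have l2: "\<Phi> (x + y) = \<Phi> x + \<Phi> y" "\<Phi> (r *\<^sub>R x) = r *\<^sub>R \<Phi> x" if xy: "\<pi> x = 0" "\<pi> y = 0" for x y r
  proof -
    note L = iso_linear_on[OF V2 q2 G0_iso[OF \<Phi>]]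
    show "\<Phi> (x + y) = \<Phi> x + \<Phi> y" by (rule L(1)) (use b2 c2 xy in auto)
    show "\<Phi> (r *\<^sub>R x) = r *\<^sub>R \<Phi> x" by (rule L(2)) (use b2 c2 xy in auto)
  qed
  \<comment> \<open>On a line block \<open>F\<close> need not be even, so the metric argument is
    replaced by this: \<open>aa\<close> is then the signed coordinate on the line, and it is
    preserved.\<close>
  have fix1: "\<Phi> x = x" if o: one and x: "\<pi> x = x" for x
  proof -
    have "\<Phi> x = aa (\<Phi> x) *\<^sub>R p0" using one[OF o, of "\<Phi> x"] b1[OF x] o by (simp add: aa_def)
    moreover have "x = aa x *\<^sub>R p0" using one[OF o, of x] x o by (simp add: aa_def)
    ultimately show ?thesis using aa by simp
  qed
  have l1: "\<Phi> (x + y) = \<Phi> x + \<Phi> y \<and> \<Phi> (r *\<^sub>R x) = r *\<^sub>R \<Phi> x" if xy: "\<pi> x = x" "\<pi> y = y" for x y r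
  proof (cases one)
    case True
    thus ?thesis using fix1 xy by simp
  next
    case False
    have q1: "hs E x v v = (F v)\<^sup>2" if "x \<in> {x. \<pi> x = x}" "x \<noteq> 0" "v \<in> {x. \<pi> x = x}" for x v
    proof (rule quad[OF V1 _ that])
      fix x y :: "real^'n" assume "x \<in> {x. \<pi> x = x}" "y \<in> {x. \<pi> x = x}" "norm x = norm y"
      thus "F x = F y" by (intro sym1[OF False]) auto
    qed
    note L = iso_linear_on[OF V1 q1 G0_iso[OF \<Phi>]]
    have "\<Phi> (x + y) = \<Phi> x + \<Phi> y" by (rule L(1)) (use b1 c1 xy in auto)
    moreover have "\<Phi> (r *\<^sub>R x) = r *\<^sub>R \<Phi> x" by (rule L(2)) (use b1 c1 xy in auto)
    ultimately show ?thesis ..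
  qed
  show pc: "\<pi> (\<Phi> x) = \<Phi> (\<pi> x)" for x
    by (subst split) (simp add: b1 b2)
  show "linear \<Phi>"
  proof (rule linearI)
    fix x y :: "real^'n" and r :: real
    have 1: "(x + y) - \<pi> (x + y) = (x - \<pi> x) + (y - \<pi> y)" by simp
    have "\<Phi> (x + y) = \<Phi> (\<pi> x + \<pi> y) + \<Phi> ((x - \<pi> x) + (y - \<pi> y))" using split[of "x + y"] unfolding 1 by simp
    also have "\<dots> = \<Phi> (\<pi> x) + \<Phi> (\<pi> y) + (\<Phi> (x - \<pi> x) + \<Phi> (y - \<pi> y))"
      using l1[of "\<pi> x" "\<pi> y"] l2(1)[of "x - \<pi> x" "y - \<pi> y"] by simp
    also have "\<dots> = \<Phi> x + \<Phi> y" using split[of x] split[of y] by simp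
    finally show "\<Phi> (x + y) = \<Phi> x + \<Phi> y" .
    have "\<Phi> (r *\<^sub>R x) = \<Phi> (r *\<^sub>R \<pi> x) + \<Phi> (r *\<^sub>R (x - \<pi> x))" using split[of "r *\<^sub>R x"] by (simp add: scaleR_diff_right)
    also have "\<dots> = r *\<^sub>R \<Phi> (\<pi> x) + r *\<^sub>R \<Phi> (x - \<pi> x)"
      using l1[of "\<pi> x" "\<pi> x" r] l2(2)[of "x - \<pi> x" 0 r] by simp
    also have "\<dots> = r *\<^sub>R \<Phi> x" using split[of x] by (simp add: scaleR_add_right)
    finally show "\<Phi> (r *\<^sub>R x) = r *\<^sub>R \<Phi> x" .
  qed
  have "(norm (\<Phi> x))\<^sup>2 = (norm x)\<^sup>2" using norm_aa_bb[of x] norm_aa_bb[of "\<Phi> x"] aa bb by simp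
  thus "norm (\<Phi> x) = norm x" by simp
qed

end

subsection \<open>Connectedness of the special orthogonal group\<close>

definition refl_mat :: "real^'n::finite \<Rightarrow> real^'n^'n" where
  "refl_mat w = (\<chi> i j. (if i = j then 1 else 0) - 2 * w $ i * w $ j)"

lemma refl_mat_mult: "refl_mat w *v x = x - (2 * (w \<bullet> x)) *\<^sub>R w"
proof -
  have "(\<Sum>j\<in>UNIV. ((if i = j then 1 else 0) - 2 * w $ i * w $ j) * x $ j)
      = x $ i - 2 * w $ i * (\<Sum>j\<in>UNIV. w $ j * x $ j)" for i
  proof -
    have "(\<Sum>j\<in>UNIV. ((if i = j then 1 else 0) - 2 * w $ i * w $ j) * x $ j)
      = (\<Sum>j\<in>UNIV. (if i = j then x $ j else 0) - 2 * w $ i * (w $ j * x $ j))"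
      by (rule sum.cong) (auto simp: algebra_simps)
    thus ?thesis by (simp add: sum_subtractf sum_distrib_left)
  qed
  thus ?thesis by (simp add: vec_eq_iff refl_mat_def matrix_vector_mult_def inner_vec_def mult_ac)
qed

lemma refl_mat_square:
  assumes "norm w = 1"
  shows "refl_mat w ** refl_mat w = mat 1"
proof -
  have "w \<bullet> w = 1" using assms by (simp add: norm_eq_1)
  hence "refl_mat w *v (refl_mat w *v x) = x" for x by (simp add: refl_mat_mult inner_simps)
  thus ?thesis by (simp add: matrix_eq matrix_vector_mul_assoc[symmetric])
qed

lemma orthogonal_refl_mat:
  assumes "norm w = 1"
  shows "orthogonal_matrix (refl_mat w)"
proof -
  have "transpose (refl_mat w) = refl_mat w" by (simp add: transpose_def refl_mat_def vec_eq_iff mult_ac)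
  thus ?thesis using refl_mat_square[OF assms] by (simp add: orthogonal_matrix)
qed

text \<open>An orthogonal change of basis turns \<open>refl_mat w\<close> into the reflection in a
  coordinate hyperplane, which is diagonal with a single -1.\<close>

lemma det_refl_mat:
  fixes w :: "real^'n::finite"
  assumes w: "norm w = 1"
  shows "det (refl_mat w) = -1"
proof -
  fix k :: 'n
  obtain Q where Q: "orthogonal_matrix Q" "Q *v axis k 1 = w" using orthogonal_matrix_exists_basis[OF w] .
  define D where "D = (refl_mat (axis k 1) :: real^'n^'n)"
  have Qt: "Q ** transpose Q = mat 1" "transpose Q ** Q = mat 1" using Q(1) by (auto simp: orthogonal_matrix_def)
  have adj: "w \<bullet> x = axis k 1 \<bullet> (transpose Q *v x)" for x
    using Q(2) by (metis dot_lmul_matrix vector_transpose_matrix transpose_transpose)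
  have "(Q ** D ** transpose Q) *v x = refl_mat w *v x" for x
  proof -
    have "(Q ** D ** transpose Q) *v x = Q *v (D *v (transpose Q *v x))"
      by (simp add: matrix_vector_mul_assoc matrix_mul_assoc del: transpose_matrix_vector)
    also have "\<dots> = Q *v (transpose Q *v x) - (2 * (w \<bullet> x)) *\<^sub>R (Q *v axis k 1)"
      unfolding D_def refl_mat_mult adj by (simp add: matrix_vector_mult_diff_distrib matrix_vector_mult_scaleR)
    also have "\<dots> = refl_mat w *v x" using Qt by (simp add: refl_mat_mult Q(2) matrix_vector_mul_assoc del: transpose_matrix_vector)
    finally show ?thesis .
  qed
  hence "refl_mat w = Q ** D ** transpose Q" by (simp add: matrix_eq)
  hence "det (refl_mat w) = det D * (det Q * det (transpose Q))" by (simp add: det_mul)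
  also have "det Q * det (transpose Q) = 1" using Qt(1) by (metis det_mul det_I)
  also have "det D = (\<Prod>i\<in>UNIV. D $ i $ i)"
    by (rule det_diagonal) (auto simp: D_def refl_mat_def axis_def)
  also have "\<dots> = (\<Prod>i\<in>UNIV. if i = k then -1 else 1)"
    by (rule prod.cong) (auto simp: D_def refl_mat_def axis_def)
  finally show ?thesis by simp
qed

definition fixed_space :: "real^'n::finite^'n \<Rightarrow> (real^'n) set" where
  "fixed_space A = {x. A *v x = x}"

lemma subspace_fixed_space: "subspace (fixed_space A)"
  by (auto simp: subspace_def fixed_space_def matrix_vector_right_distrib matrix_vector_mult_scaleR)

text \<open>The step of the Cartan-Dieudonne theorem: for a moved vector \<open>x\<close>, the
  reflection along \<open>x - A *v x\<close> brings the image of \<open>x\<close> back to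
  \<open>x\<close>. Vectors fixed by \<open>A\<close> are orthogonal to that direction and stay
  fixed.\<close>

lemma refl_enlarges_fixed_space:
  assumes A: "orthogonal_matrix A" and ne: "A \<noteq> mat 1"
  obtains w where "norm w = 1" "orthogonal_matrix (refl_mat w ** A)" "det (refl_mat w ** A) = - det A"
    "dim (fixed_space A) < dim (fixed_space (refl_mat w ** A))"
proof -
  have oA: "orthogonal_transformation ((*v) A)"
    using A by (simp add: orthogonal_transformation_matrix)
  have inner: "(A *v x) \<bullet> (A *v y) = x \<bullet> y" for x y using oA by (simp add: orthogonal_transformation_def)
  have nA: "norm (A *v x) = norm x" for x using orthogonal_transformation_norm[OF oA] .
  obtain x where x: "A *v x \<noteq> x" using ne by (auto simp: matrix_eq)
  define w where "w = (1 / norm (x - A *v x)) *\<^sub>R (x - A *v x)"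
  have n: "norm (x - A *v x) \<noteq> 0" using x by auto
  hence w1: "norm w = 1" by (simp add: w_def)
  have Ax: "refl_mat w *v (A *v x) = x"
  proof -
    have "2 * ((x - A *v x) \<bullet> (A *v x)) = - (norm (x - A *v x))\<^sup>2"
      using inner[of x x] by (simp add: power2_norm_eq_inner inner_simps inner_commute)
    moreover have "2 * (w \<bullet> (A *v x)) = 2 * ((x - A *v x) \<bullet> (A *v x)) / norm (x - A *v x)"
      by (simp only: w_def inner_scaleR_left) simp
    ultimately have e: "2 * (w \<bullet> (A *v x)) = - norm (x - A *v x)"
      using n by (simp add: power2_eq_square)
    show ?thesis unfolding refl_mat_mult e using n by (simp add: w_def)
  qed
  have sub: "fixed_space A \<subseteq> fixed_space (refl_mat w ** A)"
  proof
    fix y assume "y \<in> fixed_space A"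
    hence y: "A *v y = y" by (simp add: fixed_space_def)
    hence "(x - A *v x) \<bullet> y = 0" using inner[of x y] by (simp add: inner_simps)
    hence "w \<bullet> y = 0" by (simp add: w_def)
    thus "y \<in> fixed_space (refl_mat w ** A)"
      by (simp add: fixed_space_def matrix_vector_mul_assoc[symmetric] y refl_mat_mult)
  qed
  have "x \<in> fixed_space (refl_mat w ** A)" "x \<notin> fixed_space A"
    using Ax x by (auto simp: fixed_space_def matrix_vector_mul_assoc[symmetric])
  hence "fixed_space A \<subset> fixed_space (refl_mat w ** A)" using sub by blast
  hence "dim (fixed_space A) < dim (fixed_space (refl_mat w ** A))"
    using subspace_fixed_space by (metis dim_psubset span_eq_iff)
  thus thesis
    using that[OF w1] orthogonal_matrix_mul[OF orthogonal_refl_mat[OF w1] A] det_refl_mat[OF w1] by (simp add: det_mul)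
qed

lemma continuous_on_refl_mat_pair:
  "continuous_on S (\<lambda>v. refl_mat w ** (refl_mat v ** (A :: real^'n::finite^'n)))"
  unfolding matrix_matrix_mult_def refl_mat_def
  by (intro continuous_on_vec_lambda) (simp, intro continuous_intros)

text \<open>An element of the group is a product of pairs of reflections, and
  \<open>refl_mat w ** refl_mat v\<close> is deformed to the identity by moving \<open>v\<close> to \<open>w\<close> on the sphere.\<close>

lemma connected_SO: "connected {A :: real^'n::finite^'n. SO_matrix A}"
proof -
  let ?S = "{A :: real^'n^'n. SO_matrix A}"
  have I: "mat 1 \<in> ?S" by (simp add: SO_matrix_def orthogonal_matrix_id)
  have "connected_component ?S (mat 1) A" if "A \<in> ?S" for A
    using that
  proof (induction "CARD('n) - dim (fixed_space A)" arbitrary: A rule: less_induct)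
    case (less A)
    hence A: "orthogonal_matrix A" "det A = 1" by (auto simp: SO_matrix_def)
    show ?case
    proof (cases "A = mat 1")
      case True
      thus ?thesis using I by (simp add: connected_component_refl)
    next
      case False
      obtain w where w: "norm w = 1" "orthogonal_matrix (refl_mat w ** A)" "det (refl_mat w ** A) = - det A"
        "dim (fixed_space A) < dim (fixed_space (refl_mat w ** A))" using refl_enlarges_fixed_space[OF A(1) False] .
      \<comment> \<open>The determinant is now -1, so this is not the identity and a second
        reflection can be split off.\<close>
      have "refl_mat w ** A \<noteq> mat 1" using w(3) A(2) by (metis det_I one_neq_neg_one)
      then obtain v where v: "norm v = 1" "orthogonal_matrix (refl_mat v ** (refl_mat w ** A))"
        "det (refl_mat v ** (refl_mat w ** A)) = - det (refl_mat w ** A)"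
        "dim (fixed_space (refl_mat w ** A)) < dim (fixed_space (refl_mat v ** (refl_mat w ** A)))"
        using refl_enlarges_fixed_space[OF w(2)] by blast
      define B where "B = refl_mat v ** (refl_mat w ** A)"
      have B: "B \<in> ?S" using v w A by (simp add: SO_matrix_def B_def)
      have dn: "dim (fixed_space B) \<le> CARD('n)" using dim_subset_UNIV[of "fixed_space B"] by simp
      have c1: "connected_component ?S (mat 1) B"
        by (rule less.hyps[OF _ B]) (use w(4) v(4) dn in \<open>auto simp: B_def\<close>)
      \<comment> \<open>Two strict increases of the dimension of a fixed space need at least
        dimension 2; this is what makes the unit sphere connected.\<close>
      have c2: "DIM(real^'n) \<ge> 2" using w(4) v(4) dn by (simp add: B_def)
      let ?T = "(\<lambda>u. refl_mat w ** (refl_mat u ** B)) ` sphere 0 1"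
      have "connected ?T"
        by (rule connected_continuous_image[OF continuous_on_refl_mat_pair connected_sphere[OF c2]])
      moreover have "?T \<subseteq> ?S"
      proof (rule image_subsetI, rule CollectI)
        fix u :: "real^'n" assume "u \<in> sphere 0 1"
        hence u: "norm u = 1" by simp
        show "SO_matrix (refl_mat w ** (refl_mat u ** B))"
          using B orthogonal_matrix_mul[OF orthogonal_refl_mat[OF w(1)] orthogonal_matrix_mul[OF orthogonal_refl_mat[OF u], of B]]
          by (simp add: SO_matrix_def det_mul det_refl_mat[OF u] det_refl_mat[OF w(1)])
      qed
      moreover have "B \<in> ?T"
        by (rule image_eqI[of _ _ w]) (use w(1) refl_mat_square[OF w(1)] in \<open>simp_all add: matrix_mul_assoc\<close>)
      moreover have "A \<in> ?T"
      proof (rule image_eqI[of _ _ v])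
        have "refl_mat v ** B = refl_mat w ** A"
          unfolding B_def by (simp add: matrix_mul_assoc refl_mat_square[OF v(1)])
        thus "A = refl_mat w ** (refl_mat v ** B)" by (simp add: matrix_mul_assoc refl_mat_square[OF w(1)])
      qed (use v(1) in simp)
      ultimately have "connected_component ?S B A" unfolding connected_component_def by blast
      thus ?thesis using c1 connected_component_trans by blast
    qed
  qed
  thus ?thesis unfolding connected_iff_connected_component
    by (meson connected_component_sym connected_component_trans)
qed

subsection \<open>Block coordinates\<close>

definition left :: "real^('k::finite + 'm::finite) \<Rightarrow> real^'k" where "left x = (\<chi> i. x $ Inl i)"
definition right :: "real^('k::finite + 'm::finite) \<Rightarrow> real^'m" where "right x = (\<chi> i. x $ Inr i)"
definition join :: "real^'k::finite \<Rightarrow> real^'m::finite \<Rightarrow> real^('k + 'm)" where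
  "join u v = (\<chi> i. case i of Inl a \<Rightarrow> u $ a | Inr b \<Rightarrow> v $ b)"

lemma left_join [simp]: "left (join u v) = u" and right_join [simp]: "right (join u v) = v"
  and join_left_right [simp]: "join (left x) (right x) = x"
  by (auto simp: vec_eq_iff left_def right_def join_def split: sum.split)

lemma linear_left: "linear left" and linear_right: "linear right"
  by (auto simp: linear_iff vec_eq_iff left_def right_def)

lemma join_add: "join (u + u') (v + v') = join u v + join u' v'"
  and join_scaleR: "join (c *\<^sub>R u) (c *\<^sub>R v) = c *\<^sub>R join u v"
  by (auto simp: vec_eq_iff join_def split: sum.split)

lemma join_0: "join 0 0 = 0"
  by (simp add: vec_eq_iff join_def split: sum.split)

lemma sum_UNIV_Plus:
  fixes f :: "'a::finite + 'b::finite \<Rightarrow> real"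
  shows "(\<Sum>i\<in>UNIV. f i) = (\<Sum>i\<in>UNIV. f (Inl i)) + (\<Sum>i\<in>UNIV. f (Inr i))"
proof -
  have "(\<Sum>i\<in>UNIV. f i) = (\<Sum>i\<in>range Inl. f i) + (\<Sum>i\<in>range Inr. f i)"
    unfolding UNIV_sum by (rule sum.union_disjoint) auto
  thus ?thesis by (simp add: sum.reindex)
qed

lemma inner_blocks: "x \<bullet> y = left x \<bullet> left y + right x \<bullet> right y"
  by (simp add: inner_vec_def left_def right_def sum_UNIV_Plus)

lemma inner_join [simp]: "join u v \<bullet> join u' v' = u \<bullet> u' + v \<bullet> v'"
  by (simp add: inner_blocks)

lemma norm_join: "norm (join u v) = sqrt ((norm u)\<^sup>2 + (norm v)\<^sup>2)"
  by (simp add: norm_eq_sqrt_inner)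

lemma norm_join0 [simp]: "norm (join u 0) = norm u" "norm (join 0 v) = norm v"
  by (simp_all add: norm_join)

lemma block_diag_mult: "block_diag A B *v x = join (A *v left x) (B *v right x)"
  by (auto simp: vec_eq_iff matrix_vector_mult_def block_diag_def join_def left_def right_def sum_UNIV_Plus
      split: sum.split)

lemma SO_mat1: "SO_matrix (mat 1)"
  by (simp add: SO_matrix_def orthogonal_matrix_id)

lemma one_dimensional:
  fixes u :: "real^'n::finite"
  assumes "CARD('n) < 2"
  shows "u = (axis undefined 1 \<bullet> u) *\<^sub>R axis undefined 1"
proof (rule vec_eq_iff[THEN iffD2], rule allI)
  fix i :: 'n
  have "CARD('n) = 1" using assms by (metis One_nat_def less_2_cases zero_less_card_finite less_irrefl)
  then obtain c :: 'n where "UNIV = {c}" using card_1_singletonE by blast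
  hence "i = undefined" by (metis UNIV_I singletonD)
  moreover have "axis undefined 1 \<bullet> u = u $ undefined" by (simp add: inner_axis')
  ultimately show "u $ i = ((axis undefined 1 \<bullet> u) *\<^sub>R axis undefined 1) $ i"
    by (simp add: axis_def)
qed

lemma SO_transitive:
  fixes u v :: "real^'n::finite"
  assumes "2 \<le> CARD('n)" "norm u = norm v"
  obtains A where "SO_matrix A" "A *v u = v"
proof -
  obtain f where f: "orthogonal_transformation f" "det (matrix f) = 1" "f u = v"
    using rotation_exists[OF assms] .
  have "orthogonal_matrix (matrix f)" "matrix f *v u = v"
    using f by (auto simp: orthogonal_transformation_matrix)
  thus thesis using that f by (simp add: SO_matrix_def)
qed

definition pr1 :: "real^('k::finite + 'm::finite) \<Rightarrow> real^('k + 'm)" where "pr1 x = join (left x) 0"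
definition pr2 :: "real^('k::finite + 'm::finite) \<Rightarrow> real^('k + 'm)" where "pr2 x = join 0 (right x)"

lemma pr_sum: "x - pr1 x = pr2 x" "x - pr2 x = pr1 x"
proof -
  have "pr1 x + pr2 x = join (left x) (right x)" by (simp add: pr1_def pr2_def flip: join_add)
  thus "x - pr1 x = pr2 x" "x - pr2 x = pr1 x" by (simp_all add: algebra_simps)
qed

lemma linear_pr1: "linear pr1" and linear_pr2: "linear pr2"
  using join_add[of _ _ 0 0] join_scaleR[of _ _ 0] join_add[of 0 0] join_scaleR[of _ 0]
  by (auto simp: linear_iff pr1_def pr2_def linear_add[OF linear_left] linear_add[OF linear_right]
      linear_scale[OF linear_left] linear_scale[OF linear_right])

locale block_symmetric = minkowski F for F :: "real^('k::finite + 'm::finite) \<Rightarrow> real" +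
  assumes inv: "SO_matrix (A :: real^'k^'k) \<Longrightarrow> SO_matrix (B :: real^'m^'m) \<Longrightarrow> F (block_diag A B *v y) = F y"
begin

lemma sym_left:
  assumes "2 \<le> CARD('k)" "right x = right y" "norm (left x) = norm (left y)"
  shows "F x = F y"
proof -
  obtain A where A: "SO_matrix A" "A *v left x = left y" using SO_transitive[OF assms(1,3)] .
  have "block_diag A (mat 1) *v x = join (left y) (right y)" using A assms by (simp add: block_diag_mult)
  thus ?thesis using inv[OF A(1) SO_mat1, of x] by simp
qed

lemma sym_right:
  assumes "2 \<le> CARD('m)" "left x = left y" "norm (right x) = norm (right y)"
  shows "F x = F y"
proof -
  obtain B where B: "SO_matrix B" "B *v right x = right y" using SO_transitive[OF assms(1,3)] .
  have "block_diag (mat 1) B *v x = join (left y) (right y)" using B assms by (simp add: block_diag_mult)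
  thus ?thesis using inv[OF SO_mat1 B(1), of x] by simp
qed

text \<open>The block not projected onto must admit rotations. This version covers last blocks of
  dimension at least 2; otherwise the first block has dimension at least 2 and
  \<open>sym_minkowski_right\<close> applies.\<close>

lemma sym_minkowski_left:
  assumes m: "2 \<le> CARD('m)"
  shows "sym_minkowski F pr1 CARD('k) (join (axis undefined 1) 0)"
proof (intro sym_minkowski.intro sym_minkowski_axioms.intro)
  show "minkowski F" by (rule minkowski_axioms)
  fix x y q :: "real^('k + 'm)"
  show "linear (pr1 :: real^('k + 'm) \<Rightarrow> _)" by (rule linear_pr1)
  show "pr1 (pr1 x) = pr1 x" by (simp add: pr1_def)
  show "pr1 x \<bullet> y = x \<bullet> pr1 y" by (simp add: pr1_def inner_blocks)
  show "F x = F y" if "pr1 x = pr1 y" "norm (x - pr1 x) = norm (y - pr1 y)"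
  proof (rule sym_right[OF m])
    show "left x = left y" using arg_cong[OF that(1), of left] by (simp add: pr1_def)
    show "norm (right x) = norm (right y)" using that(2) by (simp add: pr_sum pr2_def)
  qed
  show "F x = F y" if "\<not> CARD('k) < 2" "x - pr1 x = y - pr1 y" "norm (pr1 x) = norm (pr1 y)"
  proof (rule sym_left)
    show "right x = right y" using arg_cong[OF that(2), of right] by (simp add: pr_sum pr2_def)
    show "norm (left x) = norm (left y)" using that(3) by (simp add: pr1_def)
  qed (use that in simp)
  show "pr1 x = (join (axis undefined 1) 0 \<bullet> x) *\<^sub>R join (axis undefined 1) 0" if "CARD('k) < 2"
  proof -
    have "left x = (axis undefined 1 \<bullet> left x) *\<^sub>R axis undefined 1" by (rule one_dimensional[OF that])
    thus ?thesis by (subst join_scaleR[symmetric]) (simp add: pr1_def inner_blocks)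
  qed
  show "norm (join (axis undefined 1) 0 :: real^('k + 'm)) = 1" by simp
  show "pr1 (join (axis undefined 1) 0) = join (axis undefined 1) 0" by (simp add: pr1_def)
  show "\<exists>Y. norm Y = 1 \<and> pr1 Y = 0 \<and> Y \<bullet> q = 0"
  proof -
    have "2 \<le> DIM(real^'m)" using m by simp
    then obtain z where z: "z \<noteq> 0" "orthogonal (right q) z" using orthogonal_to_vector_exists by blast
    show ?thesis
      by (intro exI[of _ "join 0 ((1 / norm z) *\<^sub>R z)"])
         (use z in \<open>auto simp: pr1_def join_0 inner_blocks orthogonal_def inner_commute\<close>)
  qed
qed

lemma sym_minkowski_right:
  assumes k: "2 \<le> CARD('k)"
  shows "sym_minkowski F pr2 CARD('m) (join 0 (axis undefined 1))"
proof (intro sym_minkowski.intro sym_minkowski_axioms.intro)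
  show "minkowski F" by (rule minkowski_axioms)
  fix x y q :: "real^('k + 'm)"
  show "linear (pr2 :: real^('k + 'm) \<Rightarrow> _)" by (rule linear_pr2)
  show "pr2 (pr2 x) = pr2 x" by (simp add: pr2_def)
  show "pr2 x \<bullet> y = x \<bullet> pr2 y" by (simp add: pr2_def inner_blocks)
  show "F x = F y" if "pr2 x = pr2 y" "norm (x - pr2 x) = norm (y - pr2 y)"
  proof (rule sym_left[OF k])
    show "right x = right y" using arg_cong[OF that(1), of right] by (simp add: pr2_def)
    show "norm (left x) = norm (left y)" using that(2) by (simp add: pr_sum pr1_def)
  qed
  show "F x = F y" if "\<not> CARD('m) < 2" "x - pr2 x = y - pr2 y" "norm (pr2 x) = norm (pr2 y)"
  proof (rule sym_right)
    show "left x = left y" using arg_cong[OF that(2), of left] by (simp add: pr_sum pr1_def)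
    show "norm (right x) = norm (right y)" using that(3) by (simp add: pr2_def)
  qed (use that in simp)
  show "pr2 x = (join 0 (axis undefined 1) \<bullet> x) *\<^sub>R join 0 (axis undefined 1)" if "CARD('m) < 2"
  proof -
    have "right x = (axis undefined 1 \<bullet> right x) *\<^sub>R axis undefined 1" by (rule one_dimensional[OF that])
    thus ?thesis by (subst join_scaleR[symmetric]) (simp add: pr2_def inner_blocks)
  qed
  show "norm (join 0 (axis undefined 1) :: real^('k + 'm)) = 1" by simp
  show "pr2 (join 0 (axis undefined 1)) = join 0 (axis undefined 1)" by (simp add: pr2_def)
  show "\<exists>Y. norm Y = 1 \<and> pr2 Y = 0 \<and> Y \<bullet> q = 0"
  proof -
    have "2 \<le> DIM(real^'k)" using k by simp
    then obtain z where z: "z \<noteq> 0" "orthogonal (left q) z" using orthogonal_to_vector_exists by blast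
    show ?thesis
      by (intro exI[of _ "join ((1 / norm z) *\<^sub>R z) 0"])
         (use z in \<open>auto simp: pr2_def join_0 inner_blocks orthogonal_def inner_commute\<close>)
  qed
qed

lemma G0_orthogonal:
  assumes n3: "CARD('k) + CARD('m) \<ge> 3" and ne: "\<not> euclidean_norm F" and \<Phi>: "\<Phi> \<in> G0"
  shows "linear \<Phi>" "norm (\<Phi> x) = norm x" "pr1 (\<Phi> x) = \<Phi> (pr1 x)"
proof -
  have "linear \<Phi> \<and> norm (\<Phi> x) = norm x \<and> pr1 (\<Phi> x) = \<Phi> (pr1 x)"
  proof (cases "2 \<le> CARD('m)")
    case True
    interpret sym_minkowski F pr1 "CARD('k)" "join (axis undefined 1) 0" by (rule sym_minkowski_left[OF True])
    obtain x0 where "x0 \<noteq> 0" "nonflat x0" using flat_euclidean ne by blast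
    from G0_rigid[OF this \<Phi>] show ?thesis by blast
  next
    case False
    hence k: "2 \<le> CARD('k)" using n3 by simp
    interpret sym_minkowski F pr2 "CARD('m)" "join 0 (axis undefined 1)" by (rule sym_minkowski_right[OF k])
    obtain x0 where "x0 \<noteq> 0" "nonflat x0" using flat_euclidean ne by blast
    note R = G0_rigid[OF this \<Phi>]
    have "pr1 (\<Phi> x) = \<Phi> x - pr2 (\<Phi> x)" by (simp add: pr_sum)
    also have "\<dots> = \<Phi> (x - pr2 x)" unfolding R(3) by (rule linear_diff[OF R(1), symmetric])
    also have "\<dots> = \<Phi> (pr1 x)" by (simp add: pr_sum)
    finally show ?thesis using R by blast
  qed
  thus "linear \<Phi>" "norm (\<Phi> x) = norm x" "pr1 (\<Phi> x) = \<Phi> (pr1 x)" by auto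
qed

text \<open>A determinant with values 1 and -1 that is continuous on a connected set is constant,
  and it is 1 at \<open>id\<close>. The injection \<open>e\<close> stands for \<open>Inl\<close> or
  \<open>Inr\<close>, so that both diagonal blocks are covered.\<close>

lemma G0_det_one:
  assumes one: "\<And>\<Phi>. \<Phi> \<in> G0 \<Longrightarrow> det (M \<Phi>) = 1 \<or> det (M \<Phi>) = -1"
    and M: "M = (\<lambda>\<Phi>. \<chi> i j. \<Phi> (axis (e j) 1) $ e i)" and e: "inj (e :: 'i::finite \<Rightarrow> 'k + 'm)" and \<Phi>: "\<Phi> \<in> G0"
  shows "det (M \<Phi> :: real^'i^'i) = 1"
proof -
  have ev: "continuous_map iso_top euclideanreal (\<lambda>\<Phi>. \<Phi> (axis a 1) $ b)" for a b
  proof -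
    have "continuous_map euclidean euclideanreal (\<lambda>v::real^('k + 'm). v $ b)"
      by (simp add: continuous_intros)
    from continuous_map_compose[OF continuous_map_eval this] show ?thesis by (simp add: o_def)
  qed
  have "continuous_map iso_top euclideanreal (\<lambda>\<Phi>. det (M \<Phi>))"
    unfolding det_def M by (simp, intro continuous_intros ev finite_permutations finite) auto
  hence "connected ((\<lambda>\<Phi>. det (M \<Phi>)) ` G0)" by (rule G0_image_connected)
  moreover have "finite ((\<lambda>\<Phi>. det (M \<Phi>)) ` G0)"
    by (rule finite_subset[of _ "{1, -1}"]) (use one in auto)
  ultimately obtain c where c: "(\<lambda>\<Phi>. det (M \<Phi>)) ` G0 = {c}" using connected_finite_iff_sing G0_id by blast
  have "M id = mat 1" using injD[OF e] by (auto simp: M vec_eq_iff mat_def axis_def)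
  hence "c = 1" using c G0_id det_I by (metis image_eqI singletonD)
  thus ?thesis using c \<Phi> by blast
qed

lemma G0_subset_blocks:
  assumes n3: "CARD('k) + CARD('m) \<ge> 3" and ne: "\<not> euclidean_norm F" and \<Phi>: "\<Phi> \<in> G0"
  shows "\<exists>A B. \<Phi> = (\<lambda>x. block_diag A B *v x) \<and> SO_matrix (A :: real^'k^'k) \<and> SO_matrix (B :: real^'m^'m)"
proof -
  define MA where "MA = (\<lambda>\<Phi> :: real^('k + 'm) \<Rightarrow> real^('k + 'm). (\<chi> i j. \<Phi> (axis (Inl j) 1) $ Inl i) :: real^'k^'k)"
  define MB where "MB = (\<lambda>\<Phi> :: real^('k + 'm) \<Rightarrow> real^('k + 'm). (\<chi> i j. \<Phi> (axis (Inr j) 1) $ Inr i) :: real^'m^'m)"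
  have blocks: "orthogonal_matrix (MA \<Psi>) \<and> orthogonal_matrix (MB \<Psi>) \<and> \<Psi> = (\<lambda>x. block_diag (MA \<Psi>) (MB \<Psi>) *v x)"
    if \<Psi>: "\<Psi> \<in> G0" for \<Psi>
  proof -
    note R = G0_orthogonal[OF n3 ne \<Psi>]
    define f where "f u = left (\<Psi> (join u 0))" for u
    define g where "g v = right (\<Psi> (join 0 v))" for v
    have fj: "\<Psi> (join u 0) = join (f u) 0" for u
    proof -
      have "pr1 (\<Psi> (join u 0)) = \<Psi> (join u 0)" using R(3)[of "join u 0"] by (simp add: pr1_def)
      thus ?thesis by (simp add: pr1_def f_def)
    qed
    have gj: "\<Psi> (join 0 v) = join 0 (g v)" for v
    proof -
      have "pr1 (\<Psi> (join 0 v)) = 0" using R(3)[of "join 0 v"] linear_0[OF R(1)] by (simp add: pr1_def join_0)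
      hence "\<Psi> (join 0 v) = pr2 (\<Psi> (join 0 v))" using pr_sum(1)[of "\<Psi> (join 0 v)"] by simp
      thus ?thesis by (simp add: pr2_def g_def)
    qed
    have jl: "linear (\<lambda>u. join u (0 :: real^'m) :: real^('k + 'm))" "linear (\<lambda>v. join (0 :: real^'k) v :: real^('k + 'm))"
      by (auto simp: linear_iff vec_eq_iff join_def split: sum.split)
    have lf: "linear f" unfolding f_def
      using linear_compose[OF linear_compose[OF jl(1) R(1)] linear_left] by (simp add: o_def)
    have lg: "linear g" unfolding g_def
      using linear_compose[OF linear_compose[OF jl(2) R(1)] linear_right] by (simp add: o_def)
    have nf: "norm (f u) = norm u" for u using R(2)[of "join u 0"] unfolding fj by simp
    have ng: "norm (g v) = norm v" for v using R(2)[of "join 0 v"] unfolding gj by simp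
    have ax: "axis (Inl j) 1 = (join (axis j 1) 0 :: real^('k + 'm))"
             "axis (Inr l) 1 = (join 0 (axis l 1) :: real^('k + 'm))" for j l
      by (auto simp: vec_eq_iff join_def axis_def split: sum.split)
    have mf: "MA \<Psi> = matrix f" "MB \<Psi> = matrix g"
      by (auto simp: MA_def MB_def matrix_def vec_eq_iff ax f_def g_def left_def right_def)
    have "orthogonal_transformation f" "orthogonal_transformation g"
      using lf lg nf ng by (auto simp: orthogonal_transformation)
    hence o: "orthogonal_matrix (MA \<Psi>)" "orthogonal_matrix (MB \<Psi>)"
      unfolding mf by (auto simp: orthogonal_transformation_matrix)
    have "\<Psi> x = block_diag (MA \<Psi>) (MB \<Psi>) *v x" for x
    proof -
      have "x = join (left x) 0 + join 0 (right x)" by (simp flip: join_add)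
      hence "\<Psi> x = \<Psi> (join (left x) 0) + \<Psi> (join 0 (right x))" by (metis linear_add[OF R(1)])
      also have "\<dots> = join (f (left x)) (g (right x))" unfolding fj gj by (simp flip: join_add)
      also have "\<dots> = block_diag (MA \<Psi>) (MB \<Psi>) *v x" unfolding mf block_diag_mult using lf lg by simp
      finally show ?thesis .
    qed
    thus ?thesis using o by blast
  qed
  have "det (MA \<Phi>) = 1"
    by (rule G0_det_one[OF _ MA_def _ \<Phi>]) (use blocks det_orthogonal_matrix in auto)
  moreover have "det (MB \<Phi>) = 1"
    by (rule G0_det_one[OF _ MB_def _ \<Phi>]) (use blocks det_orthogonal_matrix in auto)
  ultimately show ?thesis using blocks[OF \<Phi>] unfolding SO_matrix_def by blast
qed

text \<open>The block matrices are a continuous image of a product of two connected groups and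
  contain \<open>id\<close>, so they lie in its component.\<close>

lemma blocks_subset_G0:
  "{(\<lambda>x. block_diag A B *v x) | A B. SO_matrix (A :: real^'k^'k) \<and> SO_matrix (B :: real^'m^'m)} \<subseteq> G0"
proof -
  define S where "S = {A :: real^'k^'k. SO_matrix A} \<times> {B :: real^'m^'m. SO_matrix B}"
  define h where "h z x = block_diag (fst z) (snd z) *v x" for z :: "(real^'k^'k) \<times> (real^'m^'m)" and x
  have cS: "connected S" unfolding S_def by (intro connected_Times connected_SO)
  have iso: "h z \<in> isometries F" if z: "z \<in> S" for z
    unfolding h_def
  proof (rule linear_isometry)
    have o: "orthogonal_transformation ((*v) (fst z))" "orthogonal_transformation ((*v) (snd z))"
      using z by (auto simp: S_def SO_matrix_def orthogonal_transformation_matrix)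
    show "inj ((*v) (block_diag (fst z) (snd z)))"
    proof (rule injI)
      fix x y assume "block_diag (fst z) (snd z) *v x = block_diag (fst z) (snd z) *v y"
      hence e: "join (fst z *v left x) (snd z *v right x) = join (fst z *v left y) (snd z *v right y)"
        by (simp add: block_diag_mult)
      have "fst z *v left x = fst z *v left y" "snd z *v right x = snd z *v right y"
        using arg_cong[OF e, of left] arg_cong[OF e, of right] by simp_all
      hence "left x = left y" "right x = right y"
        using orthogonal_transformation_inj[OF o(1)] orthogonal_transformation_inj[OF o(2)] by (auto dest: injD)
      thus "x = y" using join_left_right by metis
    qed
    show "F (block_diag (fst z) (snd z) *v x) = F x" for x using z inv by (auto simp: S_def)
  qed simp
  have ch: "continuous_on UNIV (\<lambda>y. h (snd y) (fst y))"
  proof -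
    have b: "continuous_on UNIV (\<lambda>y :: (real^('k + 'm)) \<times> (real^'k^'k) \<times> (real^'m^'m).
        block_diag (fst (snd y)) (snd (snd y)) $ i $ j)" for i j
      by (cases i; cases j) (auto simp: block_diag_def intro!: continuous_intros)
    show ?thesis unfolding h_def matrix_vector_mult_def
      by (intro continuous_on_vec_lambda continuous_on_sum continuous_on_mult b) (intro continuous_intros)
  qed
  have "continuous_map (top_of_set S) iso_top h"
  proof (rule continuous_map_into_subtopology)
    show "continuous_map (top_of_set S) compact_open h"
    proof (rule continuous_map_compact_open)
      fix K V :: "(real^('k + 'm)) set" assume K: "compact K" and V: "open V"
      \<comment> \<open>The matrices that do not map \<open>K\<close> into \<open>V\<close>: the
        projection along the compact set \<open>K\<close> of a closed set, hence closed.\<close>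
      define C where "C = {z. \<exists>x. x \<in> K \<and> (x, z) \<in> (\<lambda>y. h (snd y) (fst y)) -` (- V)}"
      have "closed ((\<lambda>y. h (snd y) (fst y)) -` (- V))"
        using continuous_closed_preimage[OF ch closed_UNIV, of "- V"] V by (simp add: closed_Compl)
      from closed_compact_projection[OF K this] have "closed C" unfolding C_def .
      hence "openin (top_of_set S) (S \<inter> - C)" by (intro openin_open_Int) (simp add: open_Compl)
      moreover have "S \<inter> - C = {z \<in> topspace (top_of_set S). h z ` K \<subseteq> V}" by (auto simp: C_def)
      ultimately show "openin (top_of_set S) {z \<in> topspace (top_of_set S). h z ` K \<subseteq> V}" by simp
    qed
  qed (use iso in auto)
  hence "connectedin iso_top (h ` S)"
    by (rule connectedin_continuous_map_image) (use cS in \<open>simp add: connectedin_subtopology\<close>)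
  moreover have "id \<in> h ` S"
  proof (rule image_eqI[of _ _ "(mat 1, mat 1)"])
    show "id = h (mat 1, mat 1)" by (auto simp: h_def fun_eq_iff block_diag_mult)
  qed (simp add: S_def SO_mat1)
  ultimately have "h ` S \<subseteq> G0" by (rule G0_maximal)
  thus ?thesis by (auto simp: S_def h_def[abs_def] image_subset_iff)
qed

end

theorem theorem1p2:
  fixes F :: "real^('k::finite + 'm::finite) \<Rightarrow> real"
  assumes n3: "CARD('k) + CARD('m) \<ge> 3"
    and mink: "minkowski_norm F"
    and inv: "\<And>A B y. SO_matrix (A :: real^'k^'k) \<Longrightarrow> SO_matrix (B :: real^'m^'m) \<Longrightarrow>
                F (block_diag A B *v y) = F y"
  shows "(\<forall>\<Phi>\<in>isom_identity_component F.
            \<exists>L. linear L \<and> (\<forall>x. x \<noteq> 0 \<longrightarrow> \<Phi> x = L x))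
       \<and> (\<not> euclidean_norm F \<longrightarrow>
            isom_identity_component F =
              {(\<lambda>x. block_diag A B *v x) | A B. SO_matrix A \<and> SO_matrix B})"
proof -
  interpret block_symmetric F by unfold_locales (fact mink, fact inv)
  \<comment> \<open>Euclidean norms are argued separately: only a norm known not to be Euclidean is
    guaranteed to have a curved point.\<close>
  have "linear \<Phi>" if "\<Phi> \<in> isom_identity_component F" for \<Phi>
    using euclidean_isometry_linear[OF _ G0_iso[OF that]] G0_orthogonal(1)[OF n3 _ that] by blast
  moreover have "isom_identity_component F = {(\<lambda>x. block_diag A B *v x) | A B. SO_matrix A \<and> SO_matrix B}"
    if "\<not> euclidean_norm F"
    using G0_subset_blocks[OF n3 that] blocks_subset_G0 by blast
  ultimately show ?thesis by blast
qed

end
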